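(* Consider the array of $q$ discrete-time systems $$x_i^+=Ax_i+\sum_{j=1}^q B_{ij}u_{ij},\qquad y_{ij}=C_{ij}(x_i-x_j),\qquad i,j=1,\dots,q,$$ where $x_i\in\mathbb R^n$, $A\in\mathbb R^{n\times n}$, $u_{ij}=u_{ji}\in\mathbb R^{p_{ij}}$, $B_{ij}=-B_{ji}\in\mathbb R^{n\times p_{ij}}$, $y_{ij}=y_{ji}\in\mathbb R^{m_{ij}}$, $C_{ij}=-C_{ji}\in\mathbb R^{m_{ij}\times n}$, and assume that the array is both controllable and observable (in the relative sense defined in the context). Let $N_{\rm c},N_{\rm o}\ge n$ be integers and $\tau_{\rm c},\tau_{\rm o}>0$ be real numbers, and let the inputs $u_{ij}[k]$, $k=0,1,2,\dots$, be generated from the outputs $y_{ij}[k]$ by the following algorithm. For each $k$, let $w_{ij}[k,t)\in(\mathbb R^{p_{ij}})^{N_{\rm c}}$, $\lambda_i[k,t)\in\mathbb R^n$, $\xi_i[k,t)\in\mathbb R^n$ be the solutions, as functions of the continuous variable $t\geq 0$, of the differential equations (dot denotes $d/dt$) $$\dot w_{ij}[k,t)=-w_{ij}[k,t)-[B_{ij}\ AB_{ij}\ \cdots\ A^{N_{\rm c}-1}B_{ij}]^T(\lambda_i[k,t)-\lambda_j[k,t)),$$ $$\dot\lambda_i[k,t)=A^{N_{\rm c}}\hat x_i[k]+\sum_{j=1}^q[B_{ij}\ AB_{ij}\ \cdots\ A^{N_{\rm c}-1}B_{ij}]\,w_{ij}[k,t),$$ $$\dot\xi_i[k,t)=-\sum_{\ell=0}^{N_{\rm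 o}-1}\sum_{j=1}^q A^{\ell T}C_{ij}^TC_{ij}A^{\ell}(\xi_i[k,t)-\xi_j[k,t))+\sum_{j=1}^q A^{(N_{\rm o}-1)T}C_{ij}^T\big(y_{ij}[k]-C_{ij}(\hat x_i[k]-\hat x_j[k])\big),$$ with initial conditions $w_{ij}[k,0)=0$, $\lambda_i[k,0)=0$, $\xi_i[k,0)=0$; let $$u_{ij}[k]=\big[[0\ \cdots\ 0\ 1]\otimes I_{p_{ij}}\big]w_{ij}[k,\tau_{\rm c}),$$ where the row vector $[0\ \cdots\ 0\ 1]$ has $N_{\rm c}$ entries; and let $$\hat x_i[k+1]=A\hat x_i[k]+A^{N_{\rm o}}\xi_i[k,\tau_{\rm o})+\sum_{j=1}^q B_{ij}u_{ij}[k],$$ with $\hat x_i[0]\in\mathbb R^n$ arbitrary. Then there exist real numbers $\bar\tau_{\rm c}$ and $\bar\tau_{\rm o}$ such that if $\tau_{\rm c}>\bar\tau_{\rm c}$ and $\tau_{\rm o}>\bar\tau_{\rm o}$, then the systems synchronize, i.e., $\|x_i[k]-x_j[k]\|\to0$ as $k\to\infty$ for all pairs $(i,j)$ and all initial conditions $x_1[0],\dots,x_q[0]$.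
   Context: $x_i^+$ denotes the state at the next discrete time instant; $x_i[k]$, $u_{ij}[k]$, $y_{ij}[k]$, $\hat x_i[k]$ are values at discrete time $k=0,1,2,\dots$. The equality $u_{ij}=u_{ji}$ means that these are two names for one variable (similarly $y_{ij}=y_{ji}$); $p_{ij}=p_{ji}$, $m_{ij}=m_{ji}$; and $B_{ii}=0$, $C_{ii}=0$. $M^{\ell T}$ means $(M^\ell)^T$. Let $\mathbf A=I_q\otimes A$. Let $\mathbf B$ be the matrix with $q$ block rows of height $n$ and one block column for each pair $(i,j)$ with $1\le i<j\le q$ (pairs in lexicographic order), where the block column of $(i,j)$ has $B_{ij}$ in block row $i$, $-B_{ij}$ in block row $j$, and zeros elsewhere. Let $\mathbf C$ be the matrix with $q$ block columns of width $n$ and one block row for each pair $i<j$ (same order), where the block row of $(i,j)$ has $C_{ij}$ in block column $i$, $-C_{ij}$ in block column $j$, and zeros elsewhere. Let $\mathcal S_n={\rm range}\,[\mathbf 1_q\otimes I_n]\subset(\mathbb R^n)^q$, where $\mathbf 1_q\in\mathbb R^q$ is the vector of all ones, and let $\mathcal S_n^\perp$ be its orthogonal complement. The array is called controllable if ${\rm range}\,[\mathbf B\ \mathbf A\mathbf B\ \cdots\ \mathbf A^{n-1}\mathbf B]\supset\mathcal S_n^\perp$. It is called observable if ${\rm null}\,\mathbf W_{\rm o}\subset\mathcal S_n$, where $\mathbf W_{\rm o}$ is obtained by stacking $\mathbf C,\mathbf C\mathbf A,\dots,\mathbf C\mathbf A^{n-1}$ vertically. *)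

theory Defs
  imports Complex_Main "Jordan_Normal_Form.Matrix_Kernel"
begin

text \<open>
  The dimensions \<open>p i j\<close> and \<open>m i j\<close> depend on the pair \<open>(i, j)\<close>, hence matrices with explicit
  carriers. Systems are numbered \<open>0, \<dots>, q - 1\<close>. Quantities attached to an
  unordered pair of systems are indexed by ordered pairs \<open>(i, j)\<close>, so that each occurs under two
  names; \<open>big_B\<close> and \<open>big_C\<close> use only \<open>i < j\<close>.
\<close>

definition hcat :: "nat \<Rightarrow> real mat list \<Rightarrow> real mat" where
  "hcat nr Ms = foldr (\<lambda>M N. four_block_mat M N (0\<^sub>m 0 (dim_col M)) (0\<^sub>m 0 (dim_col N))) Ms (0\<^sub>m nr 0)"

definition vcat :: "nat \<Rightarrow> real mat list \<Rightarrow> real mat" where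
  "vcat nc Ms = foldr (\<lambda>M N. M @\<^sub>r N) Ms (0\<^sub>m 0 nc)"

definition kron :: "real mat \<Rightarrow> real mat \<Rightarrow> real mat" where
  "kron M N = mat (dim_row M * dim_row N) (dim_col M * dim_col N)
     (\<lambda>(r, c). M $$ (r div dim_row N, c div dim_col N) * N $$ (r mod dim_row N, c mod dim_col N))"

definition ctrb_mat :: "real mat \<Rightarrow> real mat \<Rightarrow> nat \<Rightarrow> real mat" where
  "ctrb_mat A B N = hcat (dim_row B) (map (\<lambda>l. A ^\<^sub>m l * B) [0..<N])"

definition obsv_mat :: "real mat \<Rightarrow> real mat \<Rightarrow> nat \<Rightarrow> real mat" where
  "obsv_mat A C N = vcat (dim_col C) (map (\<lambda>l. C * A ^\<^sub>m l) [0..<N])"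

definition mat_range :: "real mat \<Rightarrow> real vec set" where
  "mat_range M = (\<lambda>v. M *\<^sub>v v) ` carrier_vec (dim_col M)"

definition relative_array ::
  "nat \<Rightarrow> nat \<Rightarrow> (nat \<Rightarrow> nat \<Rightarrow> nat) \<Rightarrow> (nat \<Rightarrow> nat \<Rightarrow> nat) \<Rightarrow> real mat \<Rightarrow>
   (nat \<Rightarrow> nat \<Rightarrow> real mat) \<Rightarrow> (nat \<Rightarrow> nat \<Rightarrow> real mat) \<Rightarrow> bool" where
  "relative_array q n p m A B C \<longleftrightarrow>
     A \<in> carrier_mat n n \<and>
     (\<forall>i<q. \<forall>j<q.
        p i j = p j i \<and> m i j = m j i \<and>
        B i j \<in> carrier_mat n (p i j) \<and> C i j \<in> carrier_mat (m i j) n \<and>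
        B i j = - B j i \<and> C i j = - C j i) \<and>
     (\<forall>i<q. B i i = 0\<^sub>m n (p i i) \<and> C i i = 0\<^sub>m (m i i) n)"

definition pairs :: "nat \<Rightarrow> (nat \<times> nat) list" where
  "pairs q = concat (map (\<lambda>i. map (\<lambda>j. (i, j)) [Suc i..<q]) [0..<q])"

definition big_A :: "nat \<Rightarrow> real mat \<Rightarrow> real mat" where
  "big_A q A = kron (1\<^sub>m q) A"

definition big_B :: "nat \<Rightarrow> nat \<Rightarrow> (nat \<Rightarrow> nat \<Rightarrow> nat) \<Rightarrow> (nat \<Rightarrow> nat \<Rightarrow> real mat) \<Rightarrow> real mat" where
  "big_B q n p B = hcat (q * n)
     (map (\<lambda>(i, j). vcat (p i j)
        (map (\<lambda>k. if k = i then B i j else if k = j then - B i j else 0\<^sub>m n (p i j)) [0..<q]))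
      (pairs q))"

definition big_C :: "nat \<Rightarrow> nat \<Rightarrow> (nat \<Rightarrow> nat \<Rightarrow> nat) \<Rightarrow> (nat \<Rightarrow> nat \<Rightarrow> real mat) \<Rightarrow> real mat" where
  "big_C q n m C = vcat (q * n)
     (map (\<lambda>(i, j). hcat (m i j)
        (map (\<lambda>k. if k = i then C i j else if k = j then - C i j else 0\<^sub>m (m i j) n) [0..<q]))
      (pairs q))"

definition sync_subspace :: "nat \<Rightarrow> nat \<Rightarrow> real vec set" where
  "sync_subspace q n = mat_range (kron (mat q 1 (\<lambda>_. 1)) (1\<^sub>m n))"

definition array_controllable ::
  "nat \<Rightarrow> nat \<Rightarrow> (nat \<Rightarrow> nat \<Rightarrow> nat) \<Rightarrow> real mat \<Rightarrow> (nat \<Rightarrow> nat \<Rightarrow> real mat) \<Rightarrow> bool" where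
  "array_controllable q n p A B \<longleftrightarrow>
     vec_module.orthogonal_complement (q * n) (sync_subspace q n)
       \<subseteq> mat_range (ctrb_mat (big_A q A) (big_B q n p B) n)"

definition array_observable ::
  "nat \<Rightarrow> nat \<Rightarrow> (nat \<Rightarrow> nat \<Rightarrow> nat) \<Rightarrow> real mat \<Rightarrow> (nat \<Rightarrow> nat \<Rightarrow> real mat) \<Rightarrow> bool" where
  "array_observable q n m A C \<longleftrightarrow>
     mat_kernel (obsv_mat (big_A q A) (big_C q n m C) n) \<subseteq> sync_subspace q n"

abbreviation vsum :: "nat \<Rightarrow> (nat \<Rightarrow> real vec) \<Rightarrow> nat set \<Rightarrow> real vec" where
  "vsum \<equiv> finsum_vec TYPE(real)"

definition vnorm :: "real vec \<Rightarrow> real" where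
  "vnorm v = sqrt (v \<bullet> v)"

text \<open>Componentwise derivative at \<open>t\<close> of a function on \<open>[0, \<infinity>)\<close>, one-sided at \<open>t = 0\<close>.\<close>

definition vec_has_deriv :: "(real \<Rightarrow> real vec) \<Rightarrow> real vec \<Rightarrow> real \<Rightarrow> bool" where
  "vec_has_deriv f d t \<longleftrightarrow>
     (\<forall>r<dim_vec d. ((\<lambda>s. f s $ r) has_real_derivative d $ r) (at t within {0..}))"

text \<open>The second argument of \<open>x\<close>, \<open>xh\<close> and the third of \<open>u\<close>, \<open>y\<close> is the discrete time.\<close>

definition array_trajectory ::
  "nat \<Rightarrow> nat \<Rightarrow> (nat \<Rightarrow> nat \<Rightarrow> nat) \<Rightarrow> real mat \<Rightarrow> (nat \<Rightarrow> nat \<Rightarrow> real mat) \<Rightarrow>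
   (nat \<Rightarrow> nat \<Rightarrow> real mat) \<Rightarrow> (nat \<Rightarrow> nat \<Rightarrow> nat \<Rightarrow> real vec) \<Rightarrow>
   (nat \<Rightarrow> nat \<Rightarrow> real vec) \<Rightarrow> (nat \<Rightarrow> nat \<Rightarrow> nat \<Rightarrow> real vec) \<Rightarrow> bool" where
  "array_trajectory q n p A B C u x y \<longleftrightarrow>
     (\<forall>k.
       (\<forall>i<q. \<forall>j<q. u i j k \<in> carrier_vec (p i j) \<and> u i j k = u j i k \<and>
                     y i j k = C i j *\<^sub>v (x i k - x j k)) \<and>
       (\<forall>i<q. x i k \<in> carrier_vec n \<and>
              x i (Suc k) = A *\<^sub>v x i k + vsum n (\<lambda>j. B i j *\<^sub>v u i j k) {..<q}))"

definition control_flow ::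
  "nat \<Rightarrow> nat \<Rightarrow> (nat \<Rightarrow> nat \<Rightarrow> nat) \<Rightarrow> real mat \<Rightarrow> (nat \<Rightarrow> nat \<Rightarrow> real mat) \<Rightarrow> nat \<Rightarrow>
   (nat \<Rightarrow> real vec) \<Rightarrow> (nat \<Rightarrow> nat \<Rightarrow> real \<Rightarrow> real vec) \<Rightarrow> (nat \<Rightarrow> real \<Rightarrow> real vec) \<Rightarrow> bool" where
  "control_flow q n p A B N xh w lam \<longleftrightarrow>
     (\<forall>i<q. \<forall>j<q. w i j 0 = 0\<^sub>v (N * p i j)) \<and> (\<forall>i<q. lam i 0 = 0\<^sub>v n) \<and>
     (\<forall>t\<ge>0.
       (\<forall>i<q. \<forall>j<q. w i j t \<in> carrier_vec (N * p i j) \<and>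
          vec_has_deriv (w i j)
            (- w i j t - (ctrb_mat A (B i j) N)\<^sup>T *\<^sub>v (lam i t - lam j t)) t) \<and>
       (\<forall>i<q. lam i t \<in> carrier_vec n \<and>
          vec_has_deriv (lam i)
            (A ^\<^sub>m N *\<^sub>v xh i + vsum n (\<lambda>j. ctrb_mat A (B i j) N *\<^sub>v w i j t) {..<q}) t))"

definition estimation_flow ::
  "nat \<Rightarrow> nat \<Rightarrow> real mat \<Rightarrow> (nat \<Rightarrow> nat \<Rightarrow> real mat) \<Rightarrow> nat \<Rightarrow>
   (nat \<Rightarrow> real vec) \<Rightarrow> (nat \<Rightarrow> nat \<Rightarrow> real vec) \<Rightarrow> (nat \<Rightarrow> real \<Rightarrow> real vec) \<Rightarrow> bool" where
  "estimation_flow q n A C N xh y xi \<longleftrightarrow>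
     (\<forall>i<q. xi i 0 = 0\<^sub>v n) \<and>
     (\<forall>t\<ge>0. \<forall>i<q. xi i t \<in> carrier_vec n \<and>
        vec_has_deriv (xi i)
          (- vsum n (\<lambda>l. vsum n (\<lambda>j.
               ((A ^\<^sub>m l)\<^sup>T * (C i j)\<^sup>T * C i j * A ^\<^sub>m l) *\<^sub>v (xi i t - xi j t)) {..<q}) {..<N}
           + vsum n (\<lambda>j.
               ((A ^\<^sub>m (N - 1))\<^sup>T * (C i j)\<^sup>T) *\<^sub>v (y i j - C i j *\<^sub>v (xh i - xh j))) {..<q}) t)"

definition last_block_mat :: "nat \<Rightarrow> nat \<Rightarrow> real mat" where
  "last_block_mat N d = kron (mat 1 N (\<lambda>(_, c). if c = N - 1 then 1 else 0)) (1\<^sub>m d)"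

definition sync_algorithm ::
  "nat \<Rightarrow> nat \<Rightarrow> (nat \<Rightarrow> nat \<Rightarrow> nat) \<Rightarrow> real mat \<Rightarrow> (nat \<Rightarrow> nat \<Rightarrow> real mat) \<Rightarrow>
   (nat \<Rightarrow> nat \<Rightarrow> real mat) \<Rightarrow> nat \<Rightarrow> nat \<Rightarrow> real \<Rightarrow> real \<Rightarrow>
   (nat \<Rightarrow> nat \<Rightarrow> nat \<Rightarrow> real vec) \<Rightarrow> (nat \<Rightarrow> nat \<Rightarrow> nat \<Rightarrow> real vec) \<Rightarrow>
   (nat \<Rightarrow> nat \<Rightarrow> real vec) \<Rightarrow> (nat \<Rightarrow> nat \<Rightarrow> nat \<Rightarrow> real \<Rightarrow> real vec) \<Rightarrow>
   (nat \<Rightarrow> nat \<Rightarrow> real \<Rightarrow> real vec) \<Rightarrow> (nat \<Rightarrow> nat \<Rightarrow> real \<Rightarrow> real vec) \<Rightarrow> bool" where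
  "sync_algorithm q n p A B C Nc No \<tau>c \<tau>o y u xh w lam xi \<longleftrightarrow>
     (\<forall>k.
       control_flow q n p A B Nc (\<lambda>i. xh i k) (\<lambda>i j. w i j k) (\<lambda>i. lam i k) \<and>
       estimation_flow q n A C No (\<lambda>i. xh i k) (\<lambda>i j. y i j k) (\<lambda>i. xi i k) \<and>
       (\<forall>i<q. \<forall>j<q. u i j k = last_block_mat Nc (p i j) *\<^sub>v w i j k \<tau>c) \<and>
       (\<forall>i<q. xh i k \<in> carrier_vec n \<and>
              xh i (Suc k) = A *\<^sub>v xh i k + A ^\<^sub>m No *\<^sub>v xi i k \<tau>o
                + vsum n (\<lambda>j. B i j *\<^sub>v u i j k) {..<q}))"

definition synchronizes :: "nat \<Rightarrow> (nat \<Rightarrow> nat \<Rightarrow> real vec) \<Rightarrow> bool" where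
  "synchronizes q x \<longleftrightarrow> (\<forall>i<q. \<forall>j<q. (\<lambda>k. vnorm (x i k - x j k)) \<longlonglongrightarrow> 0)"

end

theory Submission
  imports Defs "HOL-Analysis.Inner_Product" "HOL-Library.Poly_Mapping"
begin

text \<open>
  Modulo the synchronization subspace, the two flows converge exponentially: the first to the
  minimum energy input sequence steering the estimate to synchronization in \<open>Nc\<close> steps, the second
  to the solution of a least squares problem. Eliminating the inputs \<open>w\<close> leaves
  \<open>\<lambda>' = A\<^sup>N x + z\<close>, \<open>z' = - z - G \<lambda>\<close>, with the Gramian \<open>G = (\<Sum>l<N. A\<^sup>l L A\<^sup>l\<^sup>T)\<close> of the Laplacian
  \<open>L\<close> of the weights \<open>B i j * (B i j)\<^sup>T\<close>.

  At equilibrium the control law is receding horizon control with terminal constraint. Its cost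
  \<open>\<langle>\<lambda>, G \<lambda>\<rangle>\<close> decreases along the closed loop, and the decrease over \<open>N\<close> steps bounds the cost up to a
  constant, so the closed loop is exponentially stable; \<open>A\<close> need not be invertible. The estimation
  error obeys the adjoint of such a closed loop, for \<open>A\<^sup>T\<close> and \<open>C\<^sup>T\<close>. Stopping the flows after a long
  finite time perturbs both linear maps by an arbitrarily small relative error, which a contraction
  tolerates; the estimation error then enters the control loop as a vanishing disturbance.
\<close>

section \<open>Receding horizon control on an inner product space\<close>

text \<open>The obstacle is that \<open>A\<close> may be singular: \<open>costate x\<close> vanishes
  as soon as \<open>(A ^^ Suc K) (P x) = 0\<close>, so the cost does not bound the state. The
  Lyapunov argument therefore runs on costates, which \<open>A'\<close> carries backwards along the
  closed loop up to an error paid for by the decrease of the cost. The state comes back only after a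
  full horizon, when \<open>A ^^ Suc K\<close> turns the open-loop part of it into
  \<open>G (Suc K) (costate x)\<close>. One step of decrease controls directly only the summand of
  the cost with the power \<open>K\<close>; the lower powers are reached through the costates of
  later steps, at a constant that doubles each time. The dimension of the state space is not that of
  a type. Invertibility and boundedness are therefore drawn from a finite orthonormal set
  \<open>E\<close> whose span contains the range of \<open>P\<close>, and the coercivity of the
  Gramian from a bound for its inverse. The errors of the stopped flows have to be relative to the
  disagreement: an absolute error, however small, would leave a residual offset.\<close>

lemma inner_extensionality: "(\<And>z. inner x z = inner y z) \<Longrightarrow> x = y"
  for x y :: "'a::real_inner"
  using inner_eq_zero_iff[of "x - y"] by (simp add: inner_diff_left)

lemma orthonormal_independent:
  fixes E :: "'a::real_inner set"
  assumes "\<And>e e'. e \<in> E \<Longrightarrow> e' \<in> E \<Longrightarrow> inner e e' = (if e = e' then 1 else 0)"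
  shows "independent E"
  unfolding independent_explicit_module
proof (intro allI impI)
  fix t u v
  assume t: "finite t" "t \<subseteq> E" and s: "(\<Sum>v\<in>t. u v *\<^sub>R v) = 0" and v: "v \<in> t"
  have "0 = inner (\<Sum>w\<in>t. u w *\<^sub>R w) v"
    using s by simp
  also have "\<dots> = (\<Sum>w\<in>t. u w * (if w = v then 1 else 0))"
    unfolding inner_sum_left using t v by (intro sum.cong) (auto simp: assms subset_iff)
  also have "\<dots> = u v"
    using t v by (simp add: if_distrib sum.delta cong: if_cong)
  finally show "u v = 0" by simp
qed

text \<open>Rank-nullity by counting: an injective \<open>T\<close> maps \<open>E\<close> to
  \<open>card E\<close> independent vectors of \<open>span E\<close>, and a \<open>y\<close> outside
  their span would make one more than \<open>span E\<close> can hold.\<close>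

lemma linear_inj_on_span_surj:
  fixes T :: "'a::real_vector \<Rightarrow> 'a"
  assumes T: "linear T" and E: "finite E" "independent E"
    and maps: "\<And>x. x \<in> span E \<Longrightarrow> T x \<in> span E"
    and ker: "\<And>x. x \<in> span E \<Longrightarrow> T x = 0 \<Longrightarrow> x = 0"
    and y: "y \<in> span E"
  shows "\<exists>x\<in>span E. T x = y"
proof -
  have inj: "inj_on T (span E)"
    using linear_injective_on_subspace_0[OF T subspace_span] ker by blast
  have ind: "independent (T ` E)"
    by (rule linear_independent_injective_image[OF T E(2) inj])
  have card: "card (T ` E) = card E"
    using inj span_superset[of E] by (intro card_image) (auto intro: inj_on_subset)
  have sub: "T ` E \<subseteq> span E"
    using maps span_superset by blast
  have "y \<in> span (T ` E)"
  proof (rule ccontr)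
    assume n: "y \<notin> span (T ` E)"
    then have "independent (insert y (T ` E))"
      using ind independent_insertI by blast
    then have "card (insert y (T ` E)) \<le> card E"
      using real_vector.independent_span_bound[OF E(1)] sub y by blast
    moreover have "y \<notin> T ` E"
      using n span_superset by blast
    ultimately show False
      using card E(1) by simp
  qed
  then show ?thesis
    using linear_span_image[OF T, of E] by auto
qed

text \<open>In infinite dimension linearity does not give continuity. Here the hypothesis writes
  \<open>f\<close> as a finite sum (an empty one if \<open>E\<close> is infinite) of the bounded
  functionals \<open>inner x e\<close> times fixed vectors.\<close>

lemma linear_coordinates_bounded:
  fixes f :: "'a::real_inner \<Rightarrow> 'b::real_normed_vector"
  assumes f: "linear f" and E: "\<And>x. f (\<Sum>e\<in>E. inner x e *\<^sub>R e) = f x"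
  shows "bounded_linear f"
proof -
  have "f = (\<lambda>x. \<Sum>e\<in>E. inner x e *\<^sub>R f e)"
  proof
    show "f x = (\<Sum>e\<in>E. inner x e *\<^sub>R f e)" for x
      by (subst E[symmetric]) (simp add: linear_sum[OF f] linear_cmul[OF f])
  qed
  moreover have "bounded_linear (\<lambda>x. \<Sum>e\<in>E. inner x e *\<^sub>R f e)"
    by (intro bounded_linear_sum bounded_linear_scaleR_left[THEN bounded_linear_compose]
        bounded_linear_inner_left)
  ultimately show ?thesis by simp
qed

lemma bounded_linear_funpow:
  fixes f :: "'a::real_normed_vector \<Rightarrow> 'a"
  shows "bounded_linear f \<Longrightarrow> bounded_linear (f ^^ k)"
  by (induction k) (auto simp: o_def id_def intro: bounded_linear_compose bounded_linear_ident)

lemma adjoint_funpow: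
  fixes f g :: "'a::real_inner \<Rightarrow> 'a"
  assumes "\<And>x y. inner (f x) y = inner x (g y)"
  shows "inner ((f ^^ k) x) y = inner x ((g ^^ k) y)"
  by (induction k arbitrary: x y) (simp_all add: assms funpow_swap1)

lemma funpow_commute:
  fixes f g :: "'a \<Rightarrow> 'a"
  assumes "\<And>x. f (g x) = g (f x)"
  shows "(f ^^ k) (g x) = g ((f ^^ k) x)"
  by (induction k) (simp_all add: assms)

text \<open>\<open>P\<close> projects onto the space on which the Gramian is invertible. Control uses \<open>A\<close> with its
  adjoint \<open>A'\<close>; estimation is the same situation with \<open>A\<close> and \<open>A'\<close> exchanged. The horizon is
  \<open>Suc K\<close>, since \<open>A'\<^sup>K\<close> is what enters the feedback law.\<close>

locale horizon =
  fixes A A' L P :: "'a::real_inner \<Rightarrow> 'a" and E :: "'a set" and K :: nat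
  assumes bl_A: "bounded_linear A" and bl_A': "bounded_linear A'"
    and bl_L: "bounded_linear L" and bl_P: "bounded_linear P"
    and adj: "inner (A x) y = inner x (A' y)"
    and L_sym: "inner (L x) y = inner x (L y)" and L_ge0: "0 \<le> inner x (L x)"
    and P_idem [simp]: "P (P x) = P x" and P_sym: "inner (P x) y = inner x (P y)"
    and P_A: "P (A x) = A (P x)" and L_P [simp]: "L (P x) = L x"
    and fin_E: "finite E"
    and on_E: "e \<in> E \<Longrightarrow> e' \<in> E \<Longrightarrow> inner e e' = (if e = e' then 1 else 0)"
    and P_E: "(\<Sum>e\<in>E. inner (P x) e *\<^sub>R e) = P x"
    and nondegenerate:
      "(\<And>l. l \<le> K \<Longrightarrow> inner ((A' ^^ l) x) (L ((A' ^^ l) x)) = 0) \<Longrightarrow> P x = 0"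
begin

lemma lin: "linear A" "linear A'" "linear L" "linear P"
  using bl_A bl_A' bl_L bl_P by (auto intro: bounded_linear.linear)

lemmas lin_simps =
  lin[THEN linear_add] lin[THEN linear_diff] lin[THEN linear_cmul] lin[THEN linear_sum]
  lin[THEN linear_0] lin[THEN linear_neg]

lemma P_A': "P (A' x) = A' (P x)"
  by (rule inner_extensionality) (metis adj P_sym P_A inner_commute)

lemma P_L [simp]: "P (L x) = L x"
  by (rule inner_extensionality) (metis L_sym P_sym L_P inner_commute)

lemma P_funpow_A: "P ((A ^^ l) x) = (A ^^ l) (P x)" "P ((A' ^^ l) x) = (A' ^^ l) (P x)"
  using funpow_commute[of A P] funpow_commute[of A' P] by (simp_all add: P_A P_A')

section \<open>The Gramian and its inverse modulo the kernel of \<open>P\<close>\<close>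

definition G :: "nat \<Rightarrow> 'a \<Rightarrow> 'a" where
  "G k x = (\<Sum>l<k. (A ^^ l) (L ((A' ^^ l) x)))"

lemma lin_funpow: "linear (A ^^ l)" "linear (A' ^^ l)"
  using bounded_linear_funpow[OF bl_A] bounded_linear_funpow[OF bl_A']
  by (auto intro: bounded_linear.linear)

lemmas lin_pow_simps =
  lin_funpow[THEN linear_add] lin_funpow[THEN linear_diff] lin_funpow[THEN linear_cmul]
  lin_funpow[THEN linear_sum] lin_funpow[THEN linear_0] lin_funpow[THEN linear_neg]

lemma bl_G: "bounded_linear (G k)"
  unfolding G_def
  by (intro bounded_linear_sum bounded_linear_funpow[OF bl_A, THEN bounded_linear_compose]
      bl_L[THEN bounded_linear_compose] bounded_linear_funpow[OF bl_A'])

lemmas lin_G = bl_G[THEN bounded_linear.linear]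
lemmas lin_G_simps = lin_G[THEN linear_add] lin_G[THEN linear_diff] lin_G[THEN linear_cmul]
  lin_G[THEN linear_0] lin_G[THEN linear_neg]

lemma adj_pow: "inner ((A ^^ l) x) y = inner x ((A' ^^ l) y)"
  by (rule adjoint_funpow) (rule adj)

lemma G_inner: "inner x (G k y) = (\<Sum>l<k. inner ((A' ^^ l) x) (L ((A' ^^ l) y)))"
  unfolding G_def inner_sum_right by (simp add: adj_pow inner_commute[of x] inner_commute[of "L _"])

lemma G_sym: "inner (G k x) y = inner x (G k y)"
proof -
  have "inner (G k x) y = inner y (G k x)" by (rule inner_commute)
  then show ?thesis
    unfolding G_inner by (simp add: inner_commute[of "(A' ^^ _) y"] L_sym)
qed

lemma G_ge0: "0 \<le> inner x (G k x)"
  unfolding G_inner by (intro sum_nonneg L_ge0)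

lemma G_P [simp]: "G k (P x) = G k x" and P_G [simp]: "P (G k x) = G k x"
  unfolding G_def lin_simps by (simp_all add: P_funpow_A flip: P_funpow_A(2))

lemma G_Suc: "G (Suc k) x = G k x + (A ^^ k) (L ((A' ^^ k) x))"
  by (simp add: G_def)

lemma G_Suc_shift: "G (Suc k) x = L x + A (G k (A' x))"
  unfolding G_def sum.lessThan_Suc_shift lin_simps by (simp add: funpow_swap1)

lemma G_pos: "inner x (G (Suc K) x) = 0 \<Longrightarrow> P x = 0"
  unfolding G_inner
  by (subst (asm) sum_nonneg_eq_0_iff) (auto intro!: L_ge0 nondegenerate)

lemma G_inj: "G (Suc K) x = 0 \<Longrightarrow> P x = 0"
  by (rule G_pos) simp

lemma G_surj: "\<exists>!x. P x = x \<and> G (Suc K) x = P a"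
proof (rule ex_ex1I)
  \<comment> \<open>\<open>G (Suc K)\<close> is injective only on the range of \<open>P\<close>.
    Adding the complementary projection \<open>x - P x\<close> makes it injective on all of
    \<open>span E\<close>, where the dimension count applies, and keeps
    \<open>P (T x) = G (Suc K) x\<close>.\<close>
  define T where "T x = G (Suc K) x + (x - P x)" for x
  have P_in: "P x \<in> span E" for x
    using P_E[of x] by (metis (no_types, lifting) span_base span_scale span_sum)
  have "linear T"
    unfolding T_def
    by (intro linearI) (simp_all add: lin_G_simps lin_simps algebra_simps)
  moreover have "T x \<in> span E" if "x \<in> span E" for x
    unfolding T_def using that P_in P_G by (metis span_add span_diff)
  moreover have "x = 0" if "T x = 0" for x
  proof -
    have "P (T x) = G (Suc K) x"
      by (simp add: T_def lin_simps)
    then have *: "G (Suc K) x = 0"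
      using that by (simp add: lin_simps)
    then show "x = 0"
      using that G_inj[OF *] by (simp add: T_def)
  qed
  ultimately obtain x where x: "T x = P a"
    using linear_inj_on_span_surj[OF _ fin_E orthonormal_independent[OF on_E]] P_in by metis
  have "P (T x) = G (Suc K) x"
    by (simp add: T_def lin_simps)
  with x have "G (Suc K) x = P a" by simp
  then show "\<exists>x. P x = x \<and> G (Suc K) x = P a"
    by (intro exI[of _ "P x"]) simp
next
  fix x y
  assume "P x = x \<and> G (Suc K) x = P a" "P y = y \<and> G (Suc K) y = P a"
  then show "x = y"
    using G_inj[of "x - y"] by (simp add: lin_G_simps lin_simps)
qed

text \<open>The Moore-Penrose inverse of \<open>G (Suc K)\<close>: the kernel and the range of this
  symmetric map are those of \<open>P\<close>.\<close>

definition Gi :: "'a \<Rightarrow> 'a" where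
  "Gi a = (THE x. P x = x \<and> G (Suc K) x = P a)"

lemma P_Gi [simp]: "P (Gi a) = Gi a" and G_Gi [simp]: "G (Suc K) (Gi a) = P a"
  unfolding Gi_def using theI'[OF G_surj[of a]] by auto

lemma Gi_eqI: "P x = x \<Longrightarrow> G (Suc K) x = P a \<Longrightarrow> Gi a = x"
  unfolding Gi_def using G_surj[of a] by (blast intro: the1_equality)

lemma Gi_P [simp]: "Gi (P a) = Gi a"
  by (rule Gi_eqI) simp_all

lemma bl_Gi: "bounded_linear Gi"
proof (rule linear_coordinates_bounded)
  show "linear Gi"
    by (intro linearI Gi_eqI) (simp_all add: lin_G_simps lin_simps)
  show "Gi (\<Sum>e\<in>E. inner x e *\<^sub>R e) = Gi x" for x
  proof -
    \<comment> \<open>Replacing \<open>x\<close> by its expansion in \<open>E\<close> does not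
      change \<open>P x\<close>, because \<open>P\<close> is symmetric with range in
      \<open>span E\<close>; and \<open>Gi\<close> depends on \<open>P x\<close> only.\<close>
    have "P (\<Sum>e\<in>E. inner x e *\<^sub>R e) = P x"
    proof (rule inner_extensionality)
      fix y
      have "inner (P (\<Sum>e\<in>E. inner x e *\<^sub>R e)) y = inner x (\<Sum>e\<in>E. inner e (P y) *\<^sub>R e)"
        unfolding P_sym inner_sum_left inner_sum_right
        by (simp add: inner_commute mult.commute)
      also have "\<dots> = inner (P x) y"
        using P_E[of y] P_sym[of x y] by (simp add: inner_commute)
      finally show "inner (P (\<Sum>e\<in>E. inner x e *\<^sub>R e)) y = inner (P x) y" .
    qed
    then show ?thesis by (metis Gi_P)
  qed
qed

lemmas lin_Gi = bl_Gi[THEN bounded_linear.linear]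

lemma Gi_sym: "inner (Gi x) y = inner x (Gi y)"
  by (metis G_Gi G_sym P_Gi P_sym)

text \<open>The constant is \<open>1 / c\<close> for a bound \<open>c\<close> of \<open>Gi\<close>.
  With \<open>y\<close> equal to \<open>Gi x\<close> divided by \<open>c\<close>, the mixed term of
  the form at \<open>x\<close> and \<open>y\<close> is \<open>(norm (P x))^2 / c\<close>, and the
  form at \<open>y\<close> is at most that; expanding the nonnegative form at \<open>x - y\<close>
  leaves one copy of it as a lower bound at \<open>x\<close>.\<close>

lemma coercive: "\<exists>s>0. \<forall>x. s * (norm (P x))^2 \<le> inner x (G (Suc K) x)"
proof -
  obtain c where c: "c > 0" "\<And>x. norm (Gi x) \<le> norm x * c"
    using bounded_linear.pos_bounded[OF bl_Gi] by auto
  have "(1 / c) * (norm (P x))^2 \<le> inner x (G (Suc K) x)" for x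
  proof -
    define y where "y = (1 / c) *\<^sub>R Gi x"
    have 1: "inner x (G (Suc K) y) = (1 / c) * (norm (P x))^2"
      by (simp add: y_def lin_G_simps) (metis P_idem P_sym dot_square_norm)
    have "inner (Gi x) (P x) \<le> norm (P x) * c * norm (P x)"
      using norm_cauchy_schwarz[of "Gi x" "P x"] c(2)[of "P x"]
      by (simp add: order_trans[OF _ mult_right_mono])
    then have "inner y (G (Suc K) y) \<le> (1 / c)^2 * (norm (P x) * c * norm (P x))"
      unfolding y_def lin_G_simps inner_scaleR_left inner_scaleR_right G_Gi
      using mult_left_mono[of _ _ "(1/c)^2"] by (simp only: power2_eq_square mult.assoc zero_le_square)
    also have "\<dots> = (1 / c) * (norm (P x))^2"
      using c(1) by (simp add: power2_eq_square)
    finally have 2: "inner y (G (Suc K) y) \<le> (1 / c) * (norm (P x))^2" .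
    have "0 \<le> inner (x - y) (G (Suc K) (x - y))"
      by (rule G_ge0)
    also have "\<dots> = inner x (G (Suc K) x) - 2 * inner x (G (Suc K) y) + inner y (G (Suc K) y)"
      using G_sym[of "Suc K" x y]
      by (simp add: lin_G_simps inner_diff_left inner_diff_right inner_commute)
    finally show ?thesis
      using 1 2 by simp
  qed
  then show ?thesis
    using c(1) by (intro exI[of _ "1 / c"]) simp
qed


text \<open>Closed loop of the receding horizon law when the flow is run to its equilibrium.\<close>

definition F :: "'a \<Rightarrow> 'a" where
  "F x = A (P x) - L ((A' ^^ K) (Gi ((A ^^ Suc K) x)))"

text \<open>The equilibrium of \<lambda> in the control flow modulo synchronization, that is, the
  multiplier of the terminal constraint. In the array, \<open>J (costate x)\<close> is the least
  input energy that brings \<open>x\<close> to synchronization in \<open>Suc K\<close>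
  steps.\<close>

definition costate :: "'a \<Rightarrow> 'a" where
  "costate x = Gi ((A ^^ Suc K) x)"

definition J :: "'a \<Rightarrow> real" where
  "J y = inner y (G (Suc K) y)"

lemma P_costate [simp]: "P (costate x) = costate x"
  by (simp add: costate_def)

lemma costate_P [simp]: "costate (P x) = costate x"
  unfolding costate_def by (metis Gi_P P_funpow_A(1))

lemma G_costate: "G (Suc K) (costate x) = (A ^^ Suc K) (P x)"
  unfolding costate_def by (simp only: G_Gi P_funpow_A)

lemma F_costate: "F x = A (P x) - L ((A' ^^ K) (costate x))"
  by (simp add: F_def costate_def)

lemma P_F [simp]: "P (F x) = F x" and F_P [simp]: "F (P x) = F x"
  by (simp_all add: F_costate lin_simps P_A)

lemma bl_costate: "bounded_linear costate"
  unfolding costate_def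
  by (intro bl_Gi[THEN bounded_linear_compose] bounded_linear_funpow[OF bl_A])

lemma bl_F: "bounded_linear F"
  unfolding F_costate
  by (intro bounded_linear_sub bl_A[THEN bounded_linear_compose] bl_P
      bl_L[THEN bounded_linear_compose] bl_costate
      bounded_linear_funpow[OF bl_A', THEN bounded_linear_compose])

text \<open>The input just applied is the one that the plan sends through the highest power
  \<open>A ^^ K\<close>. Taking its contribution out of \<open>G (Suc K)\<close> leaves
  \<open>G K\<close> at the old costate, moved on by one \<open>A\<close>.\<close>

lemma G_costate_F: "G (Suc K) (costate (F x)) = A (G K (costate x))"
proof -
  have "G (Suc K) (costate (F x)) = (A ^^ Suc K) (F x)"
    by (simp only: G_costate P_F)
  also have "\<dots> = A ((A ^^ Suc K) (P x)) - A ((A ^^ K) (L ((A' ^^ K) (costate x))))"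
    by (simp add: F_costate lin_pow_simps lin_simps funpow_swap1)
  also have "\<dots> = A (G K (costate x))"
    by (simp only: G_costate[symmetric] G_Suc lin_simps) simp
  finally show ?thesis .
qed

text \<open>Both \<open>G_Suc\<close> and \<open>G_Suc_shift\<close> split \<open>G (Suc K)\<close>; comparing
  the two splittings completes the square in the decrease of the cost.\<close>

lemma J_decrease:
  fixes x
  defines "y \<equiv> costate x" and "y' \<equiv> costate (F x)"
  defines "d \<equiv> A' y' - y"
  shows "J y - J y' = inner d (G K d) + inner y' (L y') + inner ((A' ^^ K) y) (L ((A' ^^ K) y))"
proof -
  have 1: "J y = inner y (G K y) + inner ((A' ^^ K) y) (L ((A' ^^ K) y))"
    unfolding J_def G_Suc inner_add_right
    by (simp add: adj_pow inner_commute[of y] inner_commute[of "L _"])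
  have 2: "J y' = inner y' (L y') + inner (A' y') (G K (A' y'))"
    unfolding J_def G_Suc_shift inner_add_right by (simp add: adj inner_commute[of y' "A _"] inner_commute[of "G _ _"])
  have 3: "J y' = inner (A' y') (G K y)"
    unfolding J_def y'_def y_def G_costate_F by (metis adj inner_commute)
  have "inner d (G K d) = inner (A' y') (G K (A' y')) - 2 * inner (A' y') (G K y) + inner y (G K y)"
    using G_sym[of K "A' y'" y]
    by (simp add: d_def lin_G_simps inner_diff_left inner_diff_right inner_commute)
  with 1 2 3 show ?thesis by simp
qed

lemma J_ge0: "0 \<le> J y"
  unfolding J_def by (rule G_ge0)

lemma J_mono: "J (costate ((F ^^ (k + i)) x)) \<le> J (costate ((F ^^ k) x))"
proof (induction i)
  case (Suc i)
  have "J (costate (F z)) \<le> J (costate z)" for z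
    using J_decrease[of z] G_ge0 L_ge0 by (smt (verit))
  from this[of "(F ^^ (k + i)) x"] Suc show ?case by simp
qed simp

lemma L_parallelogram: "inner (x + y) (L (x + y)) \<le> 2 * inner x (L x) + 2 * inner y (L y)"
  using L_ge0[of "x - y"] L_sym[of x y]
  by (simp add: lin_simps inner_diff_left inner_diff_right inner_add_left inner_add_right
      inner_commute)

text \<open>A descent from the power \<open>K\<close>. For \<open>i = 0\<close> the seminorm is
  itself a term of \<open>J_decrease\<close>. For a lower power \<open>l < K\<close>,
  \<open>A' (costate (F x))\<close> replaces \<open>costate x\<close> up to \<open>d\<close>, whose
  seminorm at \<open>l\<close> is one summand of \<open>inner d (G K d)\<close> and hence paid for
  by the first step. What remains has the power \<open>Suc l\<close> at the next state, where the
  induction hypothesis applies. Each replacement costs the factor 2 of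
  \<open>L_parallelogram\<close>.\<close>

lemma costate_seminorm_decrease:
  assumes "i \<le> K"
  shows "inner ((A' ^^ (K - i)) (costate x)) (L ((A' ^^ (K - i)) (costate x)))
    \<le> 2 ^ Suc i * (J (costate x) - J (costate ((F ^^ Suc i) x)))"
  using assms
proof (induction i arbitrary: x)
  case 0
  have "inner ((A' ^^ K) (costate x)) (L ((A' ^^ K) (costate x))) \<le> J (costate x) - J (costate (F x))"
    unfolding J_decrease using G_ge0 L_ge0 by simp
  moreover have "0 \<le> J (costate x) - J (costate (F x))"
    using J_mono[of 0 1 x] by simp
  ultimately show ?case by simp
next
  case (Suc i)
  define l where "l = K - Suc i"
  have l: "l < K" "K - i = Suc l"
    using Suc.prems by (auto simp: l_def)
  define d where "d = A' (costate (F x)) - costate x"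
  have drop: "inner ((A' ^^ l) d) (L ((A' ^^ l) d)) \<le> J (costate x) - J (costate (F x))"
  proof -
    have "inner ((A' ^^ l) d) (L ((A' ^^ l) d)) \<le> inner d (G K d)"
      unfolding G_inner using l L_ge0 by (intro member_le_sum) auto
    also have "\<dots> \<le> J (costate x) - J (costate (F x))"
      unfolding J_decrease d_def using L_ge0 by simp
    finally show ?thesis .
  qed
  have eq: "(A' ^^ l) (costate x) = (A' ^^ Suc l) (costate (F x)) + (A' ^^ l) (- d)"
    by (simp add: d_def lin_pow_simps funpow_swap1)
  have "inner ((A' ^^ l) (costate x)) (L ((A' ^^ l) (costate x)))
      \<le> 2 * inner ((A' ^^ Suc l) (costate (F x))) (L ((A' ^^ Suc l) (costate (F x))))
        + 2 * inner ((A' ^^ l) (- d)) (L ((A' ^^ l) (- d)))"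
    unfolding eq by (rule L_parallelogram)
  also have "inner ((A' ^^ l) (- d)) (L ((A' ^^ l) (- d))) = inner ((A' ^^ l) d) (L ((A' ^^ l) d))"
    by (simp only: lin_pow_simps lin_simps inner_minus_left inner_minus_right minus_minus)
  also have "2 * inner ((A' ^^ Suc l) (costate (F x))) (L ((A' ^^ Suc l) (costate (F x))))
      \<le> 2 ^ Suc (Suc i) * (J (costate (F x)) - J (costate ((F ^^ Suc (Suc i)) x)))"
    using Suc.IH[of "F x"] Suc.prems l by (simp add: funpow_swap1)
  also have "2 * inner ((A' ^^ l) d) (L ((A' ^^ l) d))
      \<le> 2 ^ Suc (Suc i) * (J (costate x) - J (costate (F x)))"
  proof -
    have "2 * inner ((A' ^^ l) d) (L ((A' ^^ l) d)) \<le> 2 * (J (costate x) - J (costate (F x)))"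
      using drop by simp
    also have "\<dots> \<le> 2 ^ Suc (Suc i) * (J (costate x) - J (costate (F x)))"
      using J_mono[of 0 1 x] one_le_power[of "2::real" "Suc i"] by (intro mult_right_mono) auto
    finally show ?thesis .
  qed
  finally show ?case
    by (simp add: l_def algebra_simps)
qed

text \<open>The bounds of \<open>costate_seminorm_decrease\<close>, summed over the
  \<open>Suc K\<close> powers, bound the cost by \<open>Suc K * 2 ^ Suc K\<close> times its drop
  over \<open>Suc K\<close> steps. Solved for the new cost, this gives the factor
  \<open>\<rho>\<close>.\<close>

definition \<rho> :: real where
  "\<rho> = 1 - 1 / (real (Suc K) * 2 ^ Suc K)"

lemma \<rho>: "0 \<le> \<rho>" "\<rho> < 1"
proof -
  have "1 * 1 \<le> real (Suc K) * 2 ^ Suc K"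
    by (intro mult_mono one_le_power) auto
  then show "0 \<le> \<rho>" "\<rho> < 1"
    unfolding \<rho>_def by (auto simp: divide_simps)
qed

lemma J_contraction: "J (costate ((F ^^ Suc K) x)) \<le> \<rho> * J (costate x)"
proof -
  define D where "D = J (costate x) - J (costate ((F ^^ Suc K) x))"
  have "inner ((A' ^^ l) (costate x)) (L ((A' ^^ l) (costate x))) \<le> 2 ^ Suc K * D"
    if "l < Suc K" for l
  proof -
    define i where "i = K - l"
    have i: "i \<le> K" "l = K - i"
      using that by (auto simp: i_def)
    have "inner ((A' ^^ l) (costate x)) (L ((A' ^^ l) (costate x)))
      \<le> 2 ^ Suc i * (J (costate x) - J (costate ((F ^^ Suc i) x)))"
      unfolding i(2) by (rule costate_seminorm_decrease[OF i(1)])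
    also have "\<dots> \<le> 2 ^ Suc K * D"
      using J_mono[of "Suc i" "K - i" x] J_mono[of 0 "Suc i" x] i(1)
      unfolding D_def by (intro mult_mono) (auto intro: power_increasing)
    finally show ?thesis .
  qed
  then have "J (costate x) \<le> (\<Sum>l<Suc K. 2 ^ Suc K * D)"
    unfolding J_def G_inner by (intro sum_mono) simp
  then have *: "J (costate x) \<le> (real (Suc K) * 2 ^ Suc K) * D"
    by simp
  have pos: "0 < real (Suc K) * 2 ^ Suc K"
    by simp
  from * have "J (costate x) / (real (Suc K) * 2 ^ Suc K) \<le> D"
    using pos by (simp only: pos_divide_le_eq mult.commute)
  then show ?thesis
    unfolding D_def \<rho>_def by (simp add: left_diff_distrib)
qed

lemma costate_bound: "\<exists>c>0. \<forall>x. norm (costate x) \<le> c * sqrt (J (costate x))"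
proof -
  obtain s where s: "s > 0" "\<And>x. s * (norm (P x))^2 \<le> inner x (G (Suc K) x)"
    using coercive by blast
  have "norm (costate x) \<le> (1 / sqrt s) * sqrt (J (costate x))" for x
  proof -
    have "(norm (costate x))^2 \<le> J (costate x) / s"
      using s(2)[of "costate x"] s(1) by (simp add: J_def pos_le_divide_eq mult.commute)
    then have "norm (costate x) \<le> sqrt (J (costate x) / s)"
      by (rule real_le_rsqrt)
    then show ?thesis by (simp add: real_sqrt_divide)
  qed
  then show ?thesis
    using s(1) by (intro exI[of _ "1 / sqrt s"]) auto
qed

text \<open>Closed and open loop differ by the inputs alone. Each input is bounded by the costate of
  its time, and \<open>J_mono\<close> bounds all of these by the initial cost; so the cost controls
  the deviation although it does not control the state.\<close>

lemma F_pow_deviation: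
  "\<exists>c>0. \<forall>x. norm ((F ^^ i) (P x) - (A ^^ i) (P x)) \<le> c * sqrt (J (costate x))"
proof (induction i)
  case 0
  show ?case by (intro exI[of _ 1]) (simp add: J_ge0)
next
  case (Suc i)
  then obtain c where c: "c > 0"
    "\<And>x. norm ((F ^^ i) (P x) - (A ^^ i) (P x)) \<le> c * sqrt (J (costate x))"
    by blast
  obtain a where a: "a > 0" "\<And>x. norm (A x) \<le> norm x * a"
    using bounded_linear.pos_bounded[OF bl_A] by auto
  obtain b where b: "b > 0" "\<And>x. norm (L ((A' ^^ K) x)) \<le> norm x * b"
    using bounded_linear.pos_bounded[OF bounded_linear_compose[OF bl_L bounded_linear_funpow[OF bl_A']]]
    by auto
  obtain e where e: "e > 0" "\<And>x. norm (costate x) \<le> e * sqrt (J (costate x))"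
    using costate_bound by blast
  have "norm ((F ^^ Suc i) (P x) - (A ^^ Suc i) (P x)) \<le> (c * a + e * b) * sqrt (J (costate x))" for x
  proof -
    define z where "z = (F ^^ i) (P x)"
    have Pz: "P z = z"
      by (cases i) (auto simp: z_def)
    have "(F ^^ Suc i) (P x) - (A ^^ Suc i) (P x)
        = A (z - (A ^^ i) (P x)) - L ((A' ^^ K) (costate z))"
      using Pz by (simp add: F_costate lin_simps flip: z_def)
    then have "norm ((F ^^ Suc i) (P x) - (A ^^ Suc i) (P x))
        \<le> norm (A (z - (A ^^ i) (P x))) + norm (L ((A' ^^ K) (costate z)))"
      by (simp only: norm_triangle_ineq4)
    also have "\<dots> \<le> (c * sqrt (J (costate x))) * a + (e * sqrt (J (costate x))) * b"
    proof (intro add_mono order_trans[OF a(2)] order_trans[OF b(2)] mult_right_mono)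
      show "norm (z - (A ^^ i) (P x)) \<le> c * sqrt (J (costate x))"
        unfolding z_def by (rule c)
      have "J (costate z) \<le> J (costate x)"
        using J_mono[of 0 i "P x"] by (simp add: z_def)
      then show "norm (costate z) \<le> e * sqrt (J (costate x))"
        using e by (smt (verit) mult_left_mono real_sqrt_le_mono)
    qed (use a b in auto)
    finally show ?thesis by (simp add: algebra_simps)
  qed
  then show ?case
    using c a b e by (intro exI[of _ "c * a + e * b"]) (simp add: add_pos_pos)
qed

text \<open>This form of exponential stability passes to the adjoint verbatim and is the hypothesis
  of \<open>contraction_robust\<close>.\<close>

lemma F_exponentially_stable: "\<exists>M>0. \<forall>x. norm ((F ^^ M) x) \<le> norm x / 2"
proof -
  obtain c where c: "c > 0"
    "\<And>x. norm ((F ^^ Suc K) (P x) - (A ^^ Suc K) (P x)) \<le> c * sqrt (J (costate x))"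
    using F_pow_deviation by blast
  obtain e where e: "e > 0" "\<And>x. norm (costate x) \<le> e * sqrt (J (costate x))"
    using costate_bound by blast
  obtain g where g: "g > 0" "\<And>x. norm (G (Suc K) x) \<le> norm x * g"
    using bounded_linear.pos_bounded[OF bl_G] by blast
  obtain h where h: "h > 0" "\<And>x. norm (costate x) \<le> norm x * h"
    using bounded_linear.pos_bounded[OF bl_costate] by blast
  \<comment> \<open>Deviation plus open loop: after a full horizon the open-loop state
    \<open>(A ^^ Suc K) (P x)\<close> equals \<open>G (Suc K) (costate x)\<close>, so both parts are
    bounded by the root of the cost.\<close>
  have step: "norm ((F ^^ Suc K) (P x)) \<le> (c + e * g) * sqrt (J (costate x))" for x
  proof -
    have "norm ((A ^^ Suc K) (P x)) \<le> norm (costate x) * g"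
      using g(2)[of "costate x"] by (simp only: G_costate)
    also have "\<dots> \<le> (e * sqrt (J (costate x))) * g"
      using e g by (intro mult_right_mono) auto
    finally have *: "norm ((A ^^ Suc K) (P x)) \<le> (e * sqrt (J (costate x))) * g" .
    have "norm ((F ^^ Suc K) (P x)) \<le> norm ((F ^^ Suc K) (P x) - (A ^^ Suc K) (P x))
        + norm ((A ^^ Suc K) (P x))"
      by (metis norm_triangle_sub add.commute)
    also have "\<dots> \<le> c * sqrt (J (costate x)) + (e * sqrt (J (costate x))) * g"
      using c(2)[of x] * by (rule add_mono)
    finally show ?thesis by (simp add: algebra_simps)
  qed
  have Jpow: "J (costate ((F ^^ (Suc K * j)) x)) \<le> \<rho> ^ j * J (costate x)" for j x
  proof (induction j)
    case (Suc j)
    have "J (costate ((F ^^ (Suc K * Suc j)) x)) = J (costate ((F ^^ Suc K) ((F ^^ (Suc K * j)) x)))"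
      by (simp only: mult_Suc_right funpow_add o_apply)
    also have "\<dots> \<le> \<rho> * J (costate ((F ^^ (Suc K * j)) x))"
      by (rule J_contraction)
    also have "\<dots> \<le> \<rho> * (\<rho> ^ j * J (costate x))"
      using Suc \<rho> by (intro mult_left_mono)
    finally show ?case by simp
  qed simp
  have J0: "J (costate x) \<le> (norm x * h)^2 * g" for x
  proof -
    have "J (costate x) \<le> norm (costate x) * norm (G (Suc K) (costate x))"
      unfolding J_def by (rule norm_cauchy_schwarz)
    also have "\<dots> \<le> norm (costate x) * (norm (costate x) * g)"
      by (intro mult_left_mono g) auto
    also have "\<dots> = (norm (costate x))^2 * g"
      by (simp add: power2_eq_square)
    also have "\<dots> \<le> (norm x * h)^2 * g"
      using g h by (intro mult_right_mono power_mono) auto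
    finally show ?thesis .
  qed
  define C where "C = (c + e * g) * h * sqrt g"
  have C: "C > 0"
    using c e g h by (simp add: C_def add_pos_pos)
  have bound: "norm ((F ^^ (Suc K + Suc K * j)) x) \<le> C * sqrt (\<rho> ^ j) * norm x" for j x
  proof -
    define z where "z = (F ^^ (Suc K * j)) x"
    \<comment> \<open>The innermost of the last \<open>Suc K\<close> applications of
      \<open>F\<close> projects its argument, so \<open>z\<close> may be replaced by
      \<open>P z\<close>, the form that \<open>step\<close> asks for.\<close>
    have "(F ^^ (Suc K + Suc K * j)) x = (F ^^ Suc K) (P z)"
      by (simp only: funpow_add o_apply z_def[symmetric]) (simp only: funpow_Suc_right o_apply F_P)
    then have "norm ((F ^^ (Suc K + Suc K * j)) x) \<le> (c + e * g) * sqrt (J (costate z))"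
      using step[of z] by simp
    also have "\<dots> \<le> (c + e * g) * sqrt (\<rho> ^ j * ((norm x * h)^2 * g))"
      using c e g Jpow[of j x] J0[of x] \<rho>(1) unfolding z_def
      by (intro mult_left_mono real_sqrt_le_mono order_trans[OF Jpow]) auto
    also have "\<dots> = C * sqrt (\<rho> ^ j) * norm x"
      using h by (simp add: C_def real_sqrt_mult)
    finally show ?thesis .
  qed
  have "(\<lambda>j. C * sqrt (\<rho> ^ j)) \<longlonglongrightarrow> C * sqrt 0"
    using \<rho> by (intro tendsto_intros LIMSEQ_realpow_zero) auto
  then have "\<forall>\<^sub>F j in sequentially. C * sqrt (\<rho> ^ j) < 1 / 2"
    by (rule order_tendstoD) simp
  then obtain j where j: "C * sqrt (\<rho> ^ j) < 1 / 2"
    by (auto simp: eventually_sequentially)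
  have "norm ((F ^^ (Suc K + Suc K * j)) x) \<le> norm x / 2" for x
    using order_trans[OF bound[of j x] mult_right_mono[OF less_imp_le[OF j] norm_ge_zero]] by simp
  then show ?thesis
    by (intro exI[of _ "Suc K + Suc K * j"]) simp
qed

text \<open>Adjoint of \<open>F\<close>: the error map of the estimator, for the dual data.\<close>

definition F' :: "'a \<Rightarrow> 'a" where
  "F' x = A' (P x) - (A' ^^ Suc K) (Gi ((A ^^ K) (L x)))"

lemma F_adjoint: "inner (F x) y = inner x (F' y)"
proof -
  have 1: "inner (A (P x)) y = inner x (A' (P y))"
    by (simp only: adj P_sym P_A')
  have 2: "inner (L ((A' ^^ K) (Gi ((A ^^ Suc K) x)))) y = inner x ((A' ^^ Suc K) (Gi ((A ^^ K) (L y))))"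
  proof -
    have "inner (L ((A' ^^ K) (Gi ((A ^^ Suc K) x)))) y = inner ((A' ^^ K) (Gi ((A ^^ Suc K) x))) (L y)"
      by (rule L_sym)
    also have "\<dots> = inner (Gi ((A ^^ Suc K) x)) ((A ^^ K) (L y))"
      by (metis adj_pow inner_commute)
    finally show ?thesis
      by (simp only: Gi_sym adj_pow)
  qed
  show ?thesis
    unfolding F_def F'_def inner_diff_left inner_diff_right 1 2 ..
qed

lemma bl_F': "bounded_linear F'"
  unfolding F'_def
  by (intro bounded_linear_sub bl_A'[THEN bounded_linear_compose] bl_P
      bounded_linear_funpow[OF bl_A', THEN bounded_linear_compose] bl_Gi[THEN bounded_linear_compose]
      bounded_linear_funpow[OF bl_A, THEN bounded_linear_compose] bl_L)

text \<open>\<open>F' ^^ M\<close> is the adjoint of \<open>F ^^ M\<close>, and adjoint operators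
  have the same norm.\<close>

lemma F'_exponentially_stable: "\<exists>M>0. \<forall>x. norm ((F' ^^ M) x) \<le> norm x / 2"
proof -
  obtain M where M: "M > 0" "\<And>x. norm ((F ^^ M) x) \<le> norm x / 2"
    using F_exponentially_stable by blast
  have "norm ((F' ^^ M) x) \<le> norm x / 2" for x
  proof -
    let ?y = "(F' ^^ M) x"
    have "(norm ?y)^2 = inner ((F ^^ M) ?y) x"
      using adjoint_funpow[of F F' M ?y x] F_adjoint by (simp add: dot_square_norm)
    also have "\<dots> \<le> norm ((F ^^ M) ?y) * norm x"
      by (rule norm_cauchy_schwarz)
    also have "\<dots> \<le> (norm ?y / 2) * norm x"
      by (intro mult_right_mono M) auto
    finally have "norm ?y * norm ?y \<le> norm ?y * (norm x / 2)"
      by (simp add: power2_eq_square)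
    then show ?thesis
      by (cases "norm ?y = 0") auto
  qed
  then show ?thesis using M(1) by blast
qed

end

section \<open>Robust stability and decay of the continuous-time flows\<close>

lemma tendsto_zero_of_contraction:
  fixes s d :: "nat \<Rightarrow> real"
  assumes step: "\<And>k. s (Suc k) \<le> r * s k + d k" and r: "0 \<le> r" "r < 1"
    and s: "\<And>k. 0 \<le> s k" and d: "d \<longlonglongrightarrow> 0"
  shows "s \<longlonglongrightarrow> 0"
proof (rule LIMSEQ_I)
  fix e :: real
  assume e: "e > 0"
  \<comment> \<open>The other half of \<open>e\<close> is left for the transient. \<open>b\<close>
    is the fixed point of the map that takes \<open>s\<close> to \<open>r * s + (1 - r) * b\<close>:
    once the disturbance is below \<open>(1 - r) * b\<close>, the bound for the excess of
    \<open>s\<close> over \<open>b\<close> shrinks by \<open>r\<close> in each step.\<close>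
  define b where "b = e / 2"
  have b: "b > 0" using e by (simp add: b_def)
  have "\<forall>\<^sub>F k in sequentially. d k < (1 - r) * b"
    using d by (rule order_tendstoD) (use r b in simp)
  then obtain N where N: "\<And>k. k \<ge> N \<Longrightarrow> d k < (1 - r) * b"
    by (auto simp: eventually_sequentially)
  have bound: "s (N + i) \<le> r ^ i * s N + b" for i
  proof (induction i)
    case (Suc i)
    have "s (N + Suc i) \<le> r * s (N + i) + (1 - r) * b"
      using step[of "N + i"] N[of "N + i"] by simp
    also have "\<dots> \<le> r * (r ^ i * s N + b) + (1 - r) * b"
      using Suc r by (intro add_right_mono mult_left_mono) auto
    finally show ?case by (simp add: algebra_simps)
  qed (use b in simp)
  have "(\<lambda>i. r ^ i * s N) \<longlonglongrightarrow> 0 * s N"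
    using r by (intro tendsto_intros LIMSEQ_realpow_zero) auto
  then have "\<forall>\<^sub>F i in sequentially. r ^ i * s N < b"
    by (rule order_tendstoD) (use b in simp)
  then obtain M where M: "\<And>i. i \<ge> M \<Longrightarrow> r ^ i * s N < b"
    by (auto simp: eventually_sequentially)
  have "norm (s k - 0) < e" if "k \<ge> N + M" for k
  proof -
    define i where "i = k - N"
    have i: "k = N + i" "i \<ge> M"
      using \<open>k \<ge> N + M\<close> by (auto simp: i_def)
    show ?thesis
      using bound[of i] M[OF i(2)] s[of k] unfolding i(1) b_def by simp
  qed
  then show "\<exists>n. \<forall>k\<ge>n. norm (s k - 0) < e" by blast
qed

text \<open>In the norm \<open>W x = (\<Sum>i<M. r\<^sup>-\<^sup>i \<parallel>F\<^sup>i x\<parallel>)\<close> with \<open>r\<^sup>M = 1/2\<close>, the map itself is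
  a contraction of factor \<open>r\<close>, which makes its stability robust.\<close>

lemma contraction_robust:
  fixes F :: "'a::real_normed_vector \<Rightarrow> 'a"
  assumes F: "bounded_linear F" and M: "M > 0" "\<And>x. norm ((F ^^ M) x) \<le> norm x / 2"
  shows "\<exists>\<epsilon>>0. \<forall>x d. d \<longlonglongrightarrow> 0 \<longrightarrow>
    (\<forall>k. norm (x (Suc k) - F (x k)) \<le> \<epsilon> * norm (x k) + d k) \<longrightarrow> x \<longlonglongrightarrow> 0"
proof -
  define r :: real where "r = root M (1 / 2)"
  have r: "0 < r" "r < 1" and rM: "r ^ M = 1 / 2"
    using M(1) by (auto simp: r_def)
  define W where "W x = (\<Sum>i<M. norm ((F ^^ i) x) / r ^ i)" for x
  have W_ge0: "0 \<le> W x" for x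
    unfolding W_def using r by (intro sum_nonneg) auto
  have W_ge: "norm x \<le> W x" for x
    unfolding W_def using M(1) r
    by (intro order_trans[OF _ member_le_sum[of 0]]) auto
  have W_add: "W (x + y) \<le> W x + W y" for x y
  proof -
    have "(F ^^ i) (x + y) = (F ^^ i) x + (F ^^ i) y" for i
      by (rule linear_add[OF bounded_linear.linear[OF bounded_linear_funpow[OF F]]])
    then show ?thesis
      unfolding W_def sum.distrib[symmetric] add_divide_distrib[symmetric]
      using r by (intro sum_mono divide_right_mono) (simp_all add: norm_triangle_ineq)
  qed
  have W_F: "W (F x) \<le> r * W x" for x
  proof -
    have "W (F x) = (\<Sum>i<M. r * (norm ((F ^^ Suc i) x) / r ^ Suc i))"
      unfolding W_def using r by (intro sum.cong) (auto simp: funpow_swap1)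
    also have "\<dots> = r * (\<Sum>i<M. norm ((F ^^ Suc i) x) / r ^ Suc i)"
      by (rule sum_distrib_left[symmetric])
    \<comment> \<open>Shifting the sum drops \<open>norm x\<close> and adds the term for
      \<open>i = M\<close>, which is at most \<open>norm x\<close> because
      \<open>r ^ M = 1 / 2\<close>.\<close>
    also have "(\<Sum>i<M. norm ((F ^^ Suc i) x) / r ^ Suc i) = W x + norm ((F ^^ M) x) / r ^ M - norm x"
      using sum.lessThan_Suc_shift[of "\<lambda>i. norm ((F ^^ i) x) / r ^ i" M] by (simp add: W_def)
    also have "\<dots> \<le> W x"
      using M(2)[of x] by (simp add: rM)
    finally show ?thesis using r by simp
  qed
  have "\<exists>c>0. \<forall>x. norm ((F ^^ i) x) / r ^ i \<le> c * norm x" for i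
  proof -
    obtain c where c: "c > 0" "\<And>x. norm ((F ^^ i) x) \<le> norm x * c"
      using bounded_linear.pos_bounded[OF bounded_linear_funpow[OF F]] by blast
    have "norm ((F ^^ i) x) / r ^ i \<le> (c / r ^ i) * norm x" for x
      using divide_right_mono[OF c(2)[of x], of "r ^ i"] r by (simp add: mult.commute)
    then show ?thesis
      using r c(1) by (intro exI[of _ "c / r ^ i"]) auto
  qed
  then obtain c where c: "\<And>i. c i > 0" "\<And>i x. norm ((F ^^ i) x) / r ^ i \<le> c i * norm x"
    by metis
  define C where "C = (\<Sum>i<M. c i)"
  have C: "C > 0"
    unfolding C_def using M(1) c(1) by (intro sum_pos) auto
  have W_le: "W x \<le> C * norm x" for x
    unfolding W_def C_def sum_distrib_right by (intro sum_mono c)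
  \<comment> \<open>Half of the gap \<open>1 - r\<close> is spent on the perturbation:
    \<open>C * \<epsilon> = (1 - r) / 2\<close>, which leaves the contraction factor
    \<open>(1 + r) / 2\<close>.\<close>
  define \<epsilon> where "\<epsilon> = (1 - r) / (2 * C)"
  have \<epsilon>: "\<epsilon> > 0" using r C by (simp add: \<epsilon>_def)
  show ?thesis
  proof (intro exI[of _ \<epsilon>] conjI allI impI \<epsilon>)
    fix x d
    assume d: "d \<longlonglongrightarrow> 0" and step: "\<forall>k. norm (x (Suc k) - F (x k)) \<le> \<epsilon> * norm (x k) + d k"
    have W_step: "W (x (Suc k)) \<le> ((1 + r) / 2) * W (x k) + C * d k" for k
    proof -
      have "W (x (Suc k)) \<le> W (F (x k)) + W (x (Suc k) - F (x k))"
        using W_add[of "F (x k)" "x (Suc k) - F (x k)"] by simp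
      moreover have "W (x (Suc k) - F (x k)) \<le> C * (\<epsilon> * norm (x k) + d k)"
        using step[rule_format, of k] C by (intro order_trans[OF W_le mult_left_mono]) simp_all
      moreover have "\<epsilon> * norm (x k) \<le> \<epsilon> * W (x k)"
        using \<epsilon> W_ge[of "x k"] by (intro mult_left_mono) simp_all
      then have "C * (\<epsilon> * norm (x k) + d k) \<le> C * (\<epsilon> * W (x k) + d k)"
        using C by (intro mult_left_mono) simp_all
      moreover have "C * (\<epsilon> * W (x k) + d k) = (1 - r) / 2 * W (x k) + C * d k"
      proof -
        have "C * \<epsilon> = (1 - r) / 2"
          using C by (simp add: \<epsilon>_def)
        then show ?thesis
          by (simp only: distrib_left mult.assoc[symmetric])
      qed
      moreover have "r * W (x k) + (1 - r) / 2 * W (x k) = (1 + r) / 2 * W (x k)"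
      proof -
        have "r + (1 - r) / 2 = (1 + r) / 2"
          by (simp add: field_simps)
        then show ?thesis
          by (simp only: distrib_right[symmetric])
      qed
      ultimately show ?thesis
        using W_F[of "x k"] by linarith
    qed
    have "(\<lambda>k. W (x k)) \<longlonglongrightarrow> 0"
      by (rule tendsto_zero_of_contraction[OF W_step _ _ W_ge0 tendsto_mult_right_zero[OF d]])
        (use r in simp_all)
    then have "(\<lambda>k. norm (x k)) \<longlonglongrightarrow> 0"
      by (rule tendsto_sandwich[OF _ _ tendsto_const, rotated 2]) (simp_all add: W_ge)
    then show "x \<longlonglongrightarrow> 0"
      by (rule tendsto_norm_zero_cancel)
  qed
qed

text \<open>Integrating factor \<open>exp (c * s)\<close>. The derivative at \<open>0\<close> is
  one-sided, so monotonicity is drawn from derivatives in the open interval and continuity up to its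
  ends.\<close>

lemma exponential_decay:
  fixes V V' :: "real \<Rightarrow> real"
  assumes V: "\<And>t. t \<ge> 0 \<Longrightarrow> (V has_real_derivative V' t) (at t within {0..})"
    and le: "\<And>t. t \<ge> 0 \<Longrightarrow> V' t \<le> - c * V t" and t: "t \<ge> 0"
  shows "V t \<le> exp (- c * t) * V 0"
proof -
  define U where "U s = exp (c * s) * V s" for s
  have U: "(U has_real_derivative exp (c * s) * (c * V s + V' s)) (at s within {0..})" if "s \<ge> 0" for s
    unfolding U_def
    by (auto intro!: derivative_eq_intros V that simp: algebra_simps)
  have "U t \<le> U 0"
  proof (rule DERIV_nonpos_imp_decreasing_open[OF t])
    fix s :: real
    assume s: "0 < s" "s < t"
    have "(U has_real_derivative exp (c * s) * (c * V s + V' s)) (at s)"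
      using DERIV_subset[OF U[of s], of "{0<..}"] s by (simp add: at_within_open[of s "{0<..}"] subset_eq)
    moreover have "exp (c * s) * (c * V s + V' s) \<le> 0"
      using le[of s] s by (intro mult_nonneg_nonpos) auto
    ultimately show "\<exists>y. (U has_real_derivative y) (at s) \<and> y \<le> 0" by blast
  next
    show "continuous_on {0..t} U"
      by (rule continuous_on_subset[of "{0..}"])
        (auto simp: continuous_on_eq_continuous_within intro!: DERIV_continuous U)
  qed
  then have "exp (- (c * t)) * (exp (c * t) * V t) \<le> exp (- (c * t)) * V 0"
    unfolding U_def by (intro mult_left_mono) auto
  then show ?thesis
    by (simp only: mult.assoc[symmetric] exp_add[symmetric]) simp
qed

section \<open>Rates of convergence of the two flows\<close>

context horizon
begin

text \<open>The gradient flow of a quadratic function with minimizer \<open>Gi b\<close>. On the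
  range of \<open>P\<close>, to which the flow is confined, \<open>coercive\<close> makes this
  function strongly convex.\<close>

lemma estimation_flow_decay:
  "\<exists>s>0. \<forall>\<xi> b. P b = b \<longrightarrow> \<xi> 0 = 0 \<longrightarrow>
    (\<forall>t\<ge>0. P (\<xi> t) = \<xi> t \<and>
       (\<xi> has_vector_derivative - G (Suc K) (\<xi> t) + b) (at t within {0..})) \<longrightarrow>
    (\<forall>t\<ge>0. norm (\<xi> t - Gi b) \<le> exp (- s * t) * norm (Gi b))"
proof -
  obtain s where s: "s > 0" "\<And>x. s * (norm (P x))^2 \<le> inner x (G (Suc K) x)"
    using coercive by blast
  show ?thesis
  proof (intro exI[of _ s] conjI allI impI s(1))
    fix \<xi> b t
    assume b: "P b = b" and \<xi>0: "\<xi> 0 = 0" and t: "(0::real) \<le> t"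
      and \<xi>: "\<forall>t\<ge>0. P (\<xi> t) = \<xi> t \<and>
        (\<xi> has_vector_derivative - G (Suc K) (\<xi> t) + b) (at t within {0..})"
    define e where "e t = \<xi> t - Gi b" for t
    define V where "V t = inner (e t) (e t)" for t
    have e: "(e has_vector_derivative - G (Suc K) (e t)) (at t within {0..})" if "t \<ge> 0" for t
    proof -
      have "- G (Suc K) (\<xi> t) + b = - G (Suc K) (e t)"
        by (simp only: e_def lin_G_simps G_Gi b) simp
      moreover have "(e has_vector_derivative - G (Suc K) (\<xi> t) + b) (at t within {0..})"
        unfolding e_def using \<xi> that by (auto intro!: derivative_eq_intros)
      ultimately show ?thesis by simp
    qed
    have V: "(V has_real_derivative - 2 * inner (e t) (G (Suc K) (e t))) (at t within {0..})"
      if "t \<ge> 0" for t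
      unfolding V_def has_real_derivative_iff_has_vector_derivative
      using bounded_bilinear.has_vector_derivative[OF bounded_bilinear_inner e[OF that] e[OF that]]
      by (simp add: inner_commute)
    have "- 2 * inner (e t) (G (Suc K) (e t)) \<le> - (2 * s) * V t" if "t \<ge> 0" for t
    proof -
      have "P (e t) = e t"
        using \<xi> that by (simp add: e_def lin_simps)
      then show ?thesis
        using s(2)[of "e t"] by (simp add: V_def dot_square_norm)
    qed
    from exponential_decay[OF V this t]
    have "(norm (e t))^2 \<le> exp (- (2 * s) * t) * (norm (e 0))^2"
      by (simp add: V_def dot_square_norm)
    also have "\<dots> = (exp (- s * t) * norm (e 0))^2"
      by (simp only: power_mult_distrib exp_double[symmetric] mult.assoc mult_minus_left mult_minus_right)
    finally have "norm (e t) \<le> exp (- s * t) * norm (e 0)"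
      by (rule power2_le_imp_le) simp
    then show "norm (\<xi> t - Gi b) \<le> exp (- s * t) * norm (Gi b)"
      by (simp add: e_def \<xi>0)
  qed
qed

text \<open>Along the linear flow \<open>\<mu>' = z\<close>, \<open>z' = - z - G \<mu>\<close>, \<open>v' = - v - L A'\<^sup>K \<mu>\<close> the energy
  \<open>(\<langle>\<mu>, G \<mu>\<rangle> + \<parallel>z\<parallel>\<^sup>2) / 2\<close> is dissipated only through \<open>z\<close>; the cross term \<open>e \<langle>\<mu>, z\<rangle>\<close> transfers
  dissipation to \<open>\<mu>\<close>, which in turn absorbs the forcing of \<open>v\<close>.\<close>

lemma control_flow_decay:
  "\<exists>c>0. \<exists>C>0. \<forall>\<mu> z v.
    (\<forall>t\<ge>0. P (\<mu> t) = \<mu> t \<and>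
       (\<mu> has_vector_derivative z t) (at t within {0..}) \<and>
       (z has_vector_derivative - z t - G (Suc K) (\<mu> t)) (at t within {0..}) \<and>
       (v has_vector_derivative - v t - L ((A' ^^ K) (\<mu> t))) (at t within {0..})) \<longrightarrow>
    (\<forall>t\<ge>0. (norm (v t))^2 \<le>
       C * exp (- c * t) * ((norm (\<mu> 0))^2 + (norm (z 0))^2 + (norm (v 0))^2))"
proof -
  obtain s where s: "s > 0" "\<And>x. s * (norm (P x))^2 \<le> inner x (G (Suc K) x)"
    using coercive by blast
  obtain m where m: "m > 0" "\<And>x. norm (L ((A' ^^ K) x)) \<le> norm x * m"
    using bounded_linear.pos_bounded[OF bounded_linear_compose[OF bl_L bounded_linear_funpow[OF bl_A']]]
    by auto
  obtain g where g: "g > 0" "\<And>x. norm (G (Suc K) x) \<le> norm x * g"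
    using bounded_linear.pos_bounded[OF bl_G] by blast
  \<comment> \<open>Differentiating the cross term uses up \<open>e\<close> of the dissipation of
    \<open>z\<close> and, through \<open>young\<close>, another \<open>e / s\<close>. The choice
    makes \<open>e + e / s = 1 / 2\<close>, so half of the dissipation remains.\<close>
  define e where "e = s / (2 * (s + 1))"
  \<comment> \<open>Small enough that the forcing of \<open>v\<close>, after Young's inequality,
    costs at most \<open>e * s / 4\<close> times \<open>(norm (\<mu> t))^2\<close>. Together with
    the same amount from \<open>young\<close> this consumes at most half of the gain
    \<open>e * Q t\<close>.\<close>
  define \<delta> where "\<delta> = e * s / (2 * (m^2 + 1))"
  have e: "e > 0" "e \<le> 1 / 2" "e / s \<le> 1 / 2" "e + e / s = 1 / 2"
    using s(1) by (auto simp: e_def divide_simps)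
  have \<delta>: "\<delta> > 0" "\<delta> * m^2 \<le> e * s / 2" "\<delta> \<le> e * s / 2"
    using e(1) s(1) m(1) by (auto simp: \<delta>_def divide_simps add_pos_pos power2_eq_square)
  have young: "\<bar>e * inner x y\<bar> \<le> e * s / 4 * (norm x)^2 + e / s * (norm y)^2" for x y :: 'a
  proof -
    have "0 \<le> (s / 2 * norm x - norm y)^2 * (e / s)"
      using e(1) s(1) by simp
    also have "\<dots> = e * s / 4 * (norm x)^2 + e / s * (norm y)^2 - e * (norm x * norm y)"
      using s(1) by (simp add: power2_eq_square field_simps)
    finally have "e * (norm x * norm y) \<le> e * s / 4 * (norm x)^2 + e / s * (norm y)^2" by simp
    moreover have "\<bar>e * inner x y\<bar> \<le> e * (norm x * norm y)"
      using e(1) Cauchy_Schwarz_ineq2[of x y] by (simp add: abs_mult)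
    ultimately show ?thesis by linarith
  qed
  \<comment> \<open>\<open>2 / \<delta>\<close> comes from bounding the energy below by
    \<open>v\<close> alone, \<open>g + 1 + \<delta>\<close> from bounding it above at time
    \<open>0\<close>.\<close>
  define C where "C = (2 / \<delta>) * (g + 1 + \<delta>)"
  show ?thesis
  proof (rule exI[of _ "e / 2"], rule conjI, simp add: e, rule exI[of _ C], rule conjI,
      (simp add: C_def \<delta> g add_pos_pos), intro allI impI)
    fix \<mu> z v t
    assume flow: "\<forall>t\<ge>0. P (\<mu> t) = \<mu> t \<and>
       (\<mu> has_vector_derivative z t) (at t within {0..}) \<and>
       (z has_vector_derivative - z t - G (Suc K) (\<mu> t)) (at t within {0..}) \<and>
       (v has_vector_derivative - v t - L ((A' ^^ K) (\<mu> t))) (at t within {0..})"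
      and t: "(0::real) \<le> t"
    define Q where "Q t = inner (\<mu> t) (G (Suc K) (\<mu> t))" for t
    define V where "V t = Q t / 2 + (norm (z t))^2 / 2 + e * inner (\<mu> t) (z t)
      + \<delta> * (norm (v t))^2 / 2" for t
    \<comment> \<open>The derivative of \<open>V\<close>. The terms pairing \<open>z\<close> with
      \<open>G (Suc K) (\<mu> t)\<close> that arise from the first two summands cancel because
      \<open>G\<close> is symmetric.\<close>
    define V' where "V' t = - (1 - e) * (norm (z t))^2 - e * inner (\<mu> t) (z t) - e * Q t
      - \<delta> * (norm (v t))^2 - \<delta> * inner (v t) (L ((A' ^^ K) (\<mu> t)))" for t
    have Q: "s * (norm (\<mu> t))^2 \<le> Q t" if "t \<ge> 0" for t
      using s(2)[of "\<mu> t"] flow that by (simp add: Q_def)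
    have Q_ge0: "0 \<le> Q t" for t
      unfolding Q_def by (rule G_ge0)
    have V: "(V has_real_derivative V' t) (at t within {0..})" if "t \<ge> 0" for t
    proof -
      have l: "(\<mu> has_vector_derivative z t) (at t within {0..})"
        and zz: "(z has_vector_derivative - z t - G (Suc K) (\<mu> t)) (at t within {0..})"
        and vv: "(v has_vector_derivative - v t - L ((A' ^^ K) (\<mu> t))) (at t within {0..})"
        using flow that by auto
      note der = bounded_bilinear.has_vector_derivative[OF bounded_bilinear_inner,
          folded has_real_derivative_iff_has_vector_derivative]
      have eq: "V = (\<lambda>t. 1 / 2 * inner (\<mu> t) (G (Suc K) (\<mu> t)) + 1 / 2 * inner (z t) (z t)
          + e * inner (\<mu> t) (z t) + \<delta> / 2 * inner (v t) (v t))"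
        by (simp add: fun_eq_iff V_def Q_def dot_square_norm)
      have d: "V' t = 1 / 2 * (inner (\<mu> t) (G (Suc K) (z t)) + inner (z t) (G (Suc K) (\<mu> t)))
          + 1 / 2 * (inner (z t) (- z t - G (Suc K) (\<mu> t)) + inner (- z t - G (Suc K) (\<mu> t)) (z t))
          + e * (inner (\<mu> t) (- z t - G (Suc K) (\<mu> t)) + inner (z t) (z t))
          + \<delta> / 2 * (inner (v t) (- v t - L ((A' ^^ K) (\<mu> t))) + inner (- v t - L ((A' ^^ K) (\<mu> t))) (v t))"
        using G_sym[of "Suc K" "\<mu> t" "z t"]
        by (simp add: V'_def Q_def inner_diff_left inner_diff_right inner_commute
            algebra_simps flip: dot_square_norm)
      show ?thesis
        unfolding eq d
        by (intro DERIV_add DERIV_cmult der l zz vv bounded_linear.has_vector_derivative[OF bl_G])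
    qed
    have decay: "V' t \<le> - (e / 2) * V t" if "t \<ge> 0" for t
    proof -
      let ?l = "(norm (\<mu> t))^2" and ?z = "(norm (z t))^2" and ?v = "(norm (v t))^2"
      have y: "\<bar>e * inner (\<mu> t) (z t)\<bar> \<le> e * s / 4 * ?l + e / s * ?z"
        by (rule young)
      have "- inner (v t) (L ((A' ^^ K) (\<mu> t))) \<le> ?v / 2 + m^2 * ?l / 2"
      proof -
        have "- inner (v t) (L ((A' ^^ K) (\<mu> t))) \<le> norm (v t) * norm (L ((A' ^^ K) (\<mu> t)))"
          using Cauchy_Schwarz_ineq2[of "v t" "L ((A' ^^ K) (\<mu> t))"] by linarith
        also have "\<dots> \<le> norm (v t) * (norm (\<mu> t) * m)"
          by (intro mult_left_mono m) simp
        also have "\<dots> \<le> ?v / 2 + m^2 * ?l / 2"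
          using zero_le_power2[of "norm (v t) - norm (\<mu> t) * m"]
          by (simp add: power2_eq_square algebra_simps)
        finally show ?thesis .
      qed
      then have "\<delta> * (- inner (v t) (L ((A' ^^ K) (\<mu> t)))) \<le> \<delta> * (?v / 2 + m^2 * ?l / 2)"
        using \<delta> by (intro mult_left_mono) auto
      moreover have "\<delta> * m^2 * ?l \<le> e * s / 2 * ?l"
        using \<delta> by (intro mult_right_mono) auto
      moreover have "(e + e / s) * ?z = 1 / 2 * ?z"
        using e by simp
      moreover have "e * (s * ?l) \<le> e * Q t"
        using e Q[OF that] by (intro mult_left_mono) auto
      ultimately have upper: "V' t \<le> - ?z / 2 - e / 2 * Q t - \<delta> * ?v / 2"
        using y unfolding V'_def by (simp add: algebra_simps)
      have "(e / s) * ?z \<le> 1 / 2 * ?z"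
        using e by (intro mult_right_mono) auto
      moreover have "e * Q t \<le> 1 / 2 * Q t"
        using e Q_ge0[of t] by (intro mult_right_mono) auto
      \<comment> \<open>\<open>5 / 8\<close> is \<open>1 / 2\<close> from the energy plus
        \<open>1 / 8\<close> from the cross term, whose share of \<open>\<mu>\<close> is at most
        \<open>e / 4 * Q t\<close> with \<open>e \<le> 1 / 2\<close>.\<close>
      ultimately have "V t \<le> 5 / 8 * Q t + ?z + \<delta> * ?v / 2"
        using y \<open>e * (s * ?l) \<le> e * Q t\<close> unfolding V_def by (simp add: algebra_simps)
      then have "e / 2 * V t \<le> e / 2 * (5 / 8 * Q t + ?z + \<delta> * ?v / 2)"
        using e by (intro mult_left_mono) auto
      moreover have "e * ?z \<le> 1 / 2 * ?z"
        using e by (intro mult_right_mono) auto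
      moreover have "e * (\<delta> * ?v) \<le> 1 / 2 * (\<delta> * ?v)"
        using e \<delta> by (intro mult_right_mono) auto
      moreover have "0 \<le> e * Q t" "0 \<le> ?z" "0 \<le> \<delta> * ?v"
        using e \<delta> Q_ge0[of t] by simp_all
      moreover have "e / 2 * (5 / 8 * Q t + ?z + \<delta> * ?v / 2)
          = 5 / 16 * (e * Q t) + 1 / 2 * (e * ?z) + 1 / 4 * (e * (\<delta> * ?v))"
        by (simp add: algebra_simps)
      ultimately have "V' t \<le> - (e / 2 * V t)"
        using upper by linarith
      then show ?thesis by simp
    qed
    have lower: "\<delta> * (norm (v t))^2 / 2 \<le> V t" if "t \<ge> 0" for t
    proof -
      have "\<bar>e * inner (\<mu> t) (z t)\<bar> \<le> e * s / 4 * (norm (\<mu> t))^2 + e / s * (norm (z t))^2"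
        by (rule young)
      moreover have "(e / s) * (norm (z t))^2 \<le> 1 / 2 * (norm (z t))^2"
        using e by (intro mult_right_mono) auto
      moreover have "e * (s * (norm (\<mu> t))^2) \<le> 1 / 2 * (s * (norm (\<mu> t))^2)"
        using e s(1) by (intro mult_right_mono) auto
      moreover have "0 \<le> s * (norm (\<mu> t))^2"
        using s(1) by simp
      ultimately show ?thesis
        using Q[OF that] unfolding V_def by (simp add: algebra_simps)
    qed
    have init: "V 0 \<le> (g + 1 + \<delta>) * ((norm (\<mu> 0))^2 + (norm (z 0))^2 + (norm (v 0))^2)"
    proof -
      let ?l = "(norm (\<mu> 0))^2" and ?z = "(norm (z 0))^2" and ?v = "(norm (v 0))^2"
      have y: "\<bar>e * inner (\<mu> 0) (z 0)\<bar> \<le> e * s / 4 * ?l + e / s * ?z"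
        by (rule young)
      have "Q 0 \<le> g * ?l"
      proof -
        have "Q 0 \<le> norm (\<mu> 0) * norm (G (Suc K) (\<mu> 0))"
          unfolding Q_def by (rule norm_cauchy_schwarz)
        also have "\<dots> \<le> norm (\<mu> 0) * (norm (\<mu> 0) * g)"
          by (intro mult_left_mono g) simp
        finally show ?thesis
          by (simp add: power2_eq_square algebra_simps)
      qed
      moreover have "(e / s) * ?z \<le> 1 / 2 * ?z"
        using e by (intro mult_right_mono) auto
      moreover have "e * (s * ?l) \<le> 1 / 2 * (s * ?l)"
        using e s(1) by (intro mult_right_mono) auto
      moreover have "0 \<le> s * ?l" "s * ?l \<le> Q 0"
        using s(1) Q[of 0] by simp_all
      moreover have "0 \<le> g * ?l" "0 \<le> g * ?z" "0 \<le> g * ?v" "0 \<le> \<delta> * ?l" "0 \<le> \<delta> * ?z"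
          "0 \<le> \<delta> * ?v" "0 \<le> ?l" "0 \<le> ?z" "0 \<le> ?v"
        using g \<delta> by simp_all
      moreover have "e * s / 4 * ?l = 1 / 4 * (e * (s * ?l))"
        by simp
      moreover have "(g + 1 + \<delta>) * (?l + ?z + ?v)
          = (g * ?l + g * ?z + g * ?v) + (?l + ?z + ?v) + (\<delta> * ?l + \<delta> * ?z + \<delta> * ?v)"
        by (simp add: algebra_simps)
      ultimately show ?thesis
        using y unfolding V_def by linarith
    qed
    have "\<delta> * (norm (v t))^2 / 2 \<le> exp (- (e / 2) * t) * V 0"
      using lower[OF t] exponential_decay[OF V decay t] by linarith
    also have "\<dots> \<le> exp (- (e / 2) * t) *
        ((g + 1 + \<delta>) * ((norm (\<mu> 0))^2 + (norm (z 0))^2 + (norm (v 0))^2))"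
      by (intro mult_left_mono init) simp
    finally have "(norm (v t))^2 \<le> (2 / \<delta>) * (exp (- (e / 2) * t) *
        ((g + 1 + \<delta>) * ((norm (\<mu> 0))^2 + (norm (z 0))^2 + (norm (v 0))^2)))"
      using \<delta>(1) by (simp add: pos_le_divide_eq mult.commute)
    then show "(norm (v t))^2 \<le>
       C * exp (- (e / 2) * t) * ((norm (\<mu> 0))^2 + (norm (z 0))^2 + (norm (v 0))^2)"
      by (simp only: C_def ac_simps)
  qed
qed


text \<open>Subtracting the equilibrium, which has \<open>costate a\<close>,
  \<open>- G (Suc K) (costate a)\<close> and \<open>- L ((A' ^^ K) (costate a))\<close> as its
  components, makes the flow homogeneous. All flows start at zero, so the initial offset is linear
  in \<open>P a\<close>; this is what makes the error relative.\<close>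

lemma control_flow_converges:
  assumes "\<epsilon> > 0"
  shows "\<exists>T. \<forall>\<tau>>T. \<forall>a \<mu> z v. \<tau> > 0 \<longrightarrow> \<mu> 0 = 0 \<longrightarrow> z 0 = 0 \<longrightarrow> v 0 = 0 \<longrightarrow>
    (\<forall>t\<ge>0. P (\<mu> t) = \<mu> t \<and>
       (\<mu> has_vector_derivative (A ^^ Suc K) (P a) + z t) (at t within {0..}) \<and>
       (z has_vector_derivative - z t - G (Suc K) (\<mu> t)) (at t within {0..}) \<and>
       (v has_vector_derivative - v t - L ((A' ^^ K) (\<mu> t))) (at t within {0..})) \<longrightarrow>
    norm (v \<tau> + L ((A' ^^ K) (costate a))) \<le> \<epsilon> * norm (P a)"
proof -
  define H where "H x = L ((A' ^^ K) x)" for x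
  have bl_H: "bounded_linear H"
    unfolding H_def by (rule bounded_linear_compose[OF bl_L bounded_linear_funpow[OF bl_A']])
  note lin_H = bounded_linear.linear[OF bl_H]
  obtain c C where c: "c > 0" "C > 0" and decay:
    "\<And>\<mu> z v t. (\<forall>t\<ge>0. P (\<mu> t) = \<mu> t \<and>
       (\<mu> has_vector_derivative z t) (at t within {0..}) \<and>
       (z has_vector_derivative - z t - G (Suc K) (\<mu> t)) (at t within {0..}) \<and>
       (v has_vector_derivative - v t - H (\<mu> t)) (at t within {0..})) \<Longrightarrow> t \<ge> 0 \<Longrightarrow>
      (norm (v t))^2 \<le> C * exp (- c * t) * ((norm (\<mu> 0))^2 + (norm (z 0))^2 + (norm (v 0))^2)"
    using control_flow_decay unfolding H_def[symmetric] by blast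
  obtain h1 where h1: "h1 > 0" "\<And>x. norm (costate x) \<le> norm x * h1"
    using bounded_linear.pos_bounded[OF bl_costate] by blast
  obtain h2 where h2: "h2 > 0" "\<And>x. norm (G (Suc K) x) \<le> norm x * h2"
    using bounded_linear.pos_bounded[OF bl_G] by blast
  obtain h3 where h3: "h3 > 0" "\<And>x. norm (H x) \<le> norm x * h3"
    using bounded_linear.pos_bounded[OF bl_H] by blast
  define D where "D = C * (1 + h2^2 + h3^2) * h1^2"
  have "((\<lambda>\<tau>. D * exp (- c * \<tau>)) \<longlongrightarrow> D * 0) at_top"
    by (intro tendsto_mult tendsto_const filterlim_compose[OF exp_at_bot])
      (use c in \<open>simp add: filterlim_uminus_at_bot filterlim_tendsto_pos_mult_at_top[OF tendsto_const] filterlim_ident\<close>)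
  then have "\<forall>\<^sub>F \<tau> in at_top. D * exp (- c * \<tau>) < \<epsilon>^2"
    by (rule order_tendstoD) (use assms in simp)
  then obtain T where T: "\<And>\<tau>. \<tau> \<ge> T \<Longrightarrow> D * exp (- c * \<tau>) < \<epsilon>^2"
    by (auto simp: eventually_at_top_linorder)
  show ?thesis
  proof (intro exI[of _ T] allI impI)
    fix \<tau> a \<mu> z v
    assume \<tau>: "T < \<tau>" "0 < \<tau>" and init: "\<mu> 0 = 0" "z 0 = 0" "v 0 = 0"
      and flow: "\<forall>t\<ge>0. P (\<mu> t) = \<mu> t \<and>
       (\<mu> has_vector_derivative (A ^^ Suc K) (P a) + z t) (at t within {0..}) \<and>
       (z has_vector_derivative - z t - G (Suc K) (\<mu> t)) (at t within {0..}) \<and>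
       (v has_vector_derivative - v t - L ((A' ^^ K) (\<mu> t))) (at t within {0..})"
    define m where "m = costate a"
    have Gm: "G (Suc K) m = (A ^^ Suc K) (P a)"
      unfolding m_def by (rule G_costate)
    define \<mu>' z' v' where "\<mu>' t = \<mu> t - m" and "z' t = z t + G (Suc K) m" and "v' t = v t + H m" for t
    have "\<forall>t\<ge>0. P (\<mu>' t) = \<mu>' t \<and>
       (\<mu>' has_vector_derivative z' t) (at t within {0..}) \<and>
       (z' has_vector_derivative - z' t - G (Suc K) (\<mu>' t)) (at t within {0..}) \<and>
       (v' has_vector_derivative - v' t - H (\<mu>' t)) (at t within {0..})"
    proof (intro allI impI conjI)
      fix t :: real assume t: "0 \<le> t"
      have \<mu>: "(\<mu> has_vector_derivative (A ^^ Suc K) (P a) + z t) (at t within {0..})"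
        and z: "(z has_vector_derivative - z t - G (Suc K) (\<mu> t)) (at t within {0..})"
        and v: "(v has_vector_derivative - v t - H (\<mu> t)) (at t within {0..})"
        and P\<mu>: "P (\<mu> t) = \<mu> t"
        using flow t by (auto simp: H_def)
      show "P (\<mu>' t) = \<mu>' t"
        by (simp add: \<mu>'_def lin_simps P\<mu> m_def)
      show "(\<mu>' has_vector_derivative z' t) (at t within {0..})"
        unfolding \<mu>'_def z'_def Gm
        using has_vector_derivative_diff[OF \<mu> has_vector_derivative_const[of m]] by (simp add: add.commute)
      have "- z' t - G (Suc K) (\<mu>' t) = - z t - G (Suc K) (\<mu> t)"
        by (simp add: z'_def \<mu>'_def lin_G_simps)
      then show "(z' has_vector_derivative - z' t - G (Suc K) (\<mu>' t)) (at t within {0..})"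
        unfolding z'_def
        using has_vector_derivative_add[OF z has_vector_derivative_const[of "G (Suc K) m"]] by (simp only: add_0_right)
      have "- v' t - H (\<mu>' t) = - v t - H (\<mu> t)"
        by (simp add: v'_def \<mu>'_def linear_diff[OF lin_H])
      then show "(v' has_vector_derivative - v' t - H (\<mu>' t)) (at t within {0..})"
        unfolding v'_def
        using has_vector_derivative_add[OF v has_vector_derivative_const[of "H m"]] by (simp only: add_0_right)
    qed
    from decay[OF this, of \<tau>] \<tau>
    have "(norm (v' \<tau>))^2 \<le> C * exp (- c * \<tau>) * ((norm (\<mu>' 0))^2 + (norm (z' 0))^2 + (norm (v' 0))^2)"
      by simp
    also have "\<dots> = C * exp (- c * \<tau>) * ((norm m)^2 + (norm (G (Suc K) m))^2 + (norm (H m))^2)"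
      by (simp add: \<mu>'_def z'_def v'_def init)
    also have "\<dots> \<le> C * exp (- c * \<tau>) * ((norm m)^2 + (norm m * h2)^2 + (norm m * h3)^2)"
      using c h2 h3 by (intro mult_left_mono add_mono power_mono order_refl) auto
    also have "\<dots> = C * exp (- c * \<tau>) * (1 + h2^2 + h3^2) * (norm m)^2"
      by (simp add: power_mult_distrib algebra_simps)
    also have "\<dots> \<le> C * exp (- c * \<tau>) * (1 + h2^2 + h3^2) * (norm (P a) * h1)^2"
      using c h1(2)[of "P a"] by (intro mult_left_mono power_mono) (simp_all add: m_def)
    also have "\<dots> = D * exp (- c * \<tau>) * (norm (P a))^2"
      by (simp add: D_def power_mult_distrib)
    also have "\<dots> \<le> \<epsilon>^2 * (norm (P a))^2"
      using T[of \<tau>] \<tau> by (intro mult_right_mono) auto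
    also have "\<dots> = (\<epsilon> * norm (P a))^2"
      by (simp add: power_mult_distrib)
    finally have "norm (v' \<tau>) \<le> \<epsilon> * norm (P a)"
      by (rule power2_le_imp_le) (use assms in simp)
    then show "norm (v \<tau> + L ((A' ^^ K) (costate a))) \<le> \<epsilon> * norm (P a)"
      by (simp add: v'_def H_def m_def)
  qed
qed

text \<open>The limit is linear in \<open>a\<close> and depends on \<open>P a\<close> only. It is
  also the initial offset that the decay multiplies, so the error is relative to
  \<open>norm (P a)\<close>.\<close>

lemma estimation_flow_converges:
  assumes "\<epsilon> > 0"
  shows "\<exists>T. \<forall>\<tau>>T. \<forall>a \<xi>. \<tau> > 0 \<longrightarrow> \<xi> 0 = 0 \<longrightarrow>
    (\<forall>t\<ge>0. P (\<xi> t) = \<xi> t \<and>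
       (\<xi> has_vector_derivative - G (Suc K) (\<xi> t) + (A ^^ K) (L a)) (at t within {0..})) \<longrightarrow>
    norm (\<xi> \<tau> - Gi ((A ^^ K) (L a))) \<le> \<epsilon> * norm (P a)"
proof -
  define H where "H x = Gi ((A ^^ K) (L x))" for x
  have bl_H: "bounded_linear H"
    unfolding H_def
    by (intro bounded_linear_compose[OF bl_Gi] bounded_linear_compose[OF bounded_linear_funpow[OF bl_A]] bl_L)
  obtain h where h: "h > 0" "\<And>x. norm (H x) \<le> norm x * h"
    using bounded_linear.pos_bounded[OF bl_H] by blast
  have H_P: "H (P x) = H x" for x
    by (simp add: H_def)
  obtain s where s: "s > 0" and decay: "\<And>\<xi> b t. P b = b \<Longrightarrow> \<xi> 0 = 0 \<Longrightarrow>
    (\<forall>t\<ge>0. P (\<xi> t) = \<xi> t \<and>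
       (\<xi> has_vector_derivative - G (Suc K) (\<xi> t) + b) (at t within {0..})) \<Longrightarrow> t \<ge> 0 \<Longrightarrow>
     norm (\<xi> t - Gi b) \<le> exp (- s * t) * norm (Gi b)"
    using estimation_flow_decay by blast
  have "((\<lambda>\<tau>. h * exp (- s * \<tau>)) \<longlongrightarrow> h * 0) at_top"
    by (intro tendsto_mult tendsto_const filterlim_compose[OF exp_at_bot])
      (use s in \<open>simp add: filterlim_uminus_at_bot filterlim_tendsto_pos_mult_at_top[OF tendsto_const] filterlim_ident\<close>)
  then have "\<forall>\<^sub>F \<tau> in at_top. h * exp (- s * \<tau>) < \<epsilon>"
    by (rule order_tendstoD) (use assms in simp)
  then obtain T where T: "\<And>\<tau>. \<tau> \<ge> T \<Longrightarrow> h * exp (- s * \<tau>) < \<epsilon>"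
    by (auto simp: eventually_at_top_linorder)
  show ?thesis
  proof (intro exI[of _ T] allI impI)
    fix \<tau> a \<xi>
    assume \<tau>: "T < \<tau>" "0 < \<tau>" and init: "\<xi> 0 = 0"
      and flow: "\<forall>t\<ge>0. P (\<xi> t) = \<xi> t \<and>
       (\<xi> has_vector_derivative - G (Suc K) (\<xi> t) + (A ^^ K) (L a)) (at t within {0..})"
    have "P ((A ^^ K) (L a)) = (A ^^ K) (L a)"
      by (simp add: P_funpow_A)
    from decay[OF this init flow, of \<tau>] \<tau>
    have "norm (\<xi> \<tau> - H a) \<le> exp (- s * \<tau>) * norm (H a)"
      by (simp add: H_def)
    also have "\<dots> \<le> exp (- s * \<tau>) * (norm (P a) * h)"
      using h(2)[of "P a"] by (intro mult_left_mono) (simp_all add: H_P)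
    also have "\<dots> = h * exp (- s * \<tau>) * norm (P a)"
      by simp
    also have "\<dots> \<le> \<epsilon> * norm (P a)"
      using T[of \<tau>] \<tau> by (intro mult_right_mono) auto
    finally show "norm (\<xi> \<tau> - Gi ((A ^^ K) (L a))) \<le> \<epsilon> * norm (P a)"
      by (simp add: H_def)
  qed
qed

end

section \<open>States of the array\<close>

abbreviation "lookup \<equiv> Poly_Mapping.lookup"
abbreviation "keys \<equiv> Poly_Mapping.keys"

section \<open>Finitely supported functions as an inner product space\<close>

instantiation poly_mapping :: (type, real_vector) real_vector
begin

lift_definition scaleR_poly_mapping :: "real \<Rightarrow> ('a \<Rightarrow>\<^sub>0 'b) \<Rightarrow> 'a \<Rightarrow>\<^sub>0 'b"
  is "\<lambda>c f k. c *\<^sub>R f k"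
  by (rule finite_subset) auto

instance
  by standard (transfer; simp add: fun_eq_iff scaleR_add_right scaleR_add_left)+

end

lemma lookup_scaleR [simp]: "lookup (c *\<^sub>R x) k = c *\<^sub>R lookup x k"
  by transfer simp

lemma keys_scaleR: "keys (c *\<^sub>R x) \<subseteq> keys x"
  by (auto simp: in_keys_iff)

instantiation poly_mapping :: (type, real_inner) real_inner
begin

definition inner_poly_mapping :: "('a \<Rightarrow>\<^sub>0 'b) \<Rightarrow> ('a \<Rightarrow>\<^sub>0 'b) \<Rightarrow> real" where
  "inner_poly_mapping x y = (\<Sum>k\<in>keys x. inner (lookup x k) (lookup y k))"

definition norm_poly_mapping :: "('a \<Rightarrow>\<^sub>0 'b) \<Rightarrow> real" where
  "norm_poly_mapping x = sqrt (inner x x)"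

definition dist_poly_mapping :: "('a \<Rightarrow>\<^sub>0 'b) \<Rightarrow> ('a \<Rightarrow>\<^sub>0 'b) \<Rightarrow> real" where
  "dist_poly_mapping x y = norm (x - y)"

definition sgn_poly_mapping :: "('a \<Rightarrow>\<^sub>0 'b) \<Rightarrow> ('a \<Rightarrow>\<^sub>0 'b)" where
  "sgn_poly_mapping x = inverse (norm x) *\<^sub>R x"

definition uniformity_poly_mapping :: "(('a \<Rightarrow>\<^sub>0 'b) \<times> ('a \<Rightarrow>\<^sub>0 'b)) filter" where
  "uniformity_poly_mapping = (INF e\<in>{0<..}. principal {(x, y). dist x y < e})"

definition open_poly_mapping :: "('a \<Rightarrow>\<^sub>0 'b) set \<Rightarrow> bool" where
  "open_poly_mapping U \<longleftrightarrow> (\<forall>x\<in>U. \<forall>\<^sub>F (x', y) in uniformity. x' = x \<longrightarrow> y \<in> U)"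

text \<open>The definition sums over the support of the first argument. Symmetry and additivity
  compare sums over different supports, which this brings to a common index set.\<close>

lemma inner_poly_mapping_superset:
  assumes "finite S" "keys x \<subseteq> S"
  shows "inner x y = (\<Sum>k\<in>S. inner (lookup x k) (lookup y k))"
  unfolding inner_poly_mapping_def using assms
  by (intro sum.mono_neutral_left) (auto simp: in_keys_iff)

instance
proof
  fix x y z :: "'a \<Rightarrow>\<^sub>0 'b" and r :: real
  define S where "S = keys x \<union> keys y"
  have S: "finite S" "keys x \<subseteq> S" "keys y \<subseteq> S" "keys (x + y) \<subseteq> S"
    using keys_add[of x y] by (auto simp: S_def)
  show "inner (x + y) z = inner x z + inner y z"
    unfolding inner_poly_mapping_superset[OF S(1,2)] inner_poly_mapping_superset[OF S(1,3)]
      inner_poly_mapping_superset[OF S(1,4)]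
    by (simp add: lookup_add inner_add_left sum.distrib)
  show "inner x y = inner y x"
    unfolding inner_poly_mapping_superset[OF S(1,2)] inner_poly_mapping_superset[OF S(1,3)]
    by (intro sum.cong refl inner_commute)
  show "inner (r *\<^sub>R x) y = r * inner x y"
    unfolding inner_poly_mapping_superset[OF finite_keys keys_scaleR]
    by (simp add: inner_poly_mapping_def sum_distrib_left)
  show "0 \<le> inner x x"
    by (simp add: inner_poly_mapping_def sum_nonneg)
  show "inner x x = 0 \<longleftrightarrow> x = 0"
  proof
    assume "inner x x = 0"
    then have "lookup x k = 0" if "k \<in> keys x" for k
      using that by (simp add: inner_poly_mapping_def sum_nonneg_eq_0_iff)
    then have "lookup x k = lookup 0 k" for k
      by (cases "k \<in> keys x") (simp_all add: in_keys_iff)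
    then show "x = 0" by (rule poly_mapping_eqI)
  qed (simp add: inner_poly_mapping_def)
qed (rule norm_poly_mapping_def dist_poly_mapping_def sgn_poly_mapping_def
    uniformity_poly_mapping_def open_poly_mapping_def)+

end

text \<open>Linearity at no cost: tested against \<open>y\<close>, the map becomes
  \<open>inner x (g y)\<close>, which is linear in \<open>x\<close>.\<close>

lemma adjoint_imp_linear:
  assumes "\<And>x y. inner (f x) y = inner x (g y)"
  shows "linear f"
  by (rule linearI; rule inner_extensionality) (simp_all add: assms inner_add_left)

text \<open>The dimension \<open>q n\<close> of the state space of the array is not the dimension of a type, so
  the space is embedded into the inner product space of finitely supported functions; index
  \<open>(i, r)\<close> is component \<open>r\<close> of system \<open>i\<close>.\<close>

type_synonym state = "nat \<times> nat \<Rightarrow>\<^sub>0 real"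

definition emb :: "nat \<Rightarrow> nat \<Rightarrow> (nat \<Rightarrow> real vec) \<Rightarrow> state" where
  "emb q n f = (\<Sum>i<q. \<Sum>r<n. Poly_Mapping.single (i, r) (f i $ r))"

definition blk :: "nat \<Rightarrow> state \<Rightarrow> nat \<Rightarrow> real vec" where
  "blk n x i = vec n (\<lambda>r. lookup x (i, r))"

lemma lookup_emb: "lookup (emb q n f) (i, r) = (if i < q \<and> r < n then f i $ r else 0)"
proof -
  have "lookup (emb q n f) (i, r) = (\<Sum>i'<q. \<Sum>r'<n. if i' = i \<and> r' = r then f i' $ r' else 0)"
    by (simp add: emb_def lookup_sum lookup_single when_def)
  also have "\<dots> = (\<Sum>i'<q. if i' = i then if r < n then f i' $ r else 0 else 0)"
  proof (intro sum.cong refl)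
    show "(\<Sum>r'<n. if i' = i \<and> r' = r then f i' $ r' else 0)
        = (if i' = i then if r < n then f i' $ r else 0 else 0)" for i'
      by (cases "i' = i") simp_all
  qed
  finally show ?thesis by simp
qed

lemma emb_cong: "(\<And>i r. i < q \<Longrightarrow> r < n \<Longrightarrow> f i $ r = g i $ r) \<Longrightarrow> emb q n f = emb q n g"
  unfolding emb_def by (intro sum.cong refl) simp

lemma blk_carrier [simp]: "blk n x i \<in> carrier_vec n" "dim_vec (blk n x i) = n"
  by (simp_all add: blk_def)

lemma blk_minus_carrier [simp]: "blk n x i - blk n y j \<in> carrier_vec n"
  by (rule minus_carrier_vec) simp_all

lemma blk_index [simp]: "r < n \<Longrightarrow> blk n x i $ r = lookup x (i, r)"
  by (simp add: blk_def)

lemma blk_emb [simp]: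
  assumes "i < q" "f i \<in> carrier_vec n"
  shows "blk n (emb q n f) i = f i"
  by (rule eq_vecI) (simp_all add: lookup_emb assms(1) carrier_vecD[OF assms(2)])

lemma state_eqI: "(\<And>i r. lookup x (i, r) = lookup y (i, r)) \<Longrightarrow> x = y" for x y :: state
  by (rule poly_mapping_eqI) (metis surj_pair)

lemma emb_add:
  assumes "\<And>i. i < q \<Longrightarrow> f i \<in> carrier_vec n" "\<And>i. i < q \<Longrightarrow> g i \<in> carrier_vec n"
  shows "emb q n (\<lambda>i. f i + g i) = emb q n f + emb q n g"
  by (rule state_eqI) (simp add: lookup_emb lookup_add carrier_vecD[OF assms(2)])

lemma emb_minus:
  assumes "\<And>i. i < q \<Longrightarrow> f i \<in> carrier_vec n" "\<And>i. i < q \<Longrightarrow> g i \<in> carrier_vec n"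
  shows "emb q n (\<lambda>i. f i - g i) = emb q n f - emb q n g"
  by (rule state_eqI) (simp add: lookup_emb lookup_minus carrier_vecD[OF assms(2)])

lemma emb_uminus:
  assumes "\<And>i. i < q \<Longrightarrow> f i \<in> carrier_vec n"
  shows "emb q n (\<lambda>i. - f i) = - emb q n f"
  by (rule state_eqI) (simp add: lookup_emb carrier_vecD[OF assms])

lemma scalar_prod_lessThan: "u \<in> carrier_vec n \<Longrightarrow> v \<in> carrier_vec n \<Longrightarrow> u \<bullet> v = (\<Sum>r<n. u $ r * v $ r)"
  by (simp add: scalar_prod_def atLeast0LessThan)

lemma inner_emb:
  assumes "\<And>i. i < q \<Longrightarrow> f i \<in> carrier_vec n"
  shows "inner (emb q n f) x = (\<Sum>i<q. f i \<bullet> blk n x i)"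
proof -
  have "keys (emb q n f) \<subseteq> {..<q} \<times> {..<n}"
    by (auto simp: in_keys_iff lookup_emb split: if_splits)
  then have "inner (emb q n f) x = (\<Sum>(i, r)\<in>{..<q} \<times> {..<n}. f i $ r * lookup x (i, r))"
    by (subst inner_poly_mapping_superset[of "{..<q} \<times> {..<n}"])
      (auto intro!: sum.cong simp: lookup_emb)
  also have "\<dots> = (\<Sum>i<q. \<Sum>r<n. f i $ r * lookup x (i, r))"
    by (simp add: sum.cartesian_product)
  also have "\<dots> = (\<Sum>i<q. f i \<bullet> blk n x i)"
    by (intro sum.cong refl) (simp add: scalar_prod_lessThan[OF assms blk_carrier(1)])
  finally show ?thesis .
qed

definition unit_states :: "nat \<Rightarrow> nat \<Rightarrow> state set" where
  "unit_states q n = (\<lambda>k. Poly_Mapping.single k 1) ` ({..<q} \<times> {..<n})"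

lemma inner_single: "inner (Poly_Mapping.single k c) x = c * lookup x k" for c :: real
  by (subst inner_poly_mapping_superset[of "{k}"]) auto

lemma single_one_eq_iff: "Poly_Mapping.single k (1::real) = Poly_Mapping.single k' 1 \<longleftrightarrow> k = k'"
proof
  assume "Poly_Mapping.single k (1::real) = Poly_Mapping.single k' 1"
  then have "lookup (Poly_Mapping.single k (1::real)) k = lookup (Poly_Mapping.single k' 1) k"
    by simp
  then show "k = k'"
    by (simp add: lookup_single when_def split: if_splits)
qed simp

lemma unit_states_orthonormal:
  "e \<in> unit_states q n \<Longrightarrow> e' \<in> unit_states q n \<Longrightarrow> inner e e' = (if e = e' then 1 else 0)"
  unfolding unit_states_def by (auto simp: inner_single lookup_single when_def single_one_eq_iff)

lemma sum_unit_states: "(\<Sum>e\<in>unit_states q n. inner x e *\<^sub>R e) = emb q n (blk n x)"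
proof -
  have inj: "inj_on (\<lambda>k. Poly_Mapping.single k (1::real)) ({..<q} \<times> {..<n})"
    by (rule inj_onI) (simp add: single_one_eq_iff)
  have "(\<Sum>e\<in>unit_states q n. inner x e *\<^sub>R e)
      = (\<Sum>(i, r)\<in>{..<q} \<times> {..<n}. Poly_Mapping.single (i, r) (lookup x (i, r)))"
    unfolding unit_states_def sum.reindex[OF inj]
    by (intro sum.cong refl) (auto intro!: poly_mapping_eqI
        simp: inner_commute[of x] inner_single lookup_single when_def)
  also have "\<dots> = emb q n (blk n x)"
    by (simp add: emb_def sum.cartesian_product)
  finally show ?thesis .
qed

text \<open>An adjoint gives linearity; dependence on the blocks below \<open>q\<close> alone means
  dependence on finitely many coordinates and gives boundedness. Both are at hand for
  \<open>diag\<close> and \<open>lapl\<close>.\<close>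

lemma state_map_bounded:
  fixes f :: "state \<Rightarrow> state"
  assumes adj: "\<And>x y. inner (f x) y = inner x (g y)"
    and dep: "\<And>x y. (\<And>i. i < q \<Longrightarrow> blk n x i = blk n y i) \<Longrightarrow> f x = f y"
  shows "bounded_linear f"
  by (rule linear_coordinates_bounded[OF adjoint_imp_linear[OF adj], of "unit_states q n"])
    (auto simp: sum_unit_states intro: dep)

section \<open>Block diagonal maps, Laplacians and disagreement\<close>

definition diag :: "nat \<Rightarrow> nat \<Rightarrow> real mat \<Rightarrow> state \<Rightarrow> state" where
  "diag q n M x = emb q n (\<lambda>i. M *\<^sub>v blk n x i)"

definition lapl :: "nat \<Rightarrow> nat \<Rightarrow> (nat \<Rightarrow> nat \<Rightarrow> real mat) \<Rightarrow> state \<Rightarrow> state" where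
  "lapl q n W x = emb q n (\<lambda>i. vsum n (\<lambda>j. W i j *\<^sub>v (blk n x i - blk n x j)) {..<q})"

text \<open>Orthogonal projection onto the complement of the synchronization subspace, written as a multiple
  of the Laplacian of the complete graph so that it inherits the lemmas on Laplacians.\<close>

definition disag :: "nat \<Rightarrow> nat \<Rightarrow> state \<Rightarrow> state" where
  "disag q n x = (1 / real q) *\<^sub>R lapl q n (\<lambda>_ _. 1\<^sub>m n) x"

lemma vsum_carrier [simp]: "(\<And>j. j \<in> S \<Longrightarrow> f j \<in> carrier_vec n) \<Longrightarrow> vsum n f S \<in> carrier_vec n"
  by (rule finsum_vec_closed) auto

lemma vsum_index:
  "finite S \<Longrightarrow> r < n \<Longrightarrow> (\<And>j. j \<in> S \<Longrightarrow> f j \<in> carrier_vec n) \<Longrightarrow> vsum n f S $ r = (\<Sum>j\<in>S. f j $ r)"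
  by (rule index_finsum_vec) auto

lemma vsum_dim [simp]: "(\<And>j. j \<in> S \<Longrightarrow> f j \<in> carrier_vec n) \<Longrightarrow> dim_vec (vsum n f S) = n"
  by (rule carrier_vecD[OF vsum_carrier])

lemma scalar_prod_vsum:
  assumes "finite S" "u \<in> carrier_vec n" "\<And>j. j \<in> S \<Longrightarrow> f j \<in> carrier_vec n"
  shows "u \<bullet> vsum n f S = (\<Sum>j\<in>S. u \<bullet> f j)"
proof -
  have "u \<bullet> vsum n f S = (\<Sum>r<n. \<Sum>j\<in>S. u $ r * f j $ r)"
    using assms by (simp add: scalar_prod_lessThan vsum_index sum_distrib_left)
  also have "\<dots> = (\<Sum>j\<in>S. \<Sum>r<n. u $ r * f j $ r)"
    by (rule sum.swap)
  also have "\<dots> = (\<Sum>j\<in>S. u \<bullet> f j)"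
    using assms by (intro sum.cong refl) (simp add: scalar_prod_lessThan)
  finally show ?thesis .
qed

lemma mult_mat_vec_vsum:
  assumes "finite S" "M \<in> carrier_mat m n" "\<And>j. j \<in> S \<Longrightarrow> f j \<in> carrier_vec n"
  shows "M *\<^sub>v vsum n f S = vsum m (\<lambda>j. M *\<^sub>v f j) S"
proof (rule eq_vecI)
  have c: "M *\<^sub>v f j \<in> carrier_vec m" if "j \<in> S" for j
    using assms that by simp
  show "dim_vec (M *\<^sub>v vsum n f S) = dim_vec (vsum m (\<lambda>j. M *\<^sub>v f j) S)"
    using assms(2) c by simp
  fix r assume "r < dim_vec (vsum m (\<lambda>j. M *\<^sub>v f j) S)"
  then have r: "r < m" using c by simp
  then show "(M *\<^sub>v vsum n f S) $ r = vsum m (\<lambda>j. M *\<^sub>v f j) S $ r"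
    using assms c by (simp add: vsum_index scalar_prod_vsum)
qed

lemma mult_mat_vec_uminus:
  fixes M :: "real mat"
  assumes "M \<in> carrier_mat m n" "v \<in> carrier_vec n"
  shows "M *\<^sub>v (- v) = - (M *\<^sub>v v)"
  using assms by (intro eq_vecI) (auto simp: scalar_prod_uminus_right)

lemma vsum_cong: "(\<And>j. j \<in> S \<Longrightarrow> f j = g j) \<Longrightarrow> (\<And>j. j \<in> S \<Longrightarrow> g j \<in> carrier_vec n) \<Longrightarrow> vsum n f S = vsum n g S"
  unfolding finsum_vec_def
  by (rule comm_monoid.finprod_cong'[OF comm_monoid_vec]) (auto simp: monoid_vec_simps)

lemma diag_adjoint:
  assumes "M \<in> carrier_mat n n"
  shows "inner (diag q n M x) y = inner x (diag q n M\<^sup>T y)"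
proof -
  have "inner (diag q n M x) y = (\<Sum>i<q. (M *\<^sub>v blk n x i) \<bullet> blk n y i)"
    unfolding diag_def by (rule inner_emb) (use assms in simp)
  also have "\<dots> = (\<Sum>i<q. (M\<^sup>T *\<^sub>v blk n y i) \<bullet> blk n x i)"
  proof (intro sum.cong refl)
    fix i
    have "(M *\<^sub>v blk n x i) \<bullet> blk n y i = blk n y i \<bullet> (M *\<^sub>v blk n x i)"
      using assms by (intro comm_scalar_prod[of _ n]) auto
    then show "(M *\<^sub>v blk n x i) \<bullet> blk n y i = (M\<^sup>T *\<^sub>v blk n y i) \<bullet> blk n x i"
      by (simp add: transpose_vec_mult_scalar[OF assms])
  qed
  also have "\<dots> = inner x (diag q n M\<^sup>T y)"
    unfolding diag_def inner_commute[of x] by (rule inner_emb[symmetric]) (use assms in simp)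
  finally show ?thesis .
qed

lemma diag_depends: "(\<And>i. i < q \<Longrightarrow> blk n x i = blk n y i) \<Longrightarrow> diag q n M x = diag q n M y"
  unfolding diag_def by (intro emb_cong) simp

lemma bounded_linear_diag: "M \<in> carrier_mat n n \<Longrightarrow> bounded_linear (diag q n M)"
  by (rule state_map_bounded[where g = "diag q n M\<^sup>T"]) (auto intro: diag_adjoint diag_depends)

lemma blk_diag_pow:
  assumes "M \<in> carrier_mat n n" "i < q"
  shows "blk n ((diag q n M ^^ l) x) i = M ^\<^sub>m l *\<^sub>v blk n x i"
proof (induction l arbitrary: x)
  case (Suc l)
  have "blk n ((diag q n M ^^ Suc l) x) i = M ^\<^sub>m l *\<^sub>v blk n (diag q n M x) i"
    using Suc by (simp only: funpow_Suc_right o_apply)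
  also have "\<dots> = M ^\<^sub>m l *\<^sub>v (M *\<^sub>v blk n x i)"
    using assms by (simp add: diag_def)
  also have "\<dots> = M ^\<^sub>m Suc l *\<^sub>v blk n x i"
    using assms by (simp add: assoc_mult_mat_vec[of _ n n _ n] pow_carrier_mat)
  finally show ?case .
qed (use assms in simp)

locale laplacian =
  fixes q n :: nat and W :: "nat \<Rightarrow> nat \<Rightarrow> real mat"
  assumes W_carrier [simp]: "i < q \<Longrightarrow> j < q \<Longrightarrow> W i j \<in> carrier_mat n n"
    and W_swap: "i < q \<Longrightarrow> j < q \<Longrightarrow> W j i = W i j"
    and W_sym: "i < q \<Longrightarrow> j < q \<Longrightarrow> (W i j)\<^sup>T = W i j"
begin

lemma W_mult_carrier [simp]: "i < q \<Longrightarrow> j < q \<Longrightarrow> v \<in> carrier_vec n \<Longrightarrow> W i j *\<^sub>v v \<in> carrier_vec n"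
  by (rule mult_mat_vec_carrier[OF W_carrier])

lemma W_diff_carrier: "i < q \<Longrightarrow> j < q \<Longrightarrow> W i j *\<^sub>v (blk n x i - blk n x j) \<in> carrier_vec n"
  by (rule W_mult_carrier) simp_all

lemma vsum_W_carrier:
  "i < q \<Longrightarrow> vsum n (\<lambda>j. W i j *\<^sub>v (blk n x i - blk n x j)) {..<q} \<in> carrier_vec n"
  by (rule vsum_carrier) (simp add: W_diff_carrier)

text \<open>What an edge contributes to block \<open>j\<close> is minus what it contributes to block
  \<open>i\<close>. Averaging the double sum with its swapped form turns the blocks of
  \<open>x\<close> into differences, and symmetry and positivity can then be read off edge by
  edge.\<close>

lemma lapl_inner:
  "inner x (lapl q n W y) =
    (\<Sum>i<q. \<Sum>j<q. (blk n x i - blk n x j) \<bullet> (W i j *\<^sub>v (blk n y i - blk n y j))) / 2"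
proof -
  define g where "g i j = W i j *\<^sub>v (blk n y i - blk n y j)" for i j
  have g: "g i j \<in> carrier_vec n" if "i < q" "j < q" for i j
    using that by (simp add: g_def)
  have g_swap: "g j i = - g i j" if "i < q" "j < q" for i j
  proof -
    have "blk n y j - blk n y i = - (blk n y i - blk n y j)" by auto
    then show ?thesis
      using that by (simp add: g_def W_swap[of i j] mult_mat_vec_uminus[of _ n n])
  qed
  have "inner x (lapl q n W y) = (\<Sum>i<q. vsum n (g i) {..<q} \<bullet> blk n x i)"
    unfolding lapl_def inner_commute[of x] g_def by (rule inner_emb[OF vsum_W_carrier])
  also have "\<dots> = (\<Sum>i<q. \<Sum>j<q. blk n x i \<bullet> g i j)"
  proof (rule sum.cong[OF refl])
    fix i assume "i \<in> {..<q}"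
    then have gi: "g i j \<in> carrier_vec n" if "j \<in> {..<q}" for j
      using g that by simp
    have "vsum n (g i) {..<q} \<bullet> blk n x i = blk n x i \<bullet> vsum n (g i) {..<q}"
      by (rule comm_scalar_prod[OF vsum_carrier[OF gi] blk_carrier(1)])
    also have "\<dots> = (\<Sum>j<q. blk n x i \<bullet> g i j)"
      by (rule scalar_prod_vsum[OF finite_lessThan blk_carrier(1) gi])
    finally show "vsum n (g i) {..<q} \<bullet> blk n x i = (\<Sum>j<q. blk n x i \<bullet> g i j)" .
  qed
  finally have 1: "inner x (lapl q n W y) = (\<Sum>i<q. \<Sum>j<q. blk n x i \<bullet> g i j)" .
  also have "\<dots> = (\<Sum>i<q. \<Sum>j<q. blk n x j \<bullet> g j i)"
    by (rule sum.swap)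
  also have "\<dots> = (\<Sum>i<q. \<Sum>j<q. - (blk n x j \<bullet> g i j))"
  proof (intro sum.cong refl)
    fix i j assume "i \<in> {..<q}" "j \<in> {..<q}"
    then show "blk n x j \<bullet> g j i = - (blk n x j \<bullet> g i j)"
      using g[of i j] by (simp add: g_swap[of i j])
  qed
  finally have 2: "inner x (lapl q n W y) = (\<Sum>i<q. \<Sum>j<q. - (blk n x j \<bullet> g i j))" .
  have "inner x (lapl q n W y) + inner x (lapl q n W y)
      = (\<Sum>i<q. \<Sum>j<q. blk n x i \<bullet> g i j) + (\<Sum>i<q. \<Sum>j<q. - (blk n x j \<bullet> g i j))"
    by (rule arg_cong2[OF 1 2])
  also have "\<dots> = (\<Sum>i<q. \<Sum>j<q. blk n x i \<bullet> g i j + - (blk n x j \<bullet> g i j))"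
    by (simp only: sum.distrib)
  also have "\<dots> = (\<Sum>i<q. \<Sum>j<q. (blk n x i - blk n x j) \<bullet> g i j)"
    using g by (intro sum.cong refl) (simp add: minus_scalar_prod_distrib[of _ n])
  finally show ?thesis by (simp add: g_def)
qed

lemma lapl_sym: "inner (lapl q n W x) y = inner x (lapl q n W y)"
proof -
  have *: "u \<bullet> (W i j *\<^sub>v v) = v \<bullet> (W i j *\<^sub>v u)"
    if "i < q" "j < q" "u \<in> carrier_vec n" "v \<in> carrier_vec n" for i j u v
    using transpose_vec_mult_scalar[OF W_carrier[of i j], of v u] that
    by (simp add: W_sym comm_scalar_prod[of _ n])
  show ?thesis
    unfolding inner_commute[of _ y] lapl_inner
    by (intro arg_cong[of _ _ "\<lambda>c. c / 2"] sum.cong refl *) simp_all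
qed

lemma lapl_depends:
  assumes "\<And>i j. i < q \<Longrightarrow> j < q \<Longrightarrow> blk n x i - blk n x j = blk n y i - blk n y j"
  shows "lapl q n W x = lapl q n W y"
  unfolding lapl_def
  by (intro emb_cong arg_cong[of _ _ "\<lambda>v. v $ _"] vsum_cong) (use assms in auto)

lemma bounded_linear_lapl: "bounded_linear (lapl q n W)"
  by (rule state_map_bounded[OF lapl_sym, where q = q and n = n]) (auto intro: lapl_depends)

lemma blk_lapl: "i < q \<Longrightarrow> blk n (lapl q n W x) i = vsum n (\<lambda>j. W i j *\<^sub>v (blk n x i - blk n x j)) {..<q}"
  unfolding lapl_def by (rule blk_emb) (simp_all add: vsum_W_carrier)

text \<open>Meant for the complete graph with identity weights, with which every \<open>M\<close>
  commutes: this is why \<open>disag\<close> commutes with the dynamics.\<close>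

lemma lapl_diag_commute:
  assumes M: "M \<in> carrier_mat n n" and comm: "\<And>i j. i < q \<Longrightarrow> j < q \<Longrightarrow> M * W i j = W i j * M"
  shows "lapl q n W (diag q n M x) = diag q n M (lapl q n W x)"
proof -
  have "W i j *\<^sub>v (M *\<^sub>v blk n x i - M *\<^sub>v blk n x j) = M *\<^sub>v (W i j *\<^sub>v (blk n x i - blk n x j))"
    if "i < q" "j < q" for i j
  proof -
    have "W i j *\<^sub>v (M *\<^sub>v blk n x i - M *\<^sub>v blk n x j) = W i j *\<^sub>v (M *\<^sub>v (blk n x i - blk n x j))"
      using M by (simp add: mult_minus_distrib_mat_vec[of _ n n])
    also have "\<dots> = (W i j * M) *\<^sub>v (blk n x i - blk n x j)"
      using M that by (intro assoc_mult_mat_vec[symmetric, of _ n n _ n]) auto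
    also have "\<dots> = (M * W i j) *\<^sub>v (blk n x i - blk n x j)"
      using comm that by simp
    also have "\<dots> = M *\<^sub>v (W i j *\<^sub>v (blk n x i - blk n x j))"
      using M that by (intro assoc_mult_mat_vec[of _ n n _ n]) auto
    finally show ?thesis .
  qed
  note comm' = this
  have Ax: "blk n (diag q n M x) i = M *\<^sub>v blk n x i" if "i < q" for i
    unfolding diag_def by (rule blk_emb[OF that]) (use M in simp)
  have "vsum n (\<lambda>j. W i j *\<^sub>v (blk n (diag q n M x) i - blk n (diag q n M x) j)) {..<q}
      = M *\<^sub>v blk n (lapl q n W x) i" if "i < q" for i
  proof -
    have "vsum n (\<lambda>j. W i j *\<^sub>v (blk n (diag q n M x) i - blk n (diag q n M x) j)) {..<q}
        = vsum n (\<lambda>j. M *\<^sub>v (W i j *\<^sub>v (blk n x i - blk n x j))) {..<q}"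
      using that M by (intro vsum_cong) (simp_all add: Ax comm' W_diff_carrier)
    also have "\<dots> = M *\<^sub>v vsum n (\<lambda>j. W i j *\<^sub>v (blk n x i - blk n x j)) {..<q}"
      using that W_diff_carrier by (intro mult_mat_vec_vsum[symmetric, OF _ M]) simp_all
    finally show ?thesis by (simp only: blk_lapl[OF that])
  qed
  then show ?thesis
    unfolding lapl_def[of q n W "diag q n M x"] diag_def[of q n M "lapl q n W x"]
    by (intro emb_cong) simp
qed

end

interpretation complete: laplacian q n "\<lambda>_ _. 1\<^sub>m n" for q n
  by unfold_locales auto

lemma blk_scaleR: "blk n (c *\<^sub>R x) i = c \<cdot>\<^sub>v blk n x i"
  by auto

text \<open>The scaled Laplacian of the complete graph subtracts the mean of the blocks.\<close>

lemma blk_disag_index: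
  assumes "i < q" "r < n"
  shows "blk n (disag q n x) i $ r = lookup x (i, r) - (\<Sum>j<q. lookup x (j, r)) / real q"
proof -
  have "blk n (disag q n x) i $ r = (1 / real q) * (\<Sum>j<q. lookup x (i, r) - lookup x (j, r))"
    using assms unfolding disag_def blk_scaleR complete.blk_lapl[OF assms(1)]
    by (simp add: vsum_index)
  then show ?thesis
    using assms by (simp add: sum_subtractf diff_divide_distrib)
qed

lemma disag_diff:
  assumes "i < q" "j < q"
  shows "blk n (disag q n x) i - blk n (disag q n x) j = blk n x i - blk n x j"
proof (rule eq_vecI)
  fix r assume "r < dim_vec (blk n x i - blk n x j)"
  then have "r < n" by simp
  then show "(blk n (disag q n x) i - blk n (disag q n x) j) $ r = (blk n x i - blk n x j) $ r"
    using blk_disag_index[OF assms(1), of r n x] blk_disag_index[OF assms(2), of r n x] by simp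
qed simp

text \<open>\<open>disag\<close> depends on differences of blocks only, and by
  \<open>disag_diff\<close> it leaves these unchanged.\<close>

lemma disag_idem: "disag q n (disag q n x) = disag q n x"
proof -
  have "lapl q n (\<lambda>_ _. 1\<^sub>m n) (disag q n x) = lapl q n (\<lambda>_ _. 1\<^sub>m n) x"
    by (rule complete.lapl_depends) (rule disag_diff)
  then have "disag q n (disag q n x) = (1 / real q) *\<^sub>R lapl q n (\<lambda>_ _. 1\<^sub>m n) x"
    by (subst disag_def) (simp only:)
  then show ?thesis
    by (simp only: disag_def[symmetric])
qed

lemma disag_sym: "inner (disag q n x) y = inner x (disag q n y)"
  by (simp add: disag_def complete.lapl_sym)

lemma bounded_linear_disag: "bounded_linear (disag q n)"
  unfolding disag_def
  by (intro complete.bounded_linear_lapl[THEN bounded_linear_compose[OF bounded_linear_scaleR_right]])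

lemma disag_diag: "M \<in> carrier_mat n n \<Longrightarrow> disag q n (diag q n M x) = diag q n M (disag q n x)"
  using complete.lapl_diag_commute[of M n q x]
    linear_cmul[OF bounded_linear.linear[OF bounded_linear_diag[of M n q]]]
  by (simp add: disag_def)

text \<open>Values of \<open>disag\<close> have no component outside the array, so their expansion
  in \<open>unit_states\<close> is complete. This supplies the assumption on \<open>E\<close> in
  \<open>horizon\<close>.\<close>

lemma emb_blk_disag: "emb q n (blk n (disag q n x)) = disag q n x"
  by (rule state_eqI) (simp add: lookup_emb disag_def lapl_def)

lemma disag_eq_0:
  assumes "\<And>i j. i < q \<Longrightarrow> j < q \<Longrightarrow> blk n x i = blk n x j"
  shows "disag q n x = 0"
proof -
  have "lapl q n (\<lambda>_ _. 1\<^sub>m n) x = lapl q n (\<lambda>_ _. 1\<^sub>m n) 0"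
  proof (rule complete.lapl_depends)
    fix i j assume "i < q" "j < q"
    then have "blk n x i = blk n x j" by (rule assms)
    then show "blk n x i - blk n x j = blk n 0 i - blk n 0 j"
      by (simp only:) auto
  qed
  then have "disag q n x = (1 / real q) *\<^sub>R lapl q n (\<lambda>_ _. 1\<^sub>m n) 0"
    by (simp only: disag_def)
  then show ?thesis
    by (simp add: linear_0[OF bounded_linear.linear[OF complete.bounded_linear_lapl]])
qed

lemma (in laplacian) lapl_disag: "lapl q n W (disag q n x) = lapl q n W x"
  by (rule lapl_depends) (rule disag_diff)

text \<open>The Laplacian form is a sum of nonnegative edge terms, so it vanishes only if every edge
  term does. \<open>nondeg\<close> is therefore stated edge by edge, the form in which
  controllability and observability deliver it.\<close>

lemma (in laplacian) horizon_array:
  assumes M: "M \<in> carrier_mat n n"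
    and psd: "\<And>i j v. i < q \<Longrightarrow> j < q \<Longrightarrow> v \<in> carrier_vec n \<Longrightarrow> 0 \<le> v \<bullet> (W i j *\<^sub>v v)"
    and nondeg: "\<And>x. (\<And>l i j. l \<le> K \<Longrightarrow> i < q \<Longrightarrow> j < q \<Longrightarrow>
        ((M\<^sup>T) ^\<^sub>m l *\<^sub>v (blk n x i - blk n x j)) \<bullet>
          (W i j *\<^sub>v ((M\<^sup>T) ^\<^sub>m l *\<^sub>v (blk n x i - blk n x j))) = 0)
      \<Longrightarrow> disag q n x = 0"
  shows "horizon (diag q n M) (diag q n M\<^sup>T) (lapl q n W) (disag q n) (unit_states q n) K"
proof (rule horizon.intro)
  have M': "M\<^sup>T \<in> carrier_mat n n" using M by simp
  show "bounded_linear (diag q n M)" "bounded_linear (diag q n M\<^sup>T)"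
    using M M' by (auto intro: bounded_linear_diag)
  show "bounded_linear (lapl q n W)" "bounded_linear (disag q n)"
    by (rule bounded_linear_lapl bounded_linear_disag)+
  show "finite (unit_states q n)"
    by (simp add: unit_states_def)
  fix x y e e' :: state
  show "inner (diag q n M x) y = inner x (diag q n M\<^sup>T y)"
    by (rule diag_adjoint[OF M])
  show "inner (lapl q n W x) y = inner x (lapl q n W y)" by (rule lapl_sym)
  show "0 \<le> inner x (lapl q n W x)"
    unfolding lapl_inner by (intro divide_nonneg_nonneg sum_nonneg psd) auto
  show "disag q n (disag q n x) = disag q n x" by (rule disag_idem)
  show "inner (disag q n x) y = inner x (disag q n y)" by (rule disag_sym)
  show "disag q n (diag q n M x) = diag q n M (disag q n x)" by (rule disag_diag[OF M])
  show "lapl q n W (disag q n x) = lapl q n W x" by (rule lapl_disag)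
  show "(\<Sum>e\<in>unit_states q n. inner (disag q n x) e *\<^sub>R e) = disag q n x"
    by (simp add: sum_unit_states emb_blk_disag)
  show "inner e e' = (if e = e' then 1 else 0)"
    if "e \<in> unit_states q n" "e' \<in> unit_states q n"
    using that by (rule unit_states_orthonormal)
  assume 0: "\<And>l. l \<le> K \<Longrightarrow> inner ((diag q n M\<^sup>T ^^ l) x) (lapl q n W ((diag q n M\<^sup>T ^^ l) x)) = 0"
  show "disag q n x = 0"
  proof (rule nondeg)
    fix l i j assume l: "l \<le> K" and ij: "i < q" "j < q"
    let ?d = "\<lambda>i j. blk n ((diag q n M\<^sup>T ^^ l) x) i - blk n ((diag q n M\<^sup>T ^^ l) x) j"
    have "(\<Sum>i<q. \<Sum>j<q. ?d i j \<bullet> (W i j *\<^sub>v ?d i j)) = 0"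
      using 0[OF l] unfolding lapl_inner by simp
    then have "(\<Sum>j<q. ?d i j \<bullet> (W i j *\<^sub>v ?d i j)) = 0"
      using ij by (subst (asm) sum_nonneg_eq_0_iff) (auto intro!: sum_nonneg psd)
    then have "?d i j \<bullet> (W i j *\<^sub>v ?d i j) = 0"
      using ij by (subst (asm) sum_nonneg_eq_0_iff) (auto intro!: psd)
    moreover have "?d i j = (M\<^sup>T) ^\<^sub>m l *\<^sub>v (blk n x i - blk n x j)"
      using M' ij by (simp add: blk_diag_pow mult_minus_distrib_mat_vec[of _ n n] pow_carrier_mat)
    ultimately show "((M\<^sup>T) ^\<^sub>m l *\<^sub>v (blk n x i - blk n x j)) \<bullet>
          (W i j *\<^sub>v ((M\<^sup>T) ^\<^sub>m l *\<^sub>v (blk n x i - blk n x j))) = 0"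
      by simp
  qed
qed

section \<open>Block matrices\<close>

lemma sum_lessThan_add: "(\<Sum>c<a + b. g c) = (\<Sum>c<a. g c) + (\<Sum>c<b. g (a + c))"
  for g :: "nat \<Rightarrow> 'a::comm_monoid_add"
  by (induction b) (simp_all add: add.assoc)

lemma sum_lessThan_mult: "(\<Sum>c<k * d. g c) = (\<Sum>l<k. \<Sum>s<d. g (l * d + s))"
  for g :: "nat \<Rightarrow> 'a::comm_monoid_add"
  by (induction k) (simp_all add: sum_lessThan_add add.commute[of d])

lemma hcat_Nil: "hcat nr [] = 0\<^sub>m nr 0"
  by (simp add: hcat_def)

lemma hcat_Cons: "hcat nr (M # Ms) =
    four_block_mat M (hcat nr Ms) (0\<^sub>m 0 (dim_col M)) (0\<^sub>m 0 (dim_col (hcat nr Ms)))"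
  by (simp add: hcat_def)

lemma vcat_Nil: "vcat nc [] = 0\<^sub>m 0 nc"
  by (simp add: vcat_def)

lemma vcat_Cons: "vcat nc (M # Ms) = M @\<^sub>r vcat nc Ms"
  by (simp add: vcat_def)

lemma dim_row_hcat [simp]: "(\<And>M. M \<in> set Ms \<Longrightarrow> dim_row M = nr) \<Longrightarrow> dim_row (hcat nr Ms) = nr"
  by (cases Ms) (simp_all add: hcat_Nil hcat_Cons)

lemma dim_col_hcat: "(\<And>M. M \<in> set Ms \<Longrightarrow> dim_col M = d) \<Longrightarrow> dim_col (hcat nr Ms) = length Ms * d"
  by (induction Ms) (simp_all add: hcat_Nil hcat_Cons)

lemma dim_col_vcat [simp]: "(\<And>M. M \<in> set Ms \<Longrightarrow> dim_col M = nc) \<Longrightarrow> dim_col (vcat nc Ms) = nc"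
  by (cases Ms) (simp_all add: vcat_Nil vcat_Cons append_rows_def)

lemma dim_row_vcat: "(\<And>M. M \<in> set Ms \<Longrightarrow> dim_row M = d) \<Longrightarrow> dim_row (vcat nc Ms) = length Ms * d"
  by (induction Ms) (simp_all add: vcat_Nil vcat_Cons append_rows_def)

lemma hcat_index:
  assumes "\<And>M. M \<in> set Ms \<Longrightarrow> M \<in> carrier_mat nr d" "i < nr" "c < length Ms * d"
  shows "hcat nr Ms $$ (i, c) = Ms ! (c div d) $$ (i, c mod d)"
  using assms
proof (induction Ms arbitrary: c)
  case (Cons M Ms)
  have M: "dim_row M = nr" "dim_col M = d"
    using Cons.prems(1)[of M] by auto
  have H: "dim_row (hcat nr Ms) = nr" "dim_col (hcat nr Ms) = length Ms * d"
    using Cons.prems(1) by (auto intro!: dim_col_hcat dim_row_hcat)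
  have c: "c < d + length Ms * d"
    using Cons.prems(3) by simp
  show ?case
  proof (cases "c < d")
    case True
    then show ?thesis
      using Cons.prems(2) c by (simp add: hcat_Cons M H)
  next
    case False
    have d: "d > 0"
      using c by (cases d) auto
    have "hcat nr (M # Ms) $$ (i, c) = hcat nr Ms $$ (i, c - d)"
      using Cons.prems(2) c False by (simp add: hcat_Cons M H)
    also have "\<dots> = Ms ! ((c - d) div d) $$ (i, (c - d) mod d)"
      by (rule Cons.IH) (use Cons.prems c False in auto)
    also have "\<dots> = (M # Ms) ! (c div d) $$ (i, c mod d)"
      using False d by (simp add: le_div_geq le_mod_geq)
    finally show ?thesis .
  qed
qed simp

lemma vcat_index:
  assumes "\<And>M. M \<in> set Ms \<Longrightarrow> M \<in> carrier_mat d nc" "c < nc" "r < length Ms * d"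
  shows "vcat nc Ms $$ (r, c) = Ms ! (r div d) $$ (r mod d, c)"
  using assms
proof (induction Ms arbitrary: r)
  case (Cons M Ms)
  have M: "dim_row M = d" "dim_col M = nc"
    using Cons.prems(1)[of M] by auto
  have H: "dim_col (vcat nc Ms) = nc" "dim_row (vcat nc Ms) = length Ms * d"
    using Cons.prems(1) by (auto intro!: dim_col_vcat dim_row_vcat)
  have r: "r < d + length Ms * d"
    using Cons.prems(3) by simp
  show ?case
  proof (cases "r < d")
    case True
    then show ?thesis
      using Cons.prems(2) r by (simp add: vcat_Cons append_rows_def M H)
  next
    case False
    have d: "d > 0"
      using r by (cases d) auto
    have "vcat nc (M # Ms) $$ (r, c) = vcat nc Ms $$ (r - d, c)"
      using Cons.prems(2) r False by (simp add: vcat_Cons append_rows_def M H)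
    also have "\<dots> = Ms ! ((r - d) div d) $$ ((r - d) mod d, c)"
      by (rule Cons.IH) (use Cons.prems r False in auto)
    also have "\<dots> = (M # Ms) ! (r div d) $$ (r mod d, c)"
      using False d by (simp add: le_div_geq le_mod_geq)
    finally show ?thesis .
  qed
qed simp

lemma mult_mat_vec_index:
  "M \<in> carrier_mat m k \<Longrightarrow> v \<in> carrier_vec k \<Longrightarrow> r < m \<Longrightarrow> (M *\<^sub>v v) $ r = (\<Sum>c<k. M $$ (r, c) * v $ c)"
  by (auto simp: scalar_prod_def atLeast0LessThan intro!: sum.cong)

lemma hcat_carrier:
  assumes "\<And>l. l < k \<Longrightarrow> f l \<in> carrier_mat nr d"
  shows "hcat nr (map f [0..<k]) \<in> carrier_mat nr (k * d)"
proof (rule carrier_matI)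
  have d: "dim_row M = nr \<and> dim_col M = d" if "M \<in> set (map f [0..<k])" for M
    using that by (auto simp: carrier_matD[OF assms])
  show "dim_row (hcat nr (map f [0..<k])) = nr"
    by (rule dim_row_hcat) (use d in blast)
  have "dim_col (hcat nr (map f [0..<k])) = length (map f [0..<k]) * d"
    by (rule dim_col_hcat) (use d in blast)
  then show "dim_col (hcat nr (map f [0..<k])) = k * d" by simp
qed

lemma vcat_carrier:
  assumes "\<And>l. l < k \<Longrightarrow> f l \<in> carrier_mat d nc"
  shows "vcat nc (map f [0..<k]) \<in> carrier_mat (k * d) nc"
proof (rule carrier_matI)
  have d: "dim_row M = d \<and> dim_col M = nc" if "M \<in> set (map f [0..<k])" for M
    using that by (auto simp: carrier_matD[OF assms])
  show "dim_col (vcat nc (map f [0..<k])) = nc"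
    by (rule dim_col_vcat) (use d in blast)
  have "dim_row (vcat nc (map f [0..<k])) = length (map f [0..<k]) * d"
    by (rule dim_row_vcat) (use d in blast)
  then show "dim_row (vcat nc (map f [0..<k])) = k * d" by simp
qed

lemma block_index_less: "l < k \<Longrightarrow> s < d \<Longrightarrow> l * d + s < k * d" for l k s d :: nat
proof -
  assume "l < k" "s < d"
  then have "l * d + s < Suc l * d" by simp
  also have "\<dots> \<le> k * d"
    using \<open>l < k\<close> by (intro mult_right_mono) auto
  finally show ?thesis .
qed

lemma hcat_map_index:
  assumes "\<And>l. l < k \<Longrightarrow> f l \<in> carrier_mat nr d" "i < nr" "l < k" "s < d"
  shows "hcat nr (map f [0..<k]) $$ (i, l * d + s) = f l $$ (i, s)"
proof -
  have "l * d + s < k * d"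
    by (rule block_index_less[OF assms(3,4)])
  moreover have "(l * d + s) div d = l" "(l * d + s) mod d = s"
    using assms(4) by auto
  ultimately show ?thesis
    using assms by (subst hcat_index[of _ nr d]) auto
qed

lemma hcat_mult_vec_index:
  assumes f: "\<And>l. l < k \<Longrightarrow> f l \<in> carrier_mat nr d" and w: "w \<in> carrier_vec (k * d)" and i: "i < nr"
  shows "(hcat nr (map f [0..<k]) *\<^sub>v w) $ i = (\<Sum>l<k. \<Sum>s<d. f l $$ (i, s) * w $ (l * d + s))"
proof -
  have "(hcat nr (map f [0..<k]) *\<^sub>v w) $ i = (\<Sum>c<k * d. hcat nr (map f [0..<k]) $$ (i, c) * w $ c)"
    by (rule mult_mat_vec_index[OF hcat_carrier[OF f] w i])
  also have "\<dots> = (\<Sum>l<k. \<Sum>s<d. f l $$ (i, s) * w $ (l * d + s))"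
    unfolding sum_lessThan_mult using f i by (intro sum.cong refl) (simp add: hcat_map_index)
  finally show ?thesis .
qed

lemma hcat_transpose_mult_vec_index:
  assumes f: "\<And>l. l < k \<Longrightarrow> f l \<in> carrier_mat nr d" and y: "y \<in> carrier_vec nr" and l: "l < k" "s < d"
  shows "((hcat nr (map f [0..<k]))\<^sup>T *\<^sub>v y) $ (l * d + s) = ((f l)\<^sup>T *\<^sub>v y) $ s"
proof -
  have H: "hcat nr (map f [0..<k]) \<in> carrier_mat nr (k * d)"
    by (rule hcat_carrier[OF f])
  have "((hcat nr (map f [0..<k]))\<^sup>T *\<^sub>v y) $ (l * d + s)
      = (\<Sum>i<nr. (hcat nr (map f [0..<k]))\<^sup>T $$ (l * d + s, i) * y $ i)"
    by (rule mult_mat_vec_index[OF _ y block_index_less[OF l]]) (use H in simp)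
  also have "\<dots> = (\<Sum>i<nr. (f l)\<^sup>T $$ (s, i) * y $ i)"
    using H block_index_less[OF l] f[OF l(1)] l hcat_map_index[OF f _ l]
    by (intro sum.cong refl) simp
  also have "\<dots> = ((f l)\<^sup>T *\<^sub>v y) $ s"
    by (rule mult_mat_vec_index[symmetric, OF _ y l(2)]) (use f[OF l(1)] in simp)
  finally show ?thesis .
qed

text \<open>Turns the product of \<open>ctrb_mat\<close> with its transpose, which arises on
  eliminating \<open>w\<close>, into the sum over powers that defines the Gramian.\<close>

lemma hcat_gram:
  assumes f: "\<And>l. l < k \<Longrightarrow> f l \<in> carrier_mat nr d" and y: "y \<in> carrier_vec nr"
  shows "hcat nr (map f [0..<k]) *\<^sub>v ((hcat nr (map f [0..<k]))\<^sup>T *\<^sub>v y)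
    = vsum nr (\<lambda>l. f l *\<^sub>v ((f l)\<^sup>T *\<^sub>v y)) {..<k}"
proof (rule eq_vecI)
  let ?H = "hcat nr (map f [0..<k])"
  have H: "?H \<in> carrier_mat nr (k * d)"
    by (rule hcat_carrier[OF f])
  have c: "f l *\<^sub>v ((f l)\<^sup>T *\<^sub>v y) \<in> carrier_vec nr" if "l \<in> {..<k}" for l
    using f[of l] that y by auto
  have V: "dim_vec (vsum nr (\<lambda>l. f l *\<^sub>v ((f l)\<^sup>T *\<^sub>v y)) {..<k}) = nr"
    by (rule vsum_dim[OF c])
  show "dim_vec (?H *\<^sub>v (?H\<^sup>T *\<^sub>v y)) = dim_vec (vsum nr (\<lambda>l. f l *\<^sub>v ((f l)\<^sup>T *\<^sub>v y)) {..<k})"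
    using H V by simp
  fix i assume "i < dim_vec (vsum nr (\<lambda>l. f l *\<^sub>v ((f l)\<^sup>T *\<^sub>v y)) {..<k})"
  then have i: "i < nr" using V by simp
  have w: "?H\<^sup>T *\<^sub>v y \<in> carrier_vec (k * d)"
    using H y by simp
  have "(?H *\<^sub>v (?H\<^sup>T *\<^sub>v y)) $ i = (\<Sum>l<k. \<Sum>s<d. f l $$ (i, s) * (?H\<^sup>T *\<^sub>v y) $ (l * d + s))"
    by (rule hcat_mult_vec_index[OF f w i])
  also have "\<dots> = (\<Sum>l<k. \<Sum>s<d. f l $$ (i, s) * ((f l)\<^sup>T *\<^sub>v y) $ s)"
    by (intro sum.cong refl) (simp add: hcat_transpose_mult_vec_index[OF f y])
  also have "\<dots> = (\<Sum>l<k. (f l *\<^sub>v ((f l)\<^sup>T *\<^sub>v y)) $ i)"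
  proof (rule sum.cong[OF refl])
    fix l assume "l \<in> {..<k}"
    then have fl: "f l \<in> carrier_mat nr d" using f by simp
    show "(\<Sum>s<d. f l $$ (i, s) * ((f l)\<^sup>T *\<^sub>v y) $ s) = (f l *\<^sub>v ((f l)\<^sup>T *\<^sub>v y)) $ i"
      by (rule mult_mat_vec_index[symmetric, OF fl _ i]) (use fl y in simp)
  qed
  also have "\<dots> = vsum nr (\<lambda>l. f l *\<^sub>v ((f l)\<^sup>T *\<^sub>v y)) {..<k} $ i"
    by (rule vsum_index[symmetric, OF finite_lessThan i c])
  finally show "(?H *\<^sub>v (?H\<^sup>T *\<^sub>v y)) $ i = vsum nr (\<lambda>l. f l *\<^sub>v ((f l)\<^sup>T *\<^sub>v y)) {..<k} $ i" .
qed

lemma last_block_mult_index: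
  assumes w: "w \<in> carrier_vec (k * d)" and k: "k > 0" and s: "s < d"
  shows "(last_block_mat k d *\<^sub>v w) $ s = w $ ((k - 1) * d + s)"
proof -
  have "last_block_mat k d \<in> carrier_mat d (k * d)"
    by (simp add: last_block_mat_def kron_def)
  then have "(last_block_mat k d *\<^sub>v w) $ s = (\<Sum>c<k * d. last_block_mat k d $$ (s, c) * w $ c)"
    using w s by (rule mult_mat_vec_index)
  also have "\<dots> = (\<Sum>l<k. \<Sum>s'<d. last_block_mat k d $$ (s, l * d + s') * w $ (l * d + s'))"
    by (rule sum_lessThan_mult)
  also have "\<dots> = (\<Sum>l<k. \<Sum>s'<d. if s = s' then (if l = k - 1 then w $ (l * d + s') else 0) else 0)"
    using s block_index_less by (intro sum.cong refl) (auto simp: last_block_mat_def kron_def)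
  also have "\<dots> = w $ ((k - 1) * d + s)"
    using s k by simp
  finally show ?thesis .
qed

text \<open>The last block carries the highest power of \<open>A\<close>. The input applied to the
  array is therefore governed by the power \<open>K = k - 1\<close> of the transpose, not by the
  power \<open>0\<close>.\<close>

lemma last_block_hcat_transpose:
  assumes f: "\<And>l. l < k \<Longrightarrow> f l \<in> carrier_mat nr d" and y: "y \<in> carrier_vec nr" and k: "k > 0"
  shows "last_block_mat k d *\<^sub>v ((hcat nr (map f [0..<k]))\<^sup>T *\<^sub>v y) = (f (k - 1))\<^sup>T *\<^sub>v y"
proof (rule eq_vecI)
  have fk: "f (k - 1) \<in> carrier_mat nr d" using f k by simp
  show "dim_vec (last_block_mat k d *\<^sub>v ((hcat nr (map f [0..<k]))\<^sup>T *\<^sub>v y)) = dim_vec ((f (k - 1))\<^sup>T *\<^sub>v y)"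
    using fk by (simp add: last_block_mat_def kron_def)
  fix s assume "s < dim_vec ((f (k - 1))\<^sup>T *\<^sub>v y)"
  then have s: "s < d" using fk by simp
  have "hcat nr (map f [0..<k]) \<in> carrier_mat nr (k * d)"
    by (rule hcat_carrier[OF f])
  then have "(hcat nr (map f [0..<k]))\<^sup>T *\<^sub>v y \<in> carrier_vec (k * d)"
    using y by simp
  from last_block_mult_index[OF this k s]
  show "(last_block_mat k d *\<^sub>v ((hcat nr (map f [0..<k]))\<^sup>T *\<^sub>v y)) $ s = ((f (k - 1))\<^sup>T *\<^sub>v y) $ s"
    using hcat_transpose_mult_vec_index[where f = f and k = k, OF f y _ s, of "k - 1"] k by simp
qed

text \<open>The flat form of a family of blocks, in which controllability and observability are
  stated; \<open>emb\<close> is the form in which the dynamics is studied.\<close>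

definition stack :: "nat \<Rightarrow> nat \<Rightarrow> (nat \<Rightarrow> real vec) \<Rightarrow> real vec" where
  "stack q n xs = vec (q * n) (\<lambda>c. xs (c div n) $ (c mod n))"

lemma stack_carrier [simp]: "stack q n xs \<in> carrier_vec (q * n)"
  by (simp add: stack_def)

lemma stack_index: "i < q \<Longrightarrow> r < n \<Longrightarrow> stack q n xs $ (i * n + r) = xs i $ r"
  using block_index_less[of i q r n] by (simp add: stack_def)

lemma stack_eqI:
  assumes "v \<in> carrier_vec (q * n)" "\<And>i r. i < q \<Longrightarrow> r < n \<Longrightarrow> v $ (i * n + r) = xs i $ r"
  shows "v = stack q n xs"
proof (rule eq_vecI)
  fix c assume "c < dim_vec (stack q n xs)"
  then have c: "c < q * n" by (simp add: stack_def)
  then have n: "n > 0" by (cases n) auto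
  have "c div n < q" "c mod n < n"
    using c n by (simp_all add: less_mult_imp_div_less)
  from assms(2)[OF this] show "v $ c = stack q n xs $ c"
    using c by (simp add: stack_def)
qed (simp add: stack_def carrier_vecD[OF assms(1)])

lemma scalar_prod_stack:
  assumes "\<And>i. i < q \<Longrightarrow> xs i \<in> carrier_vec n" "\<And>i. i < q \<Longrightarrow> ys i \<in> carrier_vec n"
  shows "stack q n xs \<bullet> stack q n ys = (\<Sum>i<q. xs i \<bullet> ys i)"
proof -
  have "stack q n xs \<bullet> stack q n ys = (\<Sum>i<q. \<Sum>r<n. xs i $ r * ys i $ r)"
    unfolding scalar_prod_lessThan[OF stack_carrier stack_carrier] sum_lessThan_mult
    by (intro sum.cong refl) (simp add: stack_index)
  also have "\<dots> = (\<Sum>i<q. xs i \<bullet> ys i)"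
    by (intro sum.cong refl) (simp add: scalar_prod_lessThan[OF assms])
  finally show ?thesis .
qed

lemma hcat_mult_stack:
  assumes f: "\<And>k. k < q \<Longrightarrow> f k \<in> carrier_mat m n" and xs: "\<And>k. k < q \<Longrightarrow> xs k \<in> carrier_vec n"
  shows "hcat m (map f [0..<q]) *\<^sub>v stack q n xs = vsum m (\<lambda>k. f k *\<^sub>v xs k) {..<q}"
proof (rule eq_vecI)
  have c: "f k *\<^sub>v xs k \<in> carrier_vec m" if "k \<in> {..<q}" for k
    using f[of k] xs[of k] that by auto
  have V: "dim_vec (vsum m (\<lambda>k. f k *\<^sub>v xs k) {..<q}) = m"
    by (rule vsum_dim[OF c])
  have "hcat m (map f [0..<q]) \<in> carrier_mat m (q * n)"
    by (rule hcat_carrier[OF f])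
  then show "dim_vec (hcat m (map f [0..<q]) *\<^sub>v stack q n xs) = dim_vec (vsum m (\<lambda>k. f k *\<^sub>v xs k) {..<q})"
    using V by simp
  fix i assume "i < dim_vec (vsum m (\<lambda>k. f k *\<^sub>v xs k) {..<q})"
  then have i: "i < m" using V by simp
  have "(hcat m (map f [0..<q]) *\<^sub>v stack q n xs) $ i
      = (\<Sum>k<q. \<Sum>s<n. f k $$ (i, s) * stack q n xs $ (k * n + s))"
    by (rule hcat_mult_vec_index[OF f stack_carrier i])
  also have "\<dots> = (\<Sum>k<q. (f k *\<^sub>v xs k) $ i)"
  proof (rule sum.cong[OF refl])
    fix k assume "k \<in> {..<q}"
    then have k: "k < q" by simp
    show "(\<Sum>s<n. f k $$ (i, s) * stack q n xs $ (k * n + s)) = (f k *\<^sub>v xs k) $ i"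
      unfolding mult_mat_vec_index[OF f[OF k] xs[OF k] i]
      by (intro sum.cong refl) (simp add: stack_index k)
  qed
  also have "\<dots> = vsum m (\<lambda>k. f k *\<^sub>v xs k) {..<q} $ i"
    by (rule vsum_index[symmetric, OF finite_lessThan i c])
  finally show "(hcat m (map f [0..<q]) *\<^sub>v stack q n xs) $ i = vsum m (\<lambda>k. f k *\<^sub>v xs k) {..<q} $ i" .
qed

lemma vcat_mult_vec:
  assumes f: "\<And>k. k < q \<Longrightarrow> f k \<in> carrier_mat n p" and v: "v \<in> carrier_vec p"
  shows "vcat p (map f [0..<q]) *\<^sub>v v = stack q n (\<lambda>k. f k *\<^sub>v v)"
proof (rule stack_eqI)
  have V: "vcat p (map f [0..<q]) \<in> carrier_mat (q * n) p"
    by (rule vcat_carrier[OF f])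
  then show "vcat p (map f [0..<q]) *\<^sub>v v \<in> carrier_vec (q * n)"
    using v by simp
  fix i r assume ir: "i < q" "r < n"
  have "vcat p (map f [0..<q]) $$ (i * n + r, c) = f i $$ (r, c)" if "c < p" for c
    using block_index_less[OF ir] ir f that by (subst vcat_index[of _ n p]) auto
  then show "(vcat p (map f [0..<q]) *\<^sub>v v) $ (i * n + r) = (f i *\<^sub>v v) $ r"
    unfolding mult_mat_vec_index[OF V v block_index_less[OF ir]] mult_mat_vec_index[OF f[OF ir(1)] v ir(2)]
    by (intro sum.cong refl) simp
qed

lemma big_A_carrier: "A \<in> carrier_mat n n \<Longrightarrow> big_A q A \<in> carrier_mat (q * n) (q * n)"
  by (auto simp: big_A_def kron_def)

lemma big_A_mult_stack:
  assumes A: "A \<in> carrier_mat n n" and xs: "\<And>i. i < q \<Longrightarrow> xs i \<in> carrier_vec n"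
  shows "big_A q A *\<^sub>v stack q n xs = stack q n (\<lambda>i. A *\<^sub>v xs i)"
proof (rule stack_eqI)
  show "big_A q A *\<^sub>v stack q n xs \<in> carrier_vec (q * n)"
    using big_A_carrier[OF A, of q] by simp
  fix i r assume ir: "i < q" "r < n"
  have "(big_A q A *\<^sub>v stack q n xs) $ (i * n + r)
      = (\<Sum>k<q. \<Sum>s<n. big_A q A $$ (i * n + r, k * n + s) * stack q n xs $ (k * n + s))"
    unfolding mult_mat_vec_index[OF big_A_carrier[OF A] stack_carrier block_index_less[OF ir]]
    by (rule sum_lessThan_mult)
  also have "\<dots> = (\<Sum>k<q. if i = k then \<Sum>s<n. A $$ (r, s) * xs k $ s else 0)"
  proof (rule sum.cong[OF refl])
    fix k assume "k \<in> {..<q}"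
    then have "big_A q A $$ (i * n + r, k * n + s) = (if i = k then A $$ (r, s) else 0)" if "s < n" for s
      using A ir that block_index_less[of k q s n] block_index_less[of i q r n]
      by (auto simp: big_A_def kron_def)
    then show "(\<Sum>s<n. big_A q A $$ (i * n + r, k * n + s) * stack q n xs $ (k * n + s))
        = (if i = k then \<Sum>s<n. A $$ (r, s) * xs k $ s else 0)"
      using \<open>k \<in> {..<q}\<close> by (auto simp: stack_index intro!: sum.cong sum.neutral)
  qed
  also have "\<dots> = (A *\<^sub>v xs i) $ r"
    using ir by (simp add: mult_mat_vec_index[OF A xs[OF ir(1)] ir(2)])
  finally show "(big_A q A *\<^sub>v stack q n xs) $ (i * n + r) = (A *\<^sub>v xs i) $ r" .
qed

lemma stack_cong: "(\<And>i. i < q \<Longrightarrow> xs i = ys i) \<Longrightarrow> stack q n xs = stack q n ys"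
  by (rule stack_eqI) (simp_all add: stack_index)

lemma big_A_pow_mult_stack:
  assumes A: "A \<in> carrier_mat n n" and xs: "\<And>i. i < q \<Longrightarrow> xs i \<in> carrier_vec n"
  shows "big_A q A ^\<^sub>m l *\<^sub>v stack q n xs = stack q n (\<lambda>i. A ^\<^sub>m l *\<^sub>v xs i)"
  using xs
proof (induction l arbitrary: xs)
  case 0
  have "stack q n (\<lambda>i. A ^\<^sub>m 0 *\<^sub>v xs i) = stack q n xs"
    by (rule stack_cong) (use A 0 in simp)
  then show ?case
    using big_A_carrier[OF A, of q] by simp
next
  case (Suc l)
  have "big_A q A ^\<^sub>m Suc l *\<^sub>v stack q n xs = big_A q A ^\<^sub>m l *\<^sub>v (big_A q A *\<^sub>v stack q n xs)"
    using big_A_carrier[OF A, of q] by (simp add: assoc_mult_mat_vec[of _ "q * n" "q * n" _ "q * n"] pow_carrier_mat)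
  also have "\<dots> = stack q n (\<lambda>i. A ^\<^sub>m l *\<^sub>v (A *\<^sub>v xs i))"
  proof -
    have "big_A q A *\<^sub>v stack q n xs = stack q n (\<lambda>i. A *\<^sub>v xs i)"
      by (rule big_A_mult_stack[OF A]) (rule Suc.prems)
    then show ?thesis
      using Suc.IH[of "\<lambda>i. A *\<^sub>v xs i"] A Suc.prems by simp
  qed
  also have "\<dots> = stack q n (\<lambda>i. A ^\<^sub>m Suc l *\<^sub>v xs i)"
    using A Suc.prems by (intro stack_cong) (simp add: assoc_mult_mat_vec[of _ n n _ n] pow_carrier_mat)
  finally show ?case .
qed

lemma four_block_mult_vec:
  fixes M N :: "real mat"
  assumes M: "M \<in> carrier_mat nr a" and N: "N \<in> carrier_mat nr b" and w: "w \<in> carrier_vec (a + b)"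
  shows "four_block_mat M N (0\<^sub>m 0 a) (0\<^sub>m 0 b) *\<^sub>v w
    = M *\<^sub>v vec a (\<lambda>c. w $ c) + N *\<^sub>v vec b (\<lambda>c. w $ (a + c))"
    (is "?X *\<^sub>v w = M *\<^sub>v ?u + N *\<^sub>v ?v")
proof (rule eq_vecI)
  have X: "?X \<in> carrier_mat nr (a + b)"
    using M N by (intro carrier_matI) auto
  show "dim_vec (?X *\<^sub>v w) = dim_vec (M *\<^sub>v ?u + N *\<^sub>v ?v)"
    using M N by simp
  fix i assume "i < dim_vec (M *\<^sub>v ?u + N *\<^sub>v ?v)"
  then have i: "i < nr" using N by simp
  have u: "?u \<in> carrier_vec a" and v: "?v \<in> carrier_vec b" by simp_all
  have "(?X *\<^sub>v w) $ i = (\<Sum>c<a. ?X $$ (i, c) * w $ c) + (\<Sum>c<b. ?X $$ (i, a + c) * w $ (a + c))"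
    unfolding mult_mat_vec_index[OF X w i] by (rule sum_lessThan_add)
  also have "(\<Sum>c<a. ?X $$ (i, c) * w $ c) = (M *\<^sub>v ?u) $ i"
    unfolding mult_mat_vec_index[OF M u i] using M N i by (intro sum.cong refl) simp
  also have "(\<Sum>c<b. ?X $$ (i, a + c) * w $ (a + c)) = (N *\<^sub>v ?v) $ i"
    unfolding mult_mat_vec_index[OF N v i] using M N i by (intro sum.cong refl) simp
  finally show "(?X *\<^sub>v w) $ i = (M *\<^sub>v ?u + N *\<^sub>v ?v) $ i"
    using N i by simp
qed

text \<open>The block columns of \<open>big_B\<close> have different widths, so entries cannot be
  located by division with remainder as in \<open>hcat_index\<close>. Instead a property closed
  under addition is carried from the ranges of the blocks to the range of the whole matrix.\<close>

lemma hcat_range_induct: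
  assumes Ms: "\<And>M. M \<in> set Ms \<Longrightarrow> dim_row M = nr"
    and range: "\<And>M v. M \<in> set Ms \<Longrightarrow> v \<in> carrier_vec (dim_col M) \<Longrightarrow> R (M *\<^sub>v v)"
    and zero: "R (0\<^sub>v nr)"
    and add: "\<And>u v. u \<in> carrier_vec nr \<Longrightarrow> v \<in> carrier_vec nr \<Longrightarrow> R u \<Longrightarrow> R v \<Longrightarrow> R (u + v)"
    and w: "w \<in> carrier_vec (dim_col (hcat nr Ms))"
  shows "R (hcat nr Ms *\<^sub>v w)"
  using Ms range w
proof (induction Ms arbitrary: w)
  case Nil
  have "hcat nr [] *\<^sub>v w = 0\<^sub>v nr"
    using Nil.prems(3) by (intro eq_vecI) (auto simp: hcat_Nil scalar_prod_def)
  then show ?case using zero by simp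
next
  case (Cons M Ms)
  let ?H = "hcat nr Ms"
  let ?a = "vec (dim_col M) (\<lambda>c. w $ c)" and ?b = "vec (dim_col ?H) (\<lambda>c. w $ (dim_col M + c))"
  have M: "M \<in> carrier_mat nr (dim_col M)"
    by (rule carrier_matI) (use Cons.prems(1) in simp_all)
  have H: "?H \<in> carrier_mat nr (dim_col ?H)"
    by (rule carrier_matI[OF dim_row_hcat refl]) (use Cons.prems(1) in simp)
  have w: "w \<in> carrier_vec (dim_col M + dim_col ?H)"
    using Cons.prems(3) by (simp add: hcat_Cons)
  have Rb: "R (?H *\<^sub>v ?b)"
  proof (rule Cons.IH)
    show "dim_row M' = nr" if "M' \<in> set Ms" for M'
      using Cons.prems(1) that by simp
    show "R (M' *\<^sub>v v)" if "M' \<in> set Ms" "v \<in> carrier_vec (dim_col M')" for M' v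
      using Cons.prems(2) that by simp
  qed simp
  have Ra: "R (M *\<^sub>v ?a)"
    by (rule Cons.prems(2)) simp_all
  have "R (M *\<^sub>v ?a + ?H *\<^sub>v ?b)"
    by (rule add[OF mult_mat_vec_carrier[OF M] mult_mat_vec_carrier[OF H] Ra Rb]) simp_all
  then show ?case
    unfolding hcat_Cons four_block_mult_vec[OF M H w] .
qed

text \<open>The counterpart of \<open>hcat_range_induct\<close> for block rows of different
  heights.\<close>

lemma vcat_mult_eq_0:
  assumes "\<And>M. M \<in> set Ms \<Longrightarrow> dim_col M = nc \<and> M *\<^sub>v v = 0\<^sub>v (dim_row M)" and v: "v \<in> carrier_vec nc"
  shows "vcat nc Ms *\<^sub>v v = 0\<^sub>v (dim_row (vcat nc Ms))"
  using assms(1)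
proof (induction Ms)
  case Nil
  show ?case by (intro eq_vecI) (auto simp: vcat_Nil)
next
  case (Cons M Ms)
  have M: "M \<in> carrier_mat (dim_row M) nc" and V: "vcat nc Ms \<in> carrier_mat (dim_row (vcat nc Ms)) nc"
    using Cons.prems by (auto intro!: carrier_matI)
  have "vcat nc (M # Ms) *\<^sub>v v = M *\<^sub>v v @\<^sub>v vcat nc Ms *\<^sub>v v"
    unfolding vcat_Cons by (rule mat_mult_append[OF M V v])
  also have "\<dots> = 0\<^sub>v (dim_row M) @\<^sub>v 0\<^sub>v (dim_row (vcat nc Ms))"
    using Cons.IH Cons.prems by simp
  also have "\<dots> = 0\<^sub>v (dim_row (vcat nc (M # Ms)))"
    by (auto simp: vcat_Cons append_rows_def)
  finally show ?case .
qed

lemma pairs_less: "(i, j) \<in> set (pairs q) \<Longrightarrow> i < j \<and> j < q"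
  by (auto simp: pairs_def)

lemma sync_subspace_iff: "v \<in> sync_subspace q n \<longleftrightarrow> (\<exists>x\<in>carrier_vec n. v = stack q n (\<lambda>_. x))"
proof -
  let ?K = "kron (mat q 1 (\<lambda>_. 1)) (1\<^sub>m n)"
  have K: "?K \<in> carrier_mat (q * n) n"
    by (simp add: kron_def)
  have "?K *\<^sub>v x = stack q n (\<lambda>_. x)" if x: "x \<in> carrier_vec n" for x
  proof (rule stack_eqI)
    show "?K *\<^sub>v x \<in> carrier_vec (q * n)" using K x by simp
    fix i r assume ir: "i < q" "r < n"
    have "(?K *\<^sub>v x) $ (i * n + r) = (\<Sum>c<n. ?K $$ (i * n + r, c) * x $ c)"
      by (rule mult_mat_vec_index[OF K x block_index_less[OF ir]])
    also have "\<dots> = (\<Sum>c<n. if r = c then x $ c else 0)"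
      using ir block_index_less[OF ir] by (intro sum.cong refl) (auto simp: kron_def)
    also have "\<dots> = x $ r" using ir by simp
    finally show "(?K *\<^sub>v x) $ (i * n + r) = x $ r" .
  qed
  moreover have "dim_col ?K = n" using K by simp
  ultimately show ?thesis
    unfolding sync_subspace_def mat_range_def image_iff
    by (intro bex_cong) simp_all
qed

section \<open>Nondegeneracy from controllability and observability\<close>

lemma pow_mat_Suc_left:
  fixes M :: "real mat"
  assumes "M \<in> carrier_mat n n"
  shows "M * M ^\<^sub>m l = M ^\<^sub>m Suc l"
proof (induction l)
  case (Suc l)
  have "M * M ^\<^sub>m Suc l = M * (M ^\<^sub>m l * M)"
    by simp
  also have "\<dots> = (M * M ^\<^sub>m l) * M"
    using assms pow_carrier_mat[OF assms, of l] by (intro assoc_mult_mat[symmetric, of _ n n _ n _ n]) auto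
  finally show ?case using Suc by simp
qed (simp add: carrier_matD[OF assms] left_mult_one_mat[OF assms] right_mult_one_mat[OF assms])

lemma transpose_pow_mat:
  fixes M :: "real mat"
  assumes "M \<in> carrier_mat n n"
  shows "(M ^\<^sub>m l)\<^sup>T = M\<^sup>T ^\<^sub>m l"
proof (induction l)
  case (Suc l)
  have "(M ^\<^sub>m Suc l)\<^sup>T = M\<^sup>T * (M ^\<^sub>m l)\<^sup>T"
    using assms pow_carrier_mat[OF assms, of l] by (simp add: transpose_mult[of _ n n _ n])
  also have "\<dots> = M\<^sup>T ^\<^sub>m Suc l"
    using assms Suc pow_mat_Suc_left[of "M\<^sup>T" n l] by simp
  finally show ?case .
qed (simp add: carrier_matD[OF assms])

lemma scalar_prod_mult_transpose:
  fixes M :: "real mat"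
  assumes "M \<in> carrier_mat m n" "u \<in> carrier_vec m" "v \<in> carrier_vec n"
  shows "u \<bullet> (M *\<^sub>v v) = (M\<^sup>T *\<^sub>v u) \<bullet> v"
  using transpose_vec_mult_scalar[OF assms(1) assms(3,2)] by simp

lemma zero_mult_mat_vec: "v \<in> carrier_vec b \<Longrightarrow> 0\<^sub>m a b *\<^sub>v v = 0\<^sub>v a" for v :: "real vec"
  by (intro eq_vecI) auto

lemma mult_mat_zero_vec: "M \<in> carrier_mat a b \<Longrightarrow> M *\<^sub>v 0\<^sub>v b = 0\<^sub>v a" for M :: "real mat"
  by (intro eq_vecI) auto

lemma sum_lessThan_two:
  fixes f :: "nat \<Rightarrow> 'a::comm_monoid_add"
  assumes "i < q" "j < q" "i \<noteq> j" "\<And>k. k < q \<Longrightarrow> k \<noteq> i \<Longrightarrow> k \<noteq> j \<Longrightarrow> f k = 0"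
  shows "(\<Sum>k<q. f k) = f i + f j"
proof -
  have "(\<Sum>k<q. f k) = (\<Sum>k\<in>{i, j}. f k)"
    using assms by (intro sum.mono_neutral_right) auto
  then show ?thesis using assms(3) by simp
qed

text \<open>The disagreement of \<open>x\<close> is orthogonal to the synchronization subspace, so
  controllability puts it in the range of the controllability matrix. The hypothesis
  \<open>zero\<close> makes it orthogonal to every block of that matrix. Hence it is orthogonal to
  itself.\<close>

lemma controllable_nondegenerate:
  assumes A: "A \<in> carrier_mat n n" and B: "\<And>i j. i < q \<Longrightarrow> j < q \<Longrightarrow> B i j \<in> carrier_mat n (p i j)"
    and ctrb: "array_controllable q n p A B"
    and zero: "\<And>l i j. l < n \<Longrightarrow> i < q \<Longrightarrow> j < q \<Longrightarrow>
      (B i j)\<^sup>T *\<^sub>v (A\<^sup>T ^\<^sub>m l *\<^sub>v (blk n x i - blk n x j)) = 0\<^sub>v (p i j)"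
  shows "disag q n x = 0"
proof -
  define z where "z = blk n (disag q n x)"
  have z: "z i \<in> carrier_vec n" for i by (simp add: z_def)
  have Atz: "A\<^sup>T ^\<^sub>m l *\<^sub>v z k \<in> carrier_vec n" for l k
    by (rule mult_mat_vec_carrier[OF pow_carrier_mat z]) (use A in simp)
  define X where "X = stack q n z"
  have X: "X \<in> carrier_vec (q * n)" by (simp add: X_def)
  let ?AA = "big_A q A" and ?BB = "big_B q n p B"
  have AA: "?AA ^\<^sub>m l \<in> carrier_mat (q * n) (q * n)" for l
    by (rule pow_carrier_mat[OF big_A_carrier[OF A]])
  define g where "g i j k = (if k = i then B i j else if k = j then - B i j else 0\<^sub>m n (p i j))" for i j k
  have g: "g i j k \<in> carrier_mat n (p i j)" if "i < q" "j < q" for i j k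
    using B[OF that] by (simp add: g_def)
  define Ms where "Ms = map (\<lambda>(i, j). vcat (p i j) (map (g i j) [0..<q])) (pairs q)"
  have BB: "?BB = hcat (q * n) Ms"
    unfolding big_B_def Ms_def g_def by simp
  have Ms: "\<exists>i j. i < j \<and> j < q \<and> M = vcat (p i j) (map (g i j) [0..<q])" if M: "M \<in> set Ms" for M
  proof -
    obtain i j where "(i, j) \<in> set (pairs q)" "M = vcat (p i j) (map (g i j) [0..<q])"
      using M unfolding Ms_def by auto
    then show ?thesis using pairs_less by blast
  qed
  have rows: "dim_row M = q * n" if M: "M \<in> set Ms" for M
  proof -
    obtain i j where ij: "i < j" "j < q" "M = vcat (p i j) (map (g i j) [0..<q])"
      using Ms[OF M] by blast
    have "M \<in> carrier_mat (q * n) (p i j)"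
      unfolding ij(3) by (rule vcat_carrier, rule g) (use ij in simp_all)
    then show ?thesis by simp
  qed
  have dimBB: "dim_row ?BB = q * n"
    unfolding BB by (rule dim_row_hcat) (rule rows)
  have "X \<in> vec_module.orthogonal_complement (q * n) (sync_subspace q n)"
    unfolding vec_module.orthogonal_complement_def
  proof (intro CollectI conjI ballI X)
    fix y assume "y \<in> sync_subspace q n"
    then obtain c where c: "c \<in> carrier_vec n" "y = stack q n (\<lambda>_. c)"
      unfolding sync_subspace_iff by blast
    have "X \<bullet> y = (\<Sum>i<q. z i \<bullet> c)"
      unfolding X_def c(2) by (rule scalar_prod_stack) (use z c in auto)
    also have "\<dots> = (\<Sum>i<q. c \<bullet> z i)"
      by (intro sum.cong refl comm_scalar_prod[OF z c(1)])
    also have "\<dots> = inner (emb q n (\<lambda>_. c)) (disag q n x)"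
      unfolding z_def by (rule inner_emb[symmetric]) (rule c)
    also have "\<dots> = inner (disag q n (emb q n (\<lambda>_. c))) x"
      by (rule disag_sym[symmetric])
    also have "disag q n (emb q n (\<lambda>_. c)) = 0"
      by (rule disag_eq_0) (simp add: blk_emb c(1))
    finally show "X \<bullet> y = 0" by simp
  qed
  then obtain w where w: "w \<in> carrier_vec (dim_col (ctrb_mat ?AA ?BB n))" "X = ctrb_mat ?AA ?BB n *\<^sub>v w"
    using ctrb unfolding array_controllable_def mat_range_def by blast
  \<comment> \<open>Moving the power of \<open>A\<close> and the block column to the other side
    leaves only the block rows \<open>i\<close> and \<open>j\<close>; their opposite signs form the
    difference \<open>z i - z j\<close>, which \<open>zero\<close> annihilates.\<close>
  have column: "X \<bullet> (?AA ^\<^sub>m l *\<^sub>v (M *\<^sub>v v)) = 0"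
    if l: "l < n" and M: "M \<in> set Ms" and v: "v \<in> carrier_vec (dim_col M)" for l M v
  proof -
    obtain i j where ij: "i < j" "j < q" and M_eq: "M = vcat (p i j) (map (g i j) [0..<q])"
      using Ms[OF M] by blast
    then have iq: "i < q" by simp
    have "M \<in> carrier_mat (q * n) (p i j)"
      unfolding M_eq by (rule vcat_carrier) (rule g[OF iq ij(2)])
    then have v: "v \<in> carrier_vec (p i j)" using v by simp
    have gv: "g i j k *\<^sub>v v \<in> carrier_vec n" for k
      using g[OF iq ij(2), of k] v by simp
    have "?AA ^\<^sub>m l *\<^sub>v (M *\<^sub>v v) = stack q n (\<lambda>k. A ^\<^sub>m l *\<^sub>v (g i j k *\<^sub>v v))"
      unfolding M_eq vcat_mult_vec[OF g[OF iq ij(2)] v]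
      by (rule big_A_pow_mult_stack[OF A]) (rule gv)
    then have "X \<bullet> (?AA ^\<^sub>m l *\<^sub>v (M *\<^sub>v v)) = (\<Sum>k<q. z k \<bullet> (A ^\<^sub>m l *\<^sub>v (g i j k *\<^sub>v v)))"
      unfolding X_def using scalar_prod_stack[of q z n "\<lambda>k. A ^\<^sub>m l *\<^sub>v (g i j k *\<^sub>v v)"] z gv
        pow_carrier_mat[OF A, of l] by simp
    also have "\<dots> = (\<Sum>k<q. ((g i j k)\<^sup>T *\<^sub>v (A\<^sup>T ^\<^sub>m l *\<^sub>v z k)) \<bullet> v)"
    proof (rule sum.cong[OF refl])
      fix k
      have Al: "A ^\<^sub>m l \<in> carrier_mat n n" by (rule pow_carrier_mat[OF A])
      have "z k \<bullet> (A ^\<^sub>m l *\<^sub>v (g i j k *\<^sub>v v)) = (A\<^sup>T ^\<^sub>m l *\<^sub>v z k) \<bullet> (g i j k *\<^sub>v v)"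
        unfolding transpose_pow_mat[OF A, symmetric] by (rule scalar_prod_mult_transpose[OF Al z gv])
      also have "\<dots> = ((g i j k)\<^sup>T *\<^sub>v (A\<^sup>T ^\<^sub>m l *\<^sub>v z k)) \<bullet> v"
        by (rule scalar_prod_mult_transpose[OF g[OF iq ij(2)] Atz v])
      finally show "z k \<bullet> (A ^\<^sub>m l *\<^sub>v (g i j k *\<^sub>v v)) = ((g i j k)\<^sup>T *\<^sub>v (A\<^sup>T ^\<^sub>m l *\<^sub>v z k)) \<bullet> v" .
    qed
    also have "\<dots> = ((g i j i)\<^sup>T *\<^sub>v (A\<^sup>T ^\<^sub>m l *\<^sub>v z i)) \<bullet> v + ((g i j j)\<^sup>T *\<^sub>v (A\<^sup>T ^\<^sub>m l *\<^sub>v z j)) \<bullet> v"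
    proof (rule sum_lessThan_two[OF iq ij(2)])
      fix k assume "k < q" "k \<noteq> i" "k \<noteq> j"
      then have "g i j k = 0\<^sub>m n (p i j)" by (simp add: g_def)
      then show "((g i j k)\<^sup>T *\<^sub>v (A\<^sup>T ^\<^sub>m l *\<^sub>v z k)) \<bullet> v = 0"
        using v Atz[of l k] by (simp add: zero_mult_mat_vec)
    qed (use ij in simp)
    also have "\<dots> = ((B i j)\<^sup>T *\<^sub>v (A\<^sup>T ^\<^sub>m l *\<^sub>v (z i - z j))) \<bullet> v"
    proof -
      have Al: "A\<^sup>T ^\<^sub>m l \<in> carrier_mat n n"
        by (rule pow_carrier_mat) (use A in simp)
      define zi zj where "zi = A\<^sup>T ^\<^sub>m l *\<^sub>v z i" and "zj = A\<^sup>T ^\<^sub>m l *\<^sub>v z j"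
      have zz: "zi \<in> carrier_vec n" "zj \<in> carrier_vec n"
        using Al z by (simp_all add: zi_def zj_def)
      have Bt: "(B i j)\<^sup>T \<in> carrier_mat (p i j) n"
        using B[OF iq ij(2)] by simp
      have gi: "g i j i = B i j" and gj: "g i j j = - B i j"
        using ij by (simp_all add: g_def)
      have "(- B i j)\<^sup>T *\<^sub>v zj = - ((B i j)\<^sup>T *\<^sub>v zj)"
        using B[OF iq ij(2)] zz by (simp add: transpose_uminus)
      moreover have "A\<^sup>T ^\<^sub>m l *\<^sub>v (z i - z j) = zi - zj"
        unfolding zi_def zj_def by (rule mult_minus_distrib_mat_vec[OF Al z z])
      moreover have "(B i j)\<^sup>T *\<^sub>v (zi - zj) = (B i j)\<^sup>T *\<^sub>v zi - (B i j)\<^sup>T *\<^sub>v zj"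
        by (rule mult_minus_distrib_mat_vec[OF Bt zz])
      moreover have "((B i j)\<^sup>T *\<^sub>v zi - (B i j)\<^sup>T *\<^sub>v zj) \<bullet> v
          = ((B i j)\<^sup>T *\<^sub>v zi) \<bullet> v - ((B i j)\<^sup>T *\<^sub>v zj) \<bullet> v"
        by (rule minus_scalar_prod_distrib[OF _ _ v]) (use Bt zz in auto)
      moreover have "(- ((B i j)\<^sup>T *\<^sub>v zj)) \<bullet> v = - (((B i j)\<^sup>T *\<^sub>v zj) \<bullet> v)"
        using Bt v by (intro scalar_prod_uminus_left) simp
      ultimately show ?thesis
        unfolding gi gj by (simp add: zi_def[symmetric] zj_def[symmetric])
    qed
    also have "z i - z j = blk n x i - blk n x j"
      unfolding z_def by (rule disag_diff[OF iq ij(2)])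
    finally show ?thesis
      using zero[OF l iq ij(2)] v by simp
  qed
  \<comment> \<open>Two nested inductions over block columns: the outer one over the powers of
    \<open>big_A\<close>, the inner one over the pairs.\<close>
  have "X \<bullet> (hcat (dim_row ?BB) (map (\<lambda>l. ?AA ^\<^sub>m l * ?BB) [0..<n]) *\<^sub>v w) = 0"
  proof (rule hcat_range_induct[where R = "\<lambda>u. X \<bullet> u = 0"])
    show "dim_row M = dim_row ?BB" if "M \<in> set (map (\<lambda>l. ?AA ^\<^sub>m l * ?BB) [0..<n])" for M
      using that dimBB carrier_matD(1)[OF AA] by auto
    show "w \<in> carrier_vec (dim_col (hcat (dim_row ?BB) (map (\<lambda>l. ?AA ^\<^sub>m l * ?BB) [0..<n])))"
      using w(1) by (simp only: ctrb_mat_def)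
    show "X \<bullet> 0\<^sub>v (dim_row ?BB) = 0"
      using X dimBB by simp
    show "X \<bullet> (u + v) = 0"
      if "u \<in> carrier_vec (dim_row ?BB)" "v \<in> carrier_vec (dim_row ?BB)" "X \<bullet> u = 0" "X \<bullet> v = 0" for u v
      using that X dimBB by (simp add: scalar_prod_add_distrib[of _ "q * n"])
    fix M and v :: "real vec"
    assume M: "M \<in> set (map (\<lambda>l. ?AA ^\<^sub>m l * ?BB) [0..<n])" and v: "v \<in> carrier_vec (dim_col M)"
    then obtain l where l: "l < n" "M = ?AA ^\<^sub>m l * ?BB" by auto
    have v': "v \<in> carrier_vec (dim_col ?BB)"
      using v by (simp add: l(2))
    have BBc: "?BB \<in> carrier_mat (q * n) (dim_col ?BB)"
      by (rule carrier_matI[OF dimBB refl])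
    have "X \<bullet> (?AA ^\<^sub>m l *\<^sub>v (hcat (q * n) Ms *\<^sub>v v)) = 0"
    proof (rule hcat_range_induct[where R = "\<lambda>u. X \<bullet> (?AA ^\<^sub>m l *\<^sub>v u) = 0"])
      show "X \<bullet> (?AA ^\<^sub>m l *\<^sub>v 0\<^sub>v (q * n)) = 0"
        using X by (simp add: mult_mat_zero_vec[OF AA])
      show "X \<bullet> (?AA ^\<^sub>m l *\<^sub>v (u + v)) = 0"
        if "u \<in> carrier_vec (q * n)" "v \<in> carrier_vec (q * n)"
          "X \<bullet> (?AA ^\<^sub>m l *\<^sub>v u) = 0" "X \<bullet> (?AA ^\<^sub>m l *\<^sub>v v) = 0" for u v
        unfolding mult_add_distrib_mat_vec[OF AA that(1,2)]
        by (subst scalar_prod_add_distrib[OF X]) (use that AA[of l] in auto)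
      show "v \<in> carrier_vec (dim_col (hcat (q * n) Ms))"
        using v' by (simp only: BB)
    qed (use rows column l in auto)
    moreover have "(?AA ^\<^sub>m l * ?BB) *\<^sub>v v = ?AA ^\<^sub>m l *\<^sub>v (?BB *\<^sub>v v)"
      by (rule assoc_mult_mat_vec[OF AA BBc v'])
    ultimately show "X \<bullet> (M *\<^sub>v v) = 0"
      by (simp only: l(2) BB)
  qed
  then have "X \<bullet> X = 0"
    using w(2) by (simp only: ctrb_mat_def)
  then have "(\<Sum>i<q. z i \<bullet> blk n (disag q n x) i) = 0"
    unfolding X_def by (subst (asm) scalar_prod_stack) (use z in \<open>auto simp: z_def\<close>)
  then have "inner (emb q n z) (disag q n x) = 0"
    by (subst inner_emb) (use z in auto)
  then show ?thesis
    by (simp add: z_def emb_blk_disag)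
qed

text \<open>Here \<open>x\<close> need not be projected: its stacked blocks lie in the kernel of the
  observability matrix, and observability makes them all equal.\<close>

lemma observable_nondegenerate:
  assumes A: "A \<in> carrier_mat n n" and C: "\<And>i j. i < q \<Longrightarrow> j < q \<Longrightarrow> C i j \<in> carrier_mat (m i j) n"
    and obsv: "array_observable q n m A C"
    and zero: "\<And>l i j. l < n \<Longrightarrow> i < q \<Longrightarrow> j < q \<Longrightarrow>
      C i j *\<^sub>v (A ^\<^sub>m l *\<^sub>v (blk n x i - blk n x j)) = 0\<^sub>v (m i j)"
  shows "disag q n x = 0"
proof -
  define z where "z = blk n x"
  have z: "z i \<in> carrier_vec n" for i by (simp add: z_def)
  let ?AA = "big_A q A" and ?CC = "big_C q n m C"
  have AA: "?AA ^\<^sub>m l \<in> carrier_mat (q * n) (q * n)" for l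
    by (rule pow_carrier_mat[OF big_A_carrier[OF A]])
  define g where "g i j k = (if k = i then C i j else if k = j then - C i j else 0\<^sub>m (m i j) n)" for i j k
  have g: "g i j k \<in> carrier_mat (m i j) n" if "i < q" "j < q" for i j k
    using C[OF that] by (simp add: g_def)
  define Ms where "Ms = map (\<lambda>(i, j). hcat (m i j) (map (g i j) [0..<q])) (pairs q)"
  have CC: "?CC = vcat (q * n) Ms"
    unfolding big_C_def Ms_def g_def by simp
  have Ms: "\<exists>i j. i < j \<and> j < q \<and> M = hcat (m i j) (map (g i j) [0..<q])" if M: "M \<in> set Ms" for M
  proof -
    obtain i j where "(i, j) \<in> set (pairs q)" "M = hcat (m i j) (map (g i j) [0..<q])"
      using M unfolding Ms_def by auto
    then show ?thesis using pairs_less by blast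
  qed
  have cols: "dim_col M = q * n" if M: "M \<in> set Ms" for M
  proof -
    obtain i j where ij: "i < j" "j < q" "M = hcat (m i j) (map (g i j) [0..<q])"
      using Ms[OF M] by blast
    have "M \<in> carrier_mat (m i j) (q * n)"
      unfolding ij(3) by (rule hcat_carrier, rule g) (use ij in simp_all)
    then show ?thesis by simp
  qed
  have CCc: "?CC \<in> carrier_mat (dim_row ?CC) (q * n)"
    unfolding CC by (rule carrier_matI[OF refl dim_col_vcat]) (rule cols)
  have row: "M *\<^sub>v stack q n (\<lambda>i. A ^\<^sub>m l *\<^sub>v z i) = 0\<^sub>v (dim_row M)"
    if l: "l < n" and M: "M \<in> set Ms" for l M
  proof -
    obtain i j where ij: "i < j" "j < q" and M_eq: "M = hcat (m i j) (map (g i j) [0..<q])"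
      using Ms[OF M] by blast
    then have iq: "i < q" by simp
    have Mc: "M \<in> carrier_mat (m i j) (q * n)"
      unfolding M_eq by (rule hcat_carrier) (rule g[OF iq ij(2)])
    have Al: "A ^\<^sub>m l \<in> carrier_mat n n" by (rule pow_carrier_mat[OF A])
    have Az: "A ^\<^sub>m l *\<^sub>v z k \<in> carrier_vec n" for k
      using Al z by simp
    have gAz: "g i j k *\<^sub>v (A ^\<^sub>m l *\<^sub>v z k) \<in> carrier_vec (m i j)" for k
      using g[OF iq ij(2), of k] Az by simp
    have "M *\<^sub>v stack q n (\<lambda>i. A ^\<^sub>m l *\<^sub>v z i) = vsum (m i j) (\<lambda>k. g i j k *\<^sub>v (A ^\<^sub>m l *\<^sub>v z k)) {..<q}"
      unfolding M_eq by (rule hcat_mult_stack) (rule g[OF iq ij(2)], rule Az)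
    also have "\<dots> = C i j *\<^sub>v (A ^\<^sub>m l *\<^sub>v (z i - z j))"
    proof (rule eq_vecI)
      have V: "dim_vec (vsum (m i j) (\<lambda>k. g i j k *\<^sub>v (A ^\<^sub>m l *\<^sub>v z k)) {..<q}) = m i j"
        by (rule vsum_dim[OF gAz])
      have Cij: "C i j \<in> carrier_mat (m i j) n" by (rule C[OF iq ij(2)])
      show "dim_vec (vsum (m i j) (\<lambda>k. g i j k *\<^sub>v (A ^\<^sub>m l *\<^sub>v z k)) {..<q})
          = dim_vec (C i j *\<^sub>v (A ^\<^sub>m l *\<^sub>v (z i - z j)))"
        unfolding V using Cij by simp
      fix r assume "r < dim_vec (C i j *\<^sub>v (A ^\<^sub>m l *\<^sub>v (z i - z j)))"
      then have r: "r < m i j" using Cij by simp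
      have "vsum (m i j) (\<lambda>k. g i j k *\<^sub>v (A ^\<^sub>m l *\<^sub>v z k)) {..<q} $ r
          = (\<Sum>k<q. (g i j k *\<^sub>v (A ^\<^sub>m l *\<^sub>v z k)) $ r)"
        by (rule vsum_index[OF finite_lessThan r gAz])
      also have "\<dots> = (g i j i *\<^sub>v (A ^\<^sub>m l *\<^sub>v z i)) $ r + (g i j j *\<^sub>v (A ^\<^sub>m l *\<^sub>v z j)) $ r"
      proof (rule sum_lessThan_two[OF iq ij(2)])
        fix k assume "k < q" "k \<noteq> i" "k \<noteq> j"
        then have "g i j k = 0\<^sub>m (m i j) n" by (simp add: g_def)
        then show "(g i j k *\<^sub>v (A ^\<^sub>m l *\<^sub>v z k)) $ r = 0"
          using r Az[of k] by simp
      qed (use ij in simp)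
      also have "\<dots> = (C i j *\<^sub>v (A ^\<^sub>m l *\<^sub>v z i) - C i j *\<^sub>v (A ^\<^sub>m l *\<^sub>v z j)) $ r"
      proof -
        have "- C i j *\<^sub>v (A ^\<^sub>m l *\<^sub>v z j) = - (C i j *\<^sub>v (A ^\<^sub>m l *\<^sub>v z j))"
          by (rule uminus_mult_mat_vec) (simp only: carrier_vecD[OF Az] carrier_matD[OF Cij])
        then show ?thesis
          using ij r Cij by (simp add: g_def)
      qed
      also have "C i j *\<^sub>v (A ^\<^sub>m l *\<^sub>v z i) - C i j *\<^sub>v (A ^\<^sub>m l *\<^sub>v z j) = C i j *\<^sub>v (A ^\<^sub>m l *\<^sub>v (z i - z j))"
        unfolding mult_minus_distrib_mat_vec[OF Al z z]
        by (rule mult_minus_distrib_mat_vec[OF Cij Az Az, symmetric])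
      finally show "vsum (m i j) (\<lambda>k. g i j k *\<^sub>v (A ^\<^sub>m l *\<^sub>v z k)) {..<q} $ r
          = (C i j *\<^sub>v (A ^\<^sub>m l *\<^sub>v (z i - z j))) $ r" .
    qed
    also have "\<dots> = 0\<^sub>v (dim_row M)"
      using zero[OF l iq ij(2)] carrier_matD(1)[OF Mc] by (simp add: z_def)
    finally show ?thesis .
  qed
  define X where "X = stack q n z"
  have "?CC *\<^sub>v (?AA ^\<^sub>m l *\<^sub>v X) = 0\<^sub>v (dim_row ?CC)" if "l < n" for l
    unfolding X_def big_A_pow_mult_stack[OF A z] CC
    by (rule vcat_mult_eq_0) (use cols row that in auto)
  then have rows: "(?CC * ?AA ^\<^sub>m l) *\<^sub>v X = 0\<^sub>v (dim_row ?CC)" if "l < n" for l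
    using that assoc_mult_mat_vec[OF CCc AA, of X l] by (simp add: X_def)
  have dimCC: "dim_col ?CC = q * n"
    by (rule carrier_matD(2)[OF CCc])
  have cols': "dim_col M = q * n" if "M \<in> set (map (\<lambda>l. ?CC * ?AA ^\<^sub>m l) [0..<n])" for M
    using that carrier_matD(2)[OF AA] by auto
  have "dim_col (vcat (q * n) (map (\<lambda>l. ?CC * ?AA ^\<^sub>m l) [0..<n])) = q * n"
    by (rule dim_col_vcat) (rule cols')
  note dim = this
  have "X \<in> mat_kernel (obsv_mat ?AA ?CC n)"
    unfolding mat_kernel_def obsv_mat_def dimCC
  proof (intro CollectI conjI)
    show "X \<in> carrier_vec (dim_col (vcat (q * n) (map (\<lambda>l. ?CC * ?AA ^\<^sub>m l) [0..<n])))"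
      unfolding dim by (simp add: X_def)
    show "vcat (q * n) (map (\<lambda>l. ?CC * ?AA ^\<^sub>m l) [0..<n]) *\<^sub>v X
        = 0\<^sub>v (dim_row (vcat (q * n) (map (\<lambda>l. ?CC * ?AA ^\<^sub>m l) [0..<n])))"
      by (rule vcat_mult_eq_0) (use cols' rows in \<open>auto simp: X_def\<close>)
  qed
  then obtain c where c: "X = stack q n (\<lambda>_. c)" "c \<in> carrier_vec n"
    using obsv unfolding array_observable_def sync_subspace_iff subset_eq by blast
  have "z i = c" if "i < q" for i
  proof (rule eq_vecI)
    fix r assume "r < dim_vec c"
    then have "r < n" using c(2) by simp
    then show "z i $ r = c $ r"
      using c(1) that stack_index[of i q r n z] stack_index[of i q r n "\<lambda>_. c"] by (simp add: X_def)
  qed (use z c(2) in simp)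
  then show ?thesis
    by (intro disag_eq_0) (simp add: z_def)
qed

section \<open>Transfer from components and blocks to states\<close>

lemma emb_has_vector_derivative:
  assumes "\<And>i r. i < q \<Longrightarrow> r < n \<Longrightarrow> ((\<lambda>s. f s i $ r) has_real_derivative d i $ r) (at t within S)"
  shows "((\<lambda>s. emb q n (f s)) has_vector_derivative emb q n d) (at t within S)"
proof -
  have single: "Poly_Mapping.single k c = c *\<^sub>R Poly_Mapping.single k (1::real)" for k :: "nat \<times> nat" and c
    by (rule poly_mapping_eqI) (simp add: lookup_single when_def)
  show ?thesis
    unfolding emb_def
  proof (intro has_vector_derivative_sum)
    fix i r assume "i \<in> {..<q}" "r \<in> {..<n}"
    then have "((\<lambda>s. f s i $ r) has_vector_derivative d i $ r) (at t within S)"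
      using assms by (simp add: has_real_derivative_iff_has_vector_derivative)
    then have "((\<lambda>s. (f s i $ r) *\<^sub>R Poly_Mapping.single (i, r) (1::real)) has_vector_derivative
        (d i $ r) *\<^sub>R Poly_Mapping.single (i, r) 1) (at t within S)"
      by (rule bounded_linear.has_vector_derivative[OF bounded_linear_scaleR_left])
    then show "((\<lambda>s. Poly_Mapping.single (i, r) (f s i $ r)) has_vector_derivative
        Poly_Mapping.single (i, r) (d i $ r)) (at t within S)"
      by (simp only: single[symmetric])
  qed
qed

text \<open>Serves two sums of the same \<open>w\<close>: with \<open>M = H\<close> it gives the
  derivative of \<open>aggregate\<close>, with the last block in \<open>M\<close> that of
  \<open>actuation\<close>.\<close>

lemma vsum_flow_derivative:
  assumes t: "0 \<le> (t::real)" and r: "r < n"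
    and w: "\<And>j s. j < q \<Longrightarrow> 0 \<le> s \<Longrightarrow> w j s \<in> carrier_vec (k j)"
    and deriv: "\<And>j. j < q \<Longrightarrow> vec_has_deriv (w j) (- w j t - (H j)\<^sup>T *\<^sub>v d j) t"
    and H: "\<And>j. j < q \<Longrightarrow> H j \<in> carrier_mat n (k j)"
    and M: "\<And>j. j < q \<Longrightarrow> M j \<in> carrier_mat n (k j)"
    and d: "\<And>j. j < q \<Longrightarrow> d j \<in> carrier_vec n"
  shows "((\<lambda>s. vsum n (\<lambda>j. M j *\<^sub>v w j s) {..<q} $ r) has_real_derivative
    (- vsum n (\<lambda>j. M j *\<^sub>v w j t) {..<q} - vsum n (\<lambda>j. M j *\<^sub>v ((H j)\<^sup>T *\<^sub>v d j)) {..<q}) $ r)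
    (at t within {0..})"
proof -
  define D where "D j = - w j t - (H j)\<^sup>T *\<^sub>v d j" for j
  have Hd: "(H j)\<^sup>T *\<^sub>v d j \<in> carrier_vec (k j)" if "j < q" for j
    using H[OF that] d[OF that] by simp
  have D: "D j \<in> carrier_vec (k j)" if "j < q" for j
    unfolding D_def using Hd[OF that] w[OF that t] by simp
  have Mw: "M j *\<^sub>v w j s \<in> carrier_vec n" if "j \<in> {..<q}" "0 \<le> s" for j s
    using M[of j] w[of j s] that by simp
  have MHd: "M j *\<^sub>v ((H j)\<^sup>T *\<^sub>v d j) \<in> carrier_vec n" if "j \<in> {..<q}" for j
    using M[of j] Hd[of j] that by simp
  have deriv_sum: "((\<lambda>s. \<Sum>j<q. \<Sum>c<k j. M j $$ (r, c) * w j s $ c) has_real_derivative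
      (\<Sum>j<q. \<Sum>c<k j. M j $$ (r, c) * D j $ c)) (at t within {0..})"
  proof (intro DERIV_sum DERIV_cmult)
    fix j c assume "j \<in> {..<q}" "c \<in> {..<k j}"
    then have j: "j < q" and c: "c < k j" by auto
    have "vec_has_deriv (w j) (D j) t"
      using deriv[OF j] by (simp only: D_def)
    then show "((\<lambda>s. w j s $ c) has_real_derivative D j $ c) (at t within {0..})"
      using c carrier_vecD[OF D[OF j]] by (simp add: vec_has_deriv_def)
  qed
  have eq: "(\<Sum>j<q. \<Sum>c<k j. M j $$ (r, c) * w j s $ c) = vsum n (\<lambda>j. M j *\<^sub>v w j s) {..<q} $ r"
    if "s \<in> {0..}" for s
  proof -
    have "vsum n (\<lambda>j. M j *\<^sub>v w j s) {..<q} $ r = (\<Sum>j<q. (M j *\<^sub>v w j s) $ r)"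
      by (rule vsum_index[OF finite_lessThan r]) (use Mw that in simp)
    also have "\<dots> = (\<Sum>j<q. \<Sum>c<k j. M j $$ (r, c) * w j s $ c)"
    proof (rule sum.cong[OF refl])
      fix j assume "j \<in> {..<q}"
      then have j: "j < q" by simp
      have "w j s \<in> carrier_vec (k j)" using w[OF j] that by simp
      then show "(M j *\<^sub>v w j s) $ r = (\<Sum>c<k j. M j $$ (r, c) * w j s $ c)"
        by (rule mult_mat_vec_index[OF M[OF j] _ r])
    qed
    finally show ?thesis by simp
  qed
  \<comment> \<open>\<open>w j s\<close> is known to have the right dimension for
    \<open>s \<ge> 0\<close> only, so the two expressions agree on \<open>{0..}\<close> and the
    derivative is transferred within that set.\<close>
  have *: "((\<lambda>s. vsum n (\<lambda>j. M j *\<^sub>v w j s) {..<q} $ r) has_real_derivative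
      (\<Sum>j<q. \<Sum>c<k j. M j $$ (r, c) * D j $ c)) (at t within {0..})"
    by (rule has_field_derivative_transform_within[OF deriv_sum, where d = 1]) (use t eq in simp_all)
  have "(\<Sum>j<q. \<Sum>c<k j. M j $$ (r, c) * D j $ c)
      = (\<Sum>j<q. - (M j *\<^sub>v w j t) $ r - (M j *\<^sub>v ((H j)\<^sup>T *\<^sub>v d j)) $ r)"
  proof (rule sum.cong[OF refl])
    fix j assume "j \<in> {..<q}"
    then have j: "j < q" by simp
    have "D j $ c = - (w j t $ c) - ((H j)\<^sup>T *\<^sub>v d j) $ c" if "c < k j" for c
      unfolding D_def using that carrier_vecD[OF Hd[OF j]] carrier_vecD[OF w[OF j t]] by simp
    then show "(\<Sum>c<k j. M j $$ (r, c) * D j $ c)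
        = - (M j *\<^sub>v w j t) $ r - (M j *\<^sub>v ((H j)\<^sup>T *\<^sub>v d j)) $ r"
      unfolding mult_mat_vec_index[OF M[OF j] w[OF j t] r] mult_mat_vec_index[OF M[OF j] Hd[OF j] r]
      by (simp add: sum_subtractf[symmetric] sum_negf[symmetric] right_diff_distrib)
  qed
  also have "\<dots> = - (\<Sum>j<q. (M j *\<^sub>v w j t) $ r) - (\<Sum>j<q. (M j *\<^sub>v ((H j)\<^sup>T *\<^sub>v d j)) $ r)"
    by (simp only: sum_subtractf sum_negf)
  also have "(\<Sum>j<q. (M j *\<^sub>v w j t) $ r) = vsum n (\<lambda>j. M j *\<^sub>v w j t) {..<q} $ r"
    by (rule vsum_index[symmetric, OF finite_lessThan r]) (use Mw t in simp)
  also have "(\<Sum>j<q. (M j *\<^sub>v ((H j)\<^sup>T *\<^sub>v d j)) $ r) = vsum n (\<lambda>j. M j *\<^sub>v ((H j)\<^sup>T *\<^sub>v d j)) {..<q} $ r"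
    by (rule vsum_index[symmetric, OF finite_lessThan r]) (use MHd in simp)
  finally have "(\<Sum>j<q. \<Sum>c<k j. M j $$ (r, c) * D j $ c)
      = - vsum n (\<lambda>j. M j *\<^sub>v w j t) {..<q} $ r - vsum n (\<lambda>j. M j *\<^sub>v ((H j)\<^sup>T *\<^sub>v d j)) {..<q} $ r" .
  moreover have "dim_vec (vsum n (\<lambda>j. M j *\<^sub>v w j t) {..<q}) = n"
    by (rule vsum_dim) (use Mw t in simp)
  moreover have "dim_vec (vsum n (\<lambda>j. M j *\<^sub>v ((H j)\<^sup>T *\<^sub>v d j)) {..<q}) = n"
    by (rule vsum_dim) (use MHd in simp)
  ultimately show ?thesis
    using * r by simp
qed

lemma disag_cong:
  assumes "\<And>i r. i < q \<Longrightarrow> r < n \<Longrightarrow> lookup x (i, r) = lookup y (i, r)"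
  shows "disag q n x = disag q n y"
proof -
  have "blk n x i = blk n y i" if "i < q" for i
    using assms that by (intro eq_vecI) simp_all
  then show ?thesis
    unfolding disag_def by (intro arg_cong[of _ _ "\<lambda>x. _ *\<^sub>R x"] complete.lapl_depends) simp
qed

lemma disag_emb_eqI:
  assumes "disag q n y = y" "\<And>i r. i < q \<Longrightarrow> r < n \<Longrightarrow> f i $ r = lookup y (i, r)"
  shows "disag q n (emb q n f) = y"
proof -
  have "disag q n (emb q n f) = disag q n y"
    by (rule disag_cong) (simp add: lookup_emb assms(2))
  then show ?thesis by (simp add: assms(1))
qed

lemma lookup_diag_pow:
  assumes "M \<in> carrier_mat n n" "i < q" "r < n"
  shows "lookup ((diag q n M ^^ l) x) (i, r) = (M ^\<^sub>m l *\<^sub>v blk n x i) $ r"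
  using blk_diag_pow[OF assms(1,2), of l x] assms(3) by (metis blk_index)

lemma disag_pow_emb:
  assumes M: "M \<in> carrier_mat n n" and f: "\<And>i. i < q \<Longrightarrow> f i \<in> carrier_vec n"
  shows "disag q n (emb q n (\<lambda>i. M ^\<^sub>m l *\<^sub>v f i)) = (diag q n M ^^ l) (disag q n (emb q n f))"
proof -
  have "disag q n (emb q n (\<lambda>i. M ^\<^sub>m l *\<^sub>v f i)) = disag q n ((diag q n M ^^ l) (emb q n f))"
    by (rule disag_cong) (simp add: lookup_emb lookup_diag_pow[OF M] blk_emb[OF _ f])
  also have "\<dots> = (diag q n M ^^ l) (disag q n (emb q n f))"
    by (rule funpow_commute[symmetric]) (rule disag_diag[OF M, symmetric])
  finally show ?thesis .
qed

text \<open>One formula for three uses: equal exponents for the summands of the Gramian,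
  \<open>l = 0\<close> for the feedback of the controller, \<open>l' = 0\<close> for the forcing of
  the estimator.\<close>

lemma (in laplacian) lookup_pow_lapl_pow:
  assumes M: "M \<in> carrier_mat n n" "N \<in> carrier_mat n n" and i: "i < q" and r: "r < n"
  shows "lookup ((diag q n M ^^ l) (lapl q n W ((diag q n N ^^ l') x))) (i, r)
    = (\<Sum>j<q. (M ^\<^sub>m l *\<^sub>v (W i j *\<^sub>v (N ^\<^sub>m l' *\<^sub>v (blk n x i - blk n x j)))) $ r)"
proof -
  have Ml: "M ^\<^sub>m l \<in> carrier_mat n n" and Nl: "N ^\<^sub>m l' \<in> carrier_mat n n"
    using M by (auto intro: pow_carrier_mat)
  have d: "blk n ((diag q n N ^^ l') x) i - blk n ((diag q n N ^^ l') x) j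
      = N ^\<^sub>m l' *\<^sub>v (blk n x i - blk n x j)" if "j < q" for j
    unfolding blk_diag_pow[OF M(2) i] blk_diag_pow[OF M(2) that]
    by (rule mult_minus_distrib_mat_vec[symmetric, OF Nl]) simp_all
  have c: "W i j *\<^sub>v (N ^\<^sub>m l' *\<^sub>v (blk n x i - blk n x j)) \<in> carrier_vec n" if "j \<in> {..<q}" for j
    by (rule W_mult_carrier) (use that i in simp_all, use Nl in simp)
  have "blk n (lapl q n W ((diag q n N ^^ l') x)) i
      = vsum n (\<lambda>j. W i j *\<^sub>v (N ^\<^sub>m l' *\<^sub>v (blk n x i - blk n x j))) {..<q}"
    unfolding blk_lapl[OF i] by (rule vsum_cong) (use d c in simp_all)
  then have "lookup ((diag q n M ^^ l) (lapl q n W ((diag q n N ^^ l') x))) (i, r)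
      = (M ^\<^sub>m l *\<^sub>v vsum n (\<lambda>j. W i j *\<^sub>v (N ^\<^sub>m l' *\<^sub>v (blk n x i - blk n x j))) {..<q}) $ r"
    unfolding lookup_diag_pow[OF M(1) i r] by simp
  also have "\<dots> = vsum n (\<lambda>j. M ^\<^sub>m l *\<^sub>v (W i j *\<^sub>v (N ^\<^sub>m l' *\<^sub>v (blk n x i - blk n x j)))) {..<q} $ r"
    by (subst mult_mat_vec_vsum[OF finite_lessThan Ml c]) simp_all
  also have "\<dots> = (\<Sum>j<q. (M ^\<^sub>m l *\<^sub>v (W i j *\<^sub>v (N ^\<^sub>m l' *\<^sub>v (blk n x i - blk n x j)))) $ r)"
    by (rule vsum_index[OF finite_lessThan r]) (use Ml c in simp)
  finally show ?thesis .
qed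

lemma abs_lookup_le_norm: "\<bar>lookup x k\<bar> \<le> norm x" for x :: "'a \<Rightarrow>\<^sub>0 real"
proof -
  have "norm (Poly_Mapping.single k (1::real)) = 1"
    by (simp add: norm_eq_sqrt_inner inner_single)
  then show ?thesis
    using Cauchy_Schwarz_ineq2[of "Poly_Mapping.single k 1" x] by (simp add: inner_single)
qed

text \<open>\<open>disag\<close> keeps differences of blocks, and \<open>vnorm\<close> of a
  difference is a continuous function of finitely many coordinates.\<close>

lemma synchronizes_of_disag:
  assumes x: "\<And>i k. i < q \<Longrightarrow> x i k \<in> carrier_vec n"
    and lim: "(\<lambda>k. disag q n (emb q n (\<lambda>i. x i k))) \<longlonglongrightarrow> 0"
  shows "synchronizes q x"
  unfolding synchronizes_def
proof (intro allI impI)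
  fix i j assume ij: "i < q" "j < q"
  define y where "y k = disag q n (emb q n (\<lambda>i. x i k))" for k
  have y0: "(\<lambda>k. lookup (y k) c) \<longlonglongrightarrow> 0" for c
  proof (rule tendsto_rabs_zero_cancel, rule tendsto_sandwich[OF _ _ tendsto_const])
    show "(\<lambda>k. norm (y k)) \<longlonglongrightarrow> 0"
      using lim unfolding y_def by (rule tendsto_norm_zero)
  qed (simp_all add: abs_lookup_le_norm)
  have diff: "(x i k - x j k) $ r = lookup (y k) (i, r) - lookup (y k) (j, r)" if r: "r < n" for k r
  proof -
    have "x i k - x j k = blk n (y k) i - blk n (y k) j"
      unfolding y_def disag_diff[OF ij] using ij x by simp
    then show ?thesis using r by simp
  qed
  have "vnorm (x i k - x j k) = sqrt (\<Sum>r<n. (lookup (y k) (i, r) - lookup (y k) (j, r))^2)" for k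
  proof -
    have "x i k - x j k \<in> carrier_vec n"
      using x ij by simp
    then show ?thesis
      unfolding vnorm_def by (simp add: scalar_prod_lessThan diff power2_eq_square)
  qed
  moreover have "(\<lambda>k. sqrt (\<Sum>r<n. (lookup (y k) (i, r) - lookup (y k) (j, r))^2))
      \<longlonglongrightarrow> sqrt (\<Sum>r<n. (0 - 0)^2)"
    by (intro tendsto_intros y0)
  ultimately show "(\<lambda>k. vnorm (x i k - x j k)) \<longlonglongrightarrow> 0"
    by simp
qed

section \<open>The array and its flows\<close>

lemma ctrb_mat_carrier:
  assumes "A \<in> carrier_mat n n" "B \<in> carrier_mat n p"
  shows "ctrb_mat A B N \<in> carrier_mat n (N * p)"
proof -
  have "A ^\<^sub>m l * B \<in> carrier_mat n p" for l
    by (rule mult_carrier_mat[OF pow_carrier_mat[OF assms(1)] assms(2)])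
  then show ?thesis
    unfolding ctrb_mat_def carrier_matD(1)[OF assms(2)] by (rule hcat_carrier)
qed

lemma ctrb_block_gram:
  fixes A B :: "real mat"
  assumes A: "A \<in> carrier_mat n n" and B: "B \<in> carrier_mat n p" and v: "v \<in> carrier_vec n"
  shows "(B * B\<^sup>T) *\<^sub>v (A\<^sup>T ^\<^sub>m l *\<^sub>v v) = B *\<^sub>v ((A ^\<^sub>m l * B)\<^sup>T *\<^sub>v v)"
proof -
  have Al: "A ^\<^sub>m l \<in> carrier_mat n n" by (rule pow_carrier_mat[OF A])
  have At: "A\<^sup>T ^\<^sub>m l \<in> carrier_mat n n" by (rule pow_carrier_mat) (use A in simp)
  have Bt: "B\<^sup>T \<in> carrier_mat p n" using B by simp
  have "(A ^\<^sub>m l * B)\<^sup>T *\<^sub>v v = B\<^sup>T *\<^sub>v (A\<^sup>T ^\<^sub>m l *\<^sub>v v)"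
    unfolding transpose_mult[OF Al B] transpose_pow_mat[OF A]
    by (rule assoc_mult_mat_vec[OF Bt At v])
  moreover have "(B * B\<^sup>T) *\<^sub>v (A\<^sup>T ^\<^sub>m l *\<^sub>v v) = B *\<^sub>v (B\<^sup>T *\<^sub>v (A\<^sup>T ^\<^sub>m l *\<^sub>v v))"
    by (rule assoc_mult_mat_vec[OF B Bt mult_mat_vec_carrier[OF At v]])
  ultimately show ?thesis by simp
qed

lemma ctrb_gram_index:
  assumes A: "A \<in> carrier_mat n n" and B: "B \<in> carrier_mat n p" and v: "v \<in> carrier_vec n" and r: "r < n"
  shows "(ctrb_mat A B N *\<^sub>v ((ctrb_mat A B N)\<^sup>T *\<^sub>v v)) $ r
    = (\<Sum>l<N. (A ^\<^sub>m l *\<^sub>v ((B * B\<^sup>T) *\<^sub>v (A\<^sup>T ^\<^sub>m l *\<^sub>v v))) $ r)"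
proof -
  have AB: "A ^\<^sub>m l * B \<in> carrier_mat n p" for l
    by (rule mult_carrier_mat[OF pow_carrier_mat[OF A] B])
  have ABt: "(A ^\<^sub>m l * B)\<^sup>T *\<^sub>v v \<in> carrier_vec p" for l
    by (rule mult_mat_vec_carrier[OF _ v]) (use AB[of l] in simp)
  have c: "(A ^\<^sub>m l * B) *\<^sub>v ((A ^\<^sub>m l * B)\<^sup>T *\<^sub>v v) \<in> carrier_vec n" for l
    by (rule mult_mat_vec_carrier[OF AB ABt])
  have "ctrb_mat A B N *\<^sub>v ((ctrb_mat A B N)\<^sup>T *\<^sub>v v)
      = vsum n (\<lambda>l. (A ^\<^sub>m l * B) *\<^sub>v ((A ^\<^sub>m l * B)\<^sup>T *\<^sub>v v)) {..<N}"
    unfolding ctrb_mat_def carrier_matD(1)[OF B] by (rule hcat_gram) (rule AB, rule v)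
  then have "(ctrb_mat A B N *\<^sub>v ((ctrb_mat A B N)\<^sup>T *\<^sub>v v)) $ r
      = (\<Sum>l<N. ((A ^\<^sub>m l * B) *\<^sub>v ((A ^\<^sub>m l * B)\<^sup>T *\<^sub>v v)) $ r)"
    using vsum_index[OF finite_lessThan r c] by simp
  also have "\<dots> = (\<Sum>l<N. (A ^\<^sub>m l *\<^sub>v ((B * B\<^sup>T) *\<^sub>v (A\<^sup>T ^\<^sub>m l *\<^sub>v v))) $ r)"
    unfolding ctrb_block_gram[OF A B v]
    by (intro sum.cong refl arg_cong[of _ _ "\<lambda>u. u $ r"] assoc_mult_mat_vec[OF pow_carrier_mat[OF A] B ABt])
  finally show ?thesis .
qed

text \<open>This is how \<lambda> drives the applied input: with \<open>v\<close> a difference of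
  multipliers, summation over the neighbours turns the right-hand side into the Laplacian after the
  power \<open>K\<close> of the transpose.\<close>

lemma ctrb_last_block:
  assumes A: "A \<in> carrier_mat n n" and B: "B \<in> carrier_mat n p" and v: "v \<in> carrier_vec n"
  shows "(B * last_block_mat (Suc K) p) *\<^sub>v ((ctrb_mat A B (Suc K))\<^sup>T *\<^sub>v v)
    = (B * B\<^sup>T) *\<^sub>v (A\<^sup>T ^\<^sub>m K *\<^sub>v v)"
proof -
  have AB: "A ^\<^sub>m l * B \<in> carrier_mat n p" for l
    by (rule mult_carrier_mat[OF pow_carrier_mat[OF A] B])
  have L: "last_block_mat (Suc K) p \<in> carrier_mat p (Suc K * p)"
    by (simp add: last_block_mat_def kron_def)
  have c: "(ctrb_mat A B (Suc K))\<^sup>T *\<^sub>v v \<in> carrier_vec (Suc K * p)"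
    by (rule mult_mat_vec_carrier[OF _ v]) (use ctrb_mat_carrier[OF A B, of "Suc K"] in simp)
  have "last_block_mat (Suc K) p *\<^sub>v ((ctrb_mat A B (Suc K))\<^sup>T *\<^sub>v v) = (A ^\<^sub>m K * B)\<^sup>T *\<^sub>v v"
    using last_block_hcat_transpose[of "Suc K" "\<lambda>l. A ^\<^sub>m l * B" n p v] AB v
    by (simp add: ctrb_mat_def carrier_matD(1)[OF B] del: upt_Suc)
  then show ?thesis
    unfolding ctrb_block_gram[OF A B v] assoc_mult_mat_vec[OF B L c] by simp
qed

lemma scalar_prod_self_ge0: "0 \<le> v \<bullet> v" for v :: "real vec"
  unfolding scalar_prod_def by (intro sum_nonneg) simp

lemma scalar_prod_self_eq_0:
  fixes v :: "real vec"
  assumes "v \<in> carrier_vec d" "v \<bullet> v = 0"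
  shows "v = 0\<^sub>v d"
proof (rule eq_vecI)
  fix r assume "r < dim_vec (0\<^sub>v d)"
  then have r: "r < d" by simp
  have "(\<Sum>r<d. v $ r * v $ r) = 0"
    using assms(2) by (simp only: scalar_prod_lessThan[OF assms(1,1)])
  then show "v $ r = 0\<^sub>v d $ r"
    using r by (subst (asm) sum_nonneg_eq_0_iff) auto
qed (use assms(1) in simp)

locale array =
  fixes q n :: nat and p m :: "nat \<Rightarrow> nat \<Rightarrow> nat" and A :: "real mat" and B C :: "nat \<Rightarrow> nat \<Rightarrow> real mat"
  assumes rel: "relative_array q n p m A B C"
begin

lemma A_carrier: "A \<in> carrier_mat n n"
  and B_carrier: "i < q \<Longrightarrow> j < q \<Longrightarrow> B i j \<in> carrier_mat n (p i j)"
  and C_carrier: "i < q \<Longrightarrow> j < q \<Longrightarrow> C i j \<in> carrier_mat (m i j) n"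
  and B_swap: "i < q \<Longrightarrow> j < q \<Longrightarrow> B j i = - B i j"
  and C_swap: "i < q \<Longrightarrow> j < q \<Longrightarrow> C j i = - C i j"
  using rel unfolding relative_array_def by blast+

text \<open>The sign in \<open>B j i = - B i j\<close> cancels in the product, so the edge weights
  do not depend on the orientation of the pair; likewise for \<open>C\<close>.\<close>

definition WB :: "nat \<Rightarrow> nat \<Rightarrow> real mat" where "WB i j = B i j * (B i j)\<^sup>T"
definition WC :: "nat \<Rightarrow> nat \<Rightarrow> real mat" where "WC i j = (C i j)\<^sup>T * C i j"

lemma WB_carrier: "i < q \<Longrightarrow> j < q \<Longrightarrow> WB i j \<in> carrier_mat n n"
  unfolding WB_def by (rule mult_carrier_mat[OF B_carrier]) (use B_carrier in simp_all)

lemma WC_carrier: "i < q \<Longrightarrow> j < q \<Longrightarrow> WC i j \<in> carrier_mat n n"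
  unfolding WC_def by (rule mult_carrier_mat[OF _ C_carrier]) (use C_carrier in simp_all)

lemma WB_mult:
  "i < q \<Longrightarrow> j < q \<Longrightarrow> v \<in> carrier_vec n \<Longrightarrow> WB i j *\<^sub>v v = B i j *\<^sub>v ((B i j)\<^sup>T *\<^sub>v v)"
  unfolding WB_def by (rule assoc_mult_mat_vec[OF B_carrier]) (use B_carrier in simp_all)

lemma WC_mult:
  "i < q \<Longrightarrow> j < q \<Longrightarrow> v \<in> carrier_vec n \<Longrightarrow> WC i j *\<^sub>v v = (C i j)\<^sup>T *\<^sub>v (C i j *\<^sub>v v)"
  unfolding WC_def by (rule assoc_mult_mat_vec[OF _ C_carrier]) (use C_carrier in simp_all)

sublocale LB: laplacian q n WB
proof
  fix i j assume ij: "i < q" "j < q"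
  show "WB i j \<in> carrier_mat n n" by (rule WB_carrier[OF ij])
  show "(WB i j)\<^sup>T = WB i j"
    unfolding WB_def using B_carrier[OF ij] by (simp add: transpose_mult[of _ n "p i j" _ n])
  show "WB j i = WB i j"
    unfolding WB_def B_swap[OF ij] using B_carrier[OF ij] by (simp add: transpose_uminus)
qed

sublocale LC: laplacian q n WC
proof
  fix i j assume ij: "i < q" "j < q"
  show "WC i j \<in> carrier_mat n n" by (rule WC_carrier[OF ij])
  show "(WC i j)\<^sup>T = WC i j"
    unfolding WC_def using C_carrier[OF ij] by (simp add: transpose_mult[of _ n "m i j" _ n])
  show "WC j i = WC i j"
    unfolding WC_def C_swap[OF ij] using C_carrier[OF ij] by (simp add: transpose_uminus)
qed

lemma WB_form: "i < q \<Longrightarrow> j < q \<Longrightarrow> v \<in> carrier_vec n \<Longrightarrow>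
    v \<bullet> (WB i j *\<^sub>v v) = ((B i j)\<^sup>T *\<^sub>v v) \<bullet> ((B i j)\<^sup>T *\<^sub>v v)"
  unfolding WB_mult
  by (rule scalar_prod_mult_transpose[OF B_carrier], assumption+, rule mult_mat_vec_carrier)
    (use B_carrier in simp_all)

lemma WC_form:
  assumes "i < q" "j < q" "v \<in> carrier_vec n"
  shows "v \<bullet> (WC i j *\<^sub>v v) = (C i j *\<^sub>v v) \<bullet> (C i j *\<^sub>v v)"
proof -
  have "(C i j)\<^sup>T \<in> carrier_mat n (m i j)" "C i j *\<^sub>v v \<in> carrier_vec (m i j)"
    using C_carrier[OF assms(1,2)] assms(3) by simp_all
  from scalar_prod_mult_transpose[OF this(1) assms(3) this(2)] show ?thesis
    unfolding WC_mult[OF assms] by simp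
qed

text \<open>Controllability speaks of the powers below \<open>n\<close>, and
  \<open>n \<le> Suc K\<close> places all of them among the summands of the Gramian.\<close>

lemma control_horizon:
  assumes "array_controllable q n p A B" "n \<le> Suc K"
  shows "horizon (diag q n A) (diag q n A\<^sup>T) (lapl q n WB) (disag q n) (unit_states q n) K"
proof (rule LB.horizon_array[OF A_carrier])
  show "0 \<le> v \<bullet> (WB i j *\<^sub>v v)" if "i < q" "j < q" "v \<in> carrier_vec n" for i j v
    unfolding WB_form[OF that] by (rule scalar_prod_self_ge0)
  fix x
  assume 0: "\<And>l i j. l \<le> K \<Longrightarrow> i < q \<Longrightarrow> j < q \<Longrightarrow>
        (A\<^sup>T ^\<^sub>m l *\<^sub>v (blk n x i - blk n x j)) \<bullet>
          (WB i j *\<^sub>v (A\<^sup>T ^\<^sub>m l *\<^sub>v (blk n x i - blk n x j))) = 0"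
  show "disag q n x = 0"
  proof (rule controllable_nondegenerate[OF A_carrier B_carrier assms(1)])
    fix l i j assume l: "l < n" and ij: "i < q" "j < q"
    have At: "A\<^sup>T ^\<^sub>m l \<in> carrier_mat n n" by (rule pow_carrier_mat) (use A_carrier in simp)
    let ?u = "A\<^sup>T ^\<^sub>m l *\<^sub>v (blk n x i - blk n x j)"
    have u: "?u \<in> carrier_vec n" by (rule mult_mat_vec_carrier[OF At]) simp
    have "(B i j)\<^sup>T *\<^sub>v ?u \<in> carrier_vec (p i j)"
      by (rule mult_mat_vec_carrier[OF _ u]) (use B_carrier[OF ij] in simp)
    moreover have "((B i j)\<^sup>T *\<^sub>v ?u) \<bullet> ((B i j)\<^sup>T *\<^sub>v ?u) = 0"
      using 0[OF _ ij, of l] l assms(2) unfolding WB_form[OF ij u] by simp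
    ultimately show "(B i j)\<^sup>T *\<^sub>v ?u = 0\<^sub>v (p i j)"
      by (rule scalar_prod_self_eq_0)
  qed
qed

text \<open>Duality: \<open>C\<close> takes the place of the transpose of \<open>B\<close>, so
  \<open>horizon_array\<close> is applied to the transpose of \<open>A\<close>.\<close>

lemma estimation_horizon:
  assumes "array_observable q n m A C" "n \<le> Suc K"
  shows "horizon (diag q n A\<^sup>T) (diag q n A) (lapl q n WC) (disag q n) (unit_states q n) K"
proof -
  have "horizon (diag q n A\<^sup>T) (diag q n (A\<^sup>T)\<^sup>T) (lapl q n WC) (disag q n) (unit_states q n) K"
  proof (rule LC.horizon_array)
    show "A\<^sup>T \<in> carrier_mat n n" using A_carrier by simp
    show "0 \<le> v \<bullet> (WC i j *\<^sub>v v)" if "i < q" "j < q" "v \<in> carrier_vec n" for i j v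
      unfolding WC_form[OF that] by (rule scalar_prod_self_ge0)
    fix x
    assume 0: "\<And>l i j. l \<le> K \<Longrightarrow> i < q \<Longrightarrow> j < q \<Longrightarrow>
          ((A\<^sup>T)\<^sup>T ^\<^sub>m l *\<^sub>v (blk n x i - blk n x j)) \<bullet>
            (WC i j *\<^sub>v ((A\<^sup>T)\<^sup>T ^\<^sub>m l *\<^sub>v (blk n x i - blk n x j))) = 0"
    show "disag q n x = 0"
    proof (rule observable_nondegenerate[OF A_carrier C_carrier assms(1)])
      fix l i j assume l: "l < n" and ij: "i < q" "j < q"
      have At: "A ^\<^sub>m l \<in> carrier_mat n n" by (rule pow_carrier_mat[OF A_carrier])
      let ?u = "A ^\<^sub>m l *\<^sub>v (blk n x i - blk n x j)"
      have u: "?u \<in> carrier_vec n" by (rule mult_mat_vec_carrier[OF At]) simp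
      have "C i j *\<^sub>v ?u \<in> carrier_vec (m i j)"
        by (rule mult_mat_vec_carrier[OF C_carrier[OF ij] u])
      moreover have "(C i j *\<^sub>v ?u) \<bullet> (C i j *\<^sub>v ?u) = 0"
        using 0[OF _ ij, of l] l assms(2) unfolding transpose_transpose WC_form[OF ij u] by simp
      ultimately show "C i j *\<^sub>v ?u = 0\<^sub>v (m i j)"
        by (rule scalar_prod_self_eq_0)
    qed
  qed
  then show ?thesis by simp
qed

end

lemma has_vector_derivative_disag_emb:
  assumes "\<And>i r. i < q \<Longrightarrow> r < n \<Longrightarrow> ((\<lambda>s. f s i $ r) has_real_derivative d i $ r) (at t within S)"
  shows "((\<lambda>s. disag q n (emb q n (f s))) has_vector_derivative disag q n (emb q n d)) (at t within S)"
  by (rule bounded_linear.has_vector_derivative[OF bounded_linear_disag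
        emb_has_vector_derivative[OF assms]])

lemma disag_emb_diff:
  assumes f: "\<And>i. i < q \<Longrightarrow> f i \<in> carrier_vec n" and g: "\<And>i. i < q \<Longrightarrow> g i \<in> carrier_vec n"
  shows "disag q n (emb q n (\<lambda>i. - f i - g i)) = - disag q n (emb q n f) - disag q n (emb q n g)"
proof -
  have "emb q n (\<lambda>i. - f i - g i) = emb q n (\<lambda>i. - f i) - emb q n g"
    by (rule emb_minus) (use f g in simp_all)
  also have "emb q n (\<lambda>i. - f i) = - emb q n f"
    by (rule emb_uminus[OF f])
  finally show ?thesis
    using bounded_linear.linear[OF bounded_linear_disag[of q n]] by (simp add: linear_diff linear_neg)
qed

section \<open>The flows as linear systems modulo synchronization\<close>

context array
begin

text \<open>The array feels \<open>w\<close> through two sums only: this one drives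
  \<open>lam\<close>, and \<open>actuation\<close> at time \<open>\<tau>c\<close> is the input term
  of system \<open>i\<close>. Each of them decays at rate 1 and is forced by differences of
  \<open>lam\<close>, so \<open>w\<close> drops out of the equations.\<close>

definition aggregate :: "nat \<Rightarrow> (nat \<Rightarrow> nat \<Rightarrow> real vec) \<Rightarrow> nat \<Rightarrow> real vec" where
  "aggregate N w i = vsum n (\<lambda>j. ctrb_mat A (B i j) N *\<^sub>v w i j) {..<q}"

definition actuation :: "nat \<Rightarrow> (nat \<Rightarrow> nat \<Rightarrow> real vec) \<Rightarrow> nat \<Rightarrow> real vec" where
  "actuation N w i = vsum n (\<lambda>j. (B i j * last_block_mat N (p i j)) *\<^sub>v w i j) {..<q}"

text \<open>Convergence can be expected only after projection: the mean of \<open>lam\<close> is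
  driven by the mean of the estimates and may drift without bound. Since \<open>z\<close> and
  \<open>v\<close> are forced by differences of \<open>lam\<close> alone, the projected quantities
  still form a closed system.\<close>

lemma control_flow_states:
  assumes flow: "control_flow q n p A B (Suc K) xh w lam"
    and hor: "horizon (diag q n A) (diag q n A\<^sup>T) (lapl q n WB) (disag q n) E K"
    and xh: "\<And>i. i < q \<Longrightarrow> xh i \<in> carrier_vec n"
    and t: "0 \<le> t"
  defines "\<mu> \<equiv> \<lambda>t. disag q n (emb q n (\<lambda>i. lam i t))"
    and "z \<equiv> \<lambda>t. disag q n (emb q n (aggregate (Suc K) (\<lambda>i j. w i j t)))"
    and "v \<equiv> \<lambda>t. disag q n (emb q n (actuation (Suc K) (\<lambda>i j. w i j t)))"
    and "a \<equiv> emb q n xh"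
  shows "\<mu> 0 = 0" "z 0 = 0" "v 0 = 0"
    and "(\<mu> has_vector_derivative (diag q n A ^^ Suc K) (disag q n a) + z t) (at t within {0..})"
    and "(z has_vector_derivative
      - z t - horizon.G (diag q n A) (diag q n A\<^sup>T) (lapl q n WB) (Suc K) (\<mu> t)) (at t within {0..})"
    and "(v has_vector_derivative - v t - lapl q n WB ((diag q n A\<^sup>T ^^ K) (\<mu> t))) (at t within {0..})"
proof -
  interpret c: horizon "diag q n A" "diag q n A\<^sup>T" "lapl q n WB" "disag q n" E K
    by (rule hor)
  note A = A_carrier
  have At: "A\<^sup>T \<in> carrier_mat n n" using A by simp
  have AN: "A ^\<^sub>m Suc K \<in> carrier_mat n n" by (rule pow_carrier_mat[OF A])
  have w: "w i j s \<in> carrier_vec (Suc K * p i j)" if "i < q" "j < q" "0 \<le> s" for i j s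
    using flow that unfolding control_flow_def by blast
  have lam: "lam i s \<in> carrier_vec n" if "i < q" "0 \<le> s" for i s
    using flow that unfolding control_flow_def by blast
  have w0: "w i j 0 = 0\<^sub>v (Suc K * p i j)" if "i < q" "j < q" for i j
    using flow that unfolding control_flow_def by blast
  have lam0: "lam i 0 = 0\<^sub>v n" if "i < q" for i
    using flow that unfolding control_flow_def by blast
  have dw: "vec_has_deriv (w i j) (- w i j s - (ctrb_mat A (B i j) (Suc K))\<^sup>T *\<^sub>v (lam i s - lam j s)) s"
    if "i < q" "j < q" "0 \<le> s" for i j s
    using flow that unfolding control_flow_def by blast
  have dlam: "vec_has_deriv (lam i) (A ^\<^sub>m Suc K *\<^sub>v xh i + aggregate (Suc K) (\<lambda>i j. w i j s) i) s"
    if "i < q" "0 \<le> s" for i s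
    using flow that unfolding control_flow_def aggregate_def by blast
  have H: "ctrb_mat A (B i j) (Suc K) \<in> carrier_mat n (Suc K * p i j)" if "i < q" "j < q" for i j
    by (rule ctrb_mat_carrier[OF A B_carrier[OF that]])
  have M: "B i j * last_block_mat (Suc K) (p i j) \<in> carrier_mat n (Suc K * p i j)" if "i < q" "j < q" for i j
    by (rule mult_carrier_mat[OF B_carrier[OF that]]) (simp add: last_block_mat_def kron_def)
  have agg: "aggregate (Suc K) (\<lambda>i j. w i j s) i \<in> carrier_vec n" if "i < q" "0 \<le> s" for i s
    unfolding aggregate_def
    by (rule vsum_carrier, rule mult_mat_vec_carrier[OF H w]) (use that in simp_all)
  have act: "actuation (Suc K) (\<lambda>i j. w i j s) i \<in> carrier_vec n" if "i < q" "0 \<le> s" for i s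
    unfolding actuation_def
    by (rule vsum_carrier, rule mult_mat_vec_carrier[OF M w]) (use that in simp_all)
  have disag_0: "disag q n (emb q n f) = 0" if "\<And>i r. i < q \<Longrightarrow> r < n \<Longrightarrow> f i $ r = 0" for f
    by (rule disag_emb_eqI) (simp_all add: that linear_0[OF bounded_linear.linear[OF bounded_linear_disag]])
  show "\<mu> 0 = 0"
    unfolding \<mu>_def by (rule disag_0) (simp add: lam0)
  show "z 0 = 0"
    unfolding z_def
  proof (rule disag_0)
    fix i r assume i: "i < q" and r: "r < n"
    have "ctrb_mat A (B i j) (Suc K) *\<^sub>v w i j 0 = 0\<^sub>v n" if "j < q" for j
      unfolding w0[OF i that] by (rule mult_mat_zero_vec[OF H[OF i that]])
    then show "aggregate (Suc K) (\<lambda>i j. w i j 0) i $ r = 0"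
      unfolding aggregate_def using r by (subst vsum_index) simp_all
  qed
  show "v 0 = 0"
    unfolding v_def
  proof (rule disag_0)
    fix i r assume i: "i < q" and r: "r < n"
    have "(B i j * last_block_mat (Suc K) (p i j)) *\<^sub>v w i j 0 = 0\<^sub>v n" if "j < q" for j
      unfolding w0[OF i that] by (rule mult_mat_zero_vec[OF M[OF i that]])
    then show "actuation (Suc K) (\<lambda>i j. w i j 0) i $ r = 0"
      unfolding actuation_def using r by (subst vsum_index) simp_all
  qed
  \<comment> \<open>The unprojected state, whose blocks are the vectors \<open>lam i t\<close>
    themselves. It may stand for \<open>\<mu> t\<close> because the Gramian and the Laplacian ignore
    the synchronized part.\<close>
  define x where "x = emb q n (\<lambda>i. lam i t)"
  have blk_x: "blk n x i = lam i t" if "i < q" for i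
    unfolding x_def by (rule blk_emb[where f = "\<lambda>i. lam i t", OF that lam[OF that t]])
  have x_\<mu>: "disag q n x = \<mu> t"
    by (simp add: x_def \<mu>_def)
  have dl: "lam i t - lam j t \<in> carrier_vec n" if "i < q" "j < q" for i j
    by (rule minus_carrier_vec[OF lam lam]) (use that t in simp_all)
  have "(\<mu> has_vector_derivative disag q n (emb q n
      (\<lambda>i. A ^\<^sub>m Suc K *\<^sub>v xh i + aggregate (Suc K) (\<lambda>i j. w i j t) i))) (at t within {0..})"
    unfolding \<mu>_def
  proof (rule has_vector_derivative_disag_emb)
    fix i r assume i: "i < q" and r: "r < n"
    have "dim_vec (A ^\<^sub>m Suc K *\<^sub>v xh i + aggregate (Suc K) (\<lambda>i j. w i j t) i) = n"
      using agg[OF i t] by simp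
    then show "((\<lambda>s. lam i s $ r) has_real_derivative
        (A ^\<^sub>m Suc K *\<^sub>v xh i + aggregate (Suc K) (\<lambda>i j. w i j t) i) $ r) (at t within {0..})"
      using dlam[OF i t] r unfolding vec_has_deriv_def by simp
  qed
  moreover have "disag q n (emb q n (\<lambda>i. A ^\<^sub>m Suc K *\<^sub>v xh i + aggregate (Suc K) (\<lambda>i j. w i j t) i))
      = (diag q n A ^^ Suc K) (disag q n a) + z t"
  proof -
    have "emb q n (\<lambda>i. A ^\<^sub>m Suc K *\<^sub>v xh i + aggregate (Suc K) (\<lambda>i j. w i j t) i)
        = emb q n (\<lambda>i. A ^\<^sub>m Suc K *\<^sub>v xh i) + emb q n (aggregate (Suc K) (\<lambda>i j. w i j t))"
      by (rule emb_add, rule mult_mat_vec_carrier[OF AN xh], assumption, rule agg[OF _ t])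
    moreover have "disag q n (emb q n (\<lambda>i. A ^\<^sub>m Suc K *\<^sub>v xh i)) = (diag q n A ^^ Suc K) (disag q n a)"
      unfolding a_def by (rule disag_pow_emb[OF A xh])
    ultimately show ?thesis
      unfolding z_def by (simp only: c.lin_simps)
  qed
  ultimately show "(\<mu> has_vector_derivative (diag q n A ^^ Suc K) (disag q n a) + z t) (at t within {0..})"
    by simp

  \<comment> \<open>The forcing left over when \<open>aggregate\<close> is differentiated.
    Exchanging the sums over neighbours and powers turns it into the Gramian of the
    Laplacian.\<close>
  define g where "g i = vsum n (\<lambda>j. ctrb_mat A (B i j) (Suc K) *\<^sub>v
      ((ctrb_mat A (B i j) (Suc K))\<^sup>T *\<^sub>v (lam i t - lam j t))) {..<q}" for i
  have gc: "ctrb_mat A (B i j) (Suc K) *\<^sub>v ((ctrb_mat A (B i j) (Suc K))\<^sup>T *\<^sub>v (lam i t - lam j t))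
      \<in> carrier_vec n" if "i < q" "j < q" for i j
    by (rule mult_mat_vec_carrier[OF H[OF that] mult_mat_vec_carrier[OF _ dl[OF that]]])
      (use H[OF that] in simp)
  have g: "g i \<in> carrier_vec n" if "i < q" for i
    unfolding g_def by (rule vsum_carrier) (use gc that in simp)
  have "(z has_vector_derivative disag q n (emb q n (\<lambda>i. - aggregate (Suc K) (\<lambda>i j. w i j t) i - g i)))
      (at t within {0..})"
    unfolding z_def
  proof (rule has_vector_derivative_disag_emb)
    fix i r assume i: "i < q" and r: "r < n"
    show "((\<lambda>s. aggregate (Suc K) (\<lambda>i j. w i j s) i $ r) has_real_derivative
        (- aggregate (Suc K) (\<lambda>i j. w i j t) i - g i) $ r) (at t within {0..})"
      unfolding aggregate_def g_def
      by (rule vsum_flow_derivative[OF t r w[OF i] dw[OF i _ t] H[OF i] H[OF i] dl[OF i]])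
  qed
  moreover have "disag q n (emb q n (\<lambda>i. - aggregate (Suc K) (\<lambda>i j. w i j t) i - g i))
      = - z t - disag q n (emb q n g)"
    unfolding z_def by (rule disag_emb_diff[OF agg[OF _ t] g])
  moreover have "disag q n (emb q n g) = c.G (Suc K) (\<mu> t)"
  proof (rule disag_emb_eqI)
    fix i r assume i: "i < q" and r: "r < n"
    have "g i $ r = (\<Sum>j<q. (ctrb_mat A (B i j) (Suc K) *\<^sub>v
        ((ctrb_mat A (B i j) (Suc K))\<^sup>T *\<^sub>v (lam i t - lam j t))) $ r)"
      unfolding g_def by (rule vsum_index[OF finite_lessThan r]) (use gc i in simp)
    also have "\<dots> = (\<Sum>j<q. \<Sum>l<Suc K. (A ^\<^sub>m l *\<^sub>v (WB i j *\<^sub>v (A\<^sup>T ^\<^sub>m l *\<^sub>v (blk n x i - blk n x j)))) $ r)"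
    proof (rule sum.cong[OF refl])
      fix j assume "j \<in> {..<q}"
      then have j: "j < q" by simp
      show "(ctrb_mat A (B i j) (Suc K) *\<^sub>v
        ((ctrb_mat A (B i j) (Suc K))\<^sup>T *\<^sub>v (lam i t - lam j t))) $ r
        = (\<Sum>l<Suc K. (A ^\<^sub>m l *\<^sub>v (WB i j *\<^sub>v (A\<^sup>T ^\<^sub>m l *\<^sub>v (blk n x i - blk n x j)))) $ r)"
        unfolding blk_x[OF i] blk_x[OF j] WB_def
        by (rule ctrb_gram_index[OF A B_carrier[OF i j] dl[OF i j] r])
    qed
    also have "\<dots> = (\<Sum>l<Suc K. \<Sum>j<q. (A ^\<^sub>m l *\<^sub>v (WB i j *\<^sub>v (A\<^sup>T ^\<^sub>m l *\<^sub>v (blk n x i - blk n x j)))) $ r)"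
      by (rule sum.swap)
    also have "\<dots> = lookup (c.G (Suc K) x) (i, r)"
      unfolding c.G_def lookup_sum LB.lookup_pow_lapl_pow[OF A At i r] ..
    finally show "g i $ r = lookup (c.G (Suc K) (\<mu> t)) (i, r)"
      unfolding x_\<mu>[symmetric] c.G_P .
  qed simp
  ultimately show "(z has_vector_derivative - z t - c.G (Suc K) (\<mu> t)) (at t within {0..})"
    by simp

  define h where "h i = vsum n (\<lambda>j. (B i j * last_block_mat (Suc K) (p i j)) *\<^sub>v
      ((ctrb_mat A (B i j) (Suc K))\<^sup>T *\<^sub>v (lam i t - lam j t))) {..<q}" for i
  have hc: "(B i j * last_block_mat (Suc K) (p i j)) *\<^sub>v
      ((ctrb_mat A (B i j) (Suc K))\<^sup>T *\<^sub>v (lam i t - lam j t)) \<in> carrier_vec n" if "i < q" "j < q" for i j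
    by (rule mult_mat_vec_carrier[OF M[OF that] mult_mat_vec_carrier[OF _ dl[OF that]]])
      (use H[OF that] in simp)
  have h: "h i \<in> carrier_vec n" if "i < q" for i
    unfolding h_def by (rule vsum_carrier) (use hc that in simp)
  have "(v has_vector_derivative disag q n (emb q n (\<lambda>i. - actuation (Suc K) (\<lambda>i j. w i j t) i - h i)))
      (at t within {0..})"
    unfolding v_def
  proof (rule has_vector_derivative_disag_emb)
    fix i r assume i: "i < q" and r: "r < n"
    show "((\<lambda>s. actuation (Suc K) (\<lambda>i j. w i j s) i $ r) has_real_derivative
        (- actuation (Suc K) (\<lambda>i j. w i j t) i - h i) $ r) (at t within {0..})"
      unfolding actuation_def h_def
      by (rule vsum_flow_derivative[OF t r w[OF i] dw[OF i _ t] H[OF i] M[OF i] dl[OF i]])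
  qed
  moreover have "disag q n (emb q n (\<lambda>i. - actuation (Suc K) (\<lambda>i j. w i j t) i - h i))
      = - v t - disag q n (emb q n h)"
    unfolding v_def by (rule disag_emb_diff[OF act[OF _ t] h])
  moreover have "disag q n (emb q n h) = lapl q n WB ((diag q n A\<^sup>T ^^ K) (\<mu> t))"
  proof (rule disag_emb_eqI)
    fix i r assume i: "i < q" and r: "r < n"
    have "h i $ r = (\<Sum>j<q. ((B i j * last_block_mat (Suc K) (p i j)) *\<^sub>v
        ((ctrb_mat A (B i j) (Suc K))\<^sup>T *\<^sub>v (lam i t - lam j t))) $ r)"
      unfolding h_def by (rule vsum_index[OF finite_lessThan r]) (use hc i in simp)
    \<comment> \<open>The power \<open>0\<close> is inserted to fit the shape of
      \<open>lookup_pow_lapl_pow\<close>.\<close>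
    also have "\<dots> = (\<Sum>j<q. (A ^\<^sub>m 0 *\<^sub>v (WB i j *\<^sub>v (A\<^sup>T ^\<^sub>m K *\<^sub>v (blk n x i - blk n x j)))) $ r)"
    proof (rule sum.cong[OF refl])
      fix j assume "j \<in> {..<q}"
      then have j: "j < q" by simp
      have "A\<^sup>T ^\<^sub>m K *\<^sub>v (lam i t - lam j t) \<in> carrier_vec n"
        by (rule mult_mat_vec_carrier[OF pow_carrier_mat[OF At] dl[OF i j]])
      then have "A ^\<^sub>m 0 *\<^sub>v (WB i j *\<^sub>v (A\<^sup>T ^\<^sub>m K *\<^sub>v (lam i t - lam j t)))
          = WB i j *\<^sub>v (A\<^sup>T ^\<^sub>m K *\<^sub>v (lam i t - lam j t))"
        using A LB.W_mult_carrier[OF i j] by simp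
      then show "((B i j * last_block_mat (Suc K) (p i j)) *\<^sub>v
          ((ctrb_mat A (B i j) (Suc K))\<^sup>T *\<^sub>v (lam i t - lam j t))) $ r
        = (A ^\<^sub>m 0 *\<^sub>v (WB i j *\<^sub>v (A\<^sup>T ^\<^sub>m K *\<^sub>v (blk n x i - blk n x j)))) $ r"
        unfolding blk_x[OF i] blk_x[OF j] ctrb_last_block[OF A B_carrier[OF i j] dl[OF i j]]
        by (simp only: WB_def)
    qed
    also have "\<dots> = lookup ((diag q n A ^^ 0) (lapl q n WB ((diag q n A\<^sup>T ^^ K) x))) (i, r)"
      by (rule LB.lookup_pow_lapl_pow[OF A At i r, symmetric])
    also have "(diag q n A ^^ 0) (lapl q n WB ((diag q n A\<^sup>T ^^ K) x)) = lapl q n WB ((diag q n A\<^sup>T ^^ K) (\<mu> t))"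
      unfolding x_\<mu>[symmetric] c.P_funpow_A(2)[symmetric] by simp
    finally show "h i $ r = lookup (lapl q n WB ((diag q n A\<^sup>T ^^ K) (\<mu> t))) (i, r)" .
  qed simp
  ultimately show "(v has_vector_derivative - v t - lapl q n WB ((diag q n A\<^sup>T ^^ K) (\<mu> t))) (at t within {0..})"
    by simp
qed

text \<open>Measured and predicted outputs are both differences seen through \<open>C i j\<close>,
  so the innovation depends on the states and estimates only through the estimation error
  \<open>a\<close>.\<close>

lemma estimation_flow_states:
  assumes flow: "estimation_flow q n A C (Suc K) xh y xi"
    and hor: "horizon (diag q n A\<^sup>T) (diag q n A) (lapl q n WC) (disag q n) E K"
    and x: "\<And>i. i < q \<Longrightarrow> x i \<in> carrier_vec n" and xh: "\<And>i. i < q \<Longrightarrow> xh i \<in> carrier_vec n"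
    and y: "\<And>i j. i < q \<Longrightarrow> j < q \<Longrightarrow> y i j = C i j *\<^sub>v (x i - x j)"
    and t: "0 \<le> t"
  defines "\<xi> \<equiv> \<lambda>t. disag q n (emb q n (\<lambda>i. xi i t))"
    and "a \<equiv> emb q n (\<lambda>i. x i - xh i)"
  shows "\<xi> 0 = 0"
    and "(\<xi> has_vector_derivative
      - horizon.G (diag q n A\<^sup>T) (diag q n A) (lapl q n WC) (Suc K) (\<xi> t)
      + (diag q n A\<^sup>T ^^ K) (lapl q n WC a)) (at t within {0..})"
proof -
  interpret c: horizon "diag q n A\<^sup>T" "diag q n A" "lapl q n WC" "disag q n" E K
    by (rule hor)
  note A = A_carrier
  have At: "A\<^sup>T \<in> carrier_mat n n" using A by simp
  have xi: "xi i s \<in> carrier_vec n" if "i < q" "0 \<le> s" for i s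
    using flow that unfolding estimation_flow_def by blast
  have xi0: "xi i 0 = 0\<^sub>v n" if "i < q" for i
    using flow that unfolding estimation_flow_def by blast
  define g where "g i = vsum n (\<lambda>l. vsum n (\<lambda>j.
      ((A ^\<^sub>m l)\<^sup>T * (C i j)\<^sup>T * C i j * A ^\<^sub>m l) *\<^sub>v (xi i t - xi j t)) {..<q}) {..<Suc K}" for i
  define h where "h i = vsum n (\<lambda>j. ((A ^\<^sub>m K)\<^sup>T * (C i j)\<^sup>T) *\<^sub>v
      (y i j - C i j *\<^sub>v (xh i - xh j))) {..<q}" for i
  have dxi: "vec_has_deriv (xi i) (- g i + h i) t" if "i < q" for i
    using flow that t unfolding estimation_flow_def g_def h_def diff_Suc_1 by blast
  have Al: "A ^\<^sub>m l \<in> carrier_mat n n" for l by (rule pow_carrier_mat[OF A])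
  have dl: "xi i t - xi j t \<in> carrier_vec n" if "i < q" "j < q" for i j
    by (rule minus_carrier_vec[OF xi xi]) (use that t in simp_all)
  have term_g: "((A ^\<^sub>m l)\<^sup>T * (C i j)\<^sup>T * C i j * A ^\<^sub>m l) *\<^sub>v v
      = A\<^sup>T ^\<^sub>m l *\<^sub>v (WC i j *\<^sub>v (A ^\<^sub>m l *\<^sub>v v))" if "i < q" "j < q" "v \<in> carrier_vec n" for i j l v
  proof -
    have C: "C i j \<in> carrier_mat (m i j) n" and Ct: "(C i j)\<^sup>T \<in> carrier_mat n (m i j)"
      using C_carrier[OF that(1,2)] by simp_all
    have Atl: "(A ^\<^sub>m l)\<^sup>T \<in> carrier_mat n n" using Al[of l] by simp
    have u: "A ^\<^sub>m l *\<^sub>v v \<in> carrier_vec n"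
      by (rule mult_mat_vec_carrier[OF Al that(3)])
    have "((A ^\<^sub>m l)\<^sup>T * (C i j)\<^sup>T * C i j * A ^\<^sub>m l) *\<^sub>v v
        = ((A ^\<^sub>m l)\<^sup>T * (C i j)\<^sup>T * C i j) *\<^sub>v (A ^\<^sub>m l *\<^sub>v v)"
      by (rule assoc_mult_mat_vec[OF mult_carrier_mat[OF mult_carrier_mat[OF Atl Ct] C] Al that(3)])
    also have "\<dots> = ((A ^\<^sub>m l)\<^sup>T * WC i j) *\<^sub>v (A ^\<^sub>m l *\<^sub>v v)"
      unfolding WC_def assoc_mult_mat[OF Atl Ct C] ..
    also have "\<dots> = (A ^\<^sub>m l)\<^sup>T *\<^sub>v (WC i j *\<^sub>v (A ^\<^sub>m l *\<^sub>v v))"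
      by (rule assoc_mult_mat_vec[OF Atl WC_carrier[OF that(1,2)] u])
    finally show ?thesis by (simp only: transpose_pow_mat[OF A])
  qed
  have gc: "A\<^sup>T ^\<^sub>m l *\<^sub>v (WC i j *\<^sub>v (A ^\<^sub>m l *\<^sub>v v)) \<in> carrier_vec n"
    if "i < q" "j < q" "v \<in> carrier_vec n" for i j l l' v
    by (intro mult_mat_vec_carrier[OF pow_carrier_mat[OF At]] mult_mat_vec_carrier[OF WC_carrier[OF that(1,2)]]
        mult_mat_vec_carrier[OF Al] that(3))
  have g_inner: "vsum n (\<lambda>j. ((A ^\<^sub>m l)\<^sup>T * (C i j)\<^sup>T * C i j * A ^\<^sub>m l) *\<^sub>v (xi i t - xi j t)) {..<q}
      \<in> carrier_vec n" if "i < q" for i l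
    by (rule vsum_carrier) (use that gc[OF that _ dl] term_g[OF that _ dl] in simp)
  have g: "g i \<in> carrier_vec n" if "i < q" for i
    unfolding g_def by (rule vsum_carrier) (rule g_inner[OF that])
  have term_h: "((A ^\<^sub>m K)\<^sup>T * (C i j)\<^sup>T) *\<^sub>v (y i j - C i j *\<^sub>v (xh i - xh j))
      = A\<^sup>T ^\<^sub>m K *\<^sub>v (WC i j *\<^sub>v (A ^\<^sub>m 0 *\<^sub>v (blk n a i - blk n a j)))" if "i < q" "j < q" for i j
  proof -
    have C: "C i j \<in> carrier_mat (m i j) n" and Ct: "(C i j)\<^sup>T \<in> carrier_mat n (m i j)"
      using C_carrier[OF that] by simp_all
    have AtK: "(A ^\<^sub>m K)\<^sup>T \<in> carrier_mat n n" using Al[of K] by simp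
    have blk_a: "blk n a k = x k - xh k" if "k < q" for k
      unfolding a_def by (rule blk_emb[OF that]) (use x[OF that] xh[OF that] in simp)
    have d: "x i - x j \<in> carrier_vec n" "xh i - xh j \<in> carrier_vec n"
      using x xh that by simp_all
    have "(x i - x j) - (xh i - xh j) = blk n a i - blk n a j"
      unfolding blk_a[OF that(1)] blk_a[OF that(2)] by (rule eq_vecI) (simp_all add: carrier_vecD[OF x[OF that(1)]] carrier_vecD[OF x[OF that(2)]]
        carrier_vecD[OF xh[OF that(1)]] carrier_vecD[OF xh[OF that(2)]])
    then have "y i j - C i j *\<^sub>v (xh i - xh j) = C i j *\<^sub>v (blk n a i - blk n a j)"
      unfolding y[OF that] mult_minus_distrib_mat_vec[OF C d, symmetric] by simp
    then have "((A ^\<^sub>m K)\<^sup>T * (C i j)\<^sup>T) *\<^sub>v (y i j - C i j *\<^sub>v (xh i - xh j))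
        = (A ^\<^sub>m K)\<^sup>T *\<^sub>v ((C i j)\<^sup>T *\<^sub>v (C i j *\<^sub>v (blk n a i - blk n a j)))"
      using assoc_mult_mat_vec[OF AtK Ct, of "C i j *\<^sub>v (blk n a i - blk n a j)"] C by simp
    moreover have "A ^\<^sub>m 0 *\<^sub>v (blk n a i - blk n a j) = blk n a i - blk n a j"
      using A by simp
    ultimately show ?thesis
      using WC_mult[OF that, of "blk n a i - blk n a j"] by (simp add: transpose_pow_mat[OF A])
  qed
  have hc: "A\<^sup>T ^\<^sub>m K *\<^sub>v (WC i j *\<^sub>v (A ^\<^sub>m 0 *\<^sub>v (blk n a i - blk n a j))) \<in> carrier_vec n"
    if "i < q" "j < q" for i j
    by (intro mult_mat_vec_carrier[OF pow_carrier_mat[OF At]] mult_mat_vec_carrier[OF WC_carrier[OF that]]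
        mult_mat_vec_carrier[OF Al] blk_minus_carrier)
  have h: "h i \<in> carrier_vec n" if "i < q" for i
    unfolding h_def by (rule vsum_carrier) (use hc term_h that in simp)
  show "\<xi> 0 = 0"
    unfolding \<xi>_def
    by (rule disag_emb_eqI) (simp_all add: xi0 linear_0[OF bounded_linear.linear[OF bounded_linear_disag]])
  have "(\<xi> has_vector_derivative disag q n (emb q n (\<lambda>i. - g i + h i))) (at t within {0..})"
    unfolding \<xi>_def
  proof (rule has_vector_derivative_disag_emb)
    fix i r assume i: "i < q" and r: "r < n"
    then show "((\<lambda>s. xi i s $ r) has_real_derivative (- g i + h i) $ r) (at t within {0..})"
      using dxi[OF i] carrier_vecD[OF h[OF i]] unfolding vec_has_deriv_def by simp
  qed
  moreover have "disag q n (emb q n (\<lambda>i. - g i + h i)) = - disag q n (emb q n g) + disag q n (emb q n h)"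
  proof -
    have "emb q n (\<lambda>i. - g i + h i) = emb q n (\<lambda>i. - g i) + emb q n h"
      by (rule emb_add) (use g h in simp_all)
    also have "emb q n (\<lambda>i. - g i) = - emb q n g"
      by (rule emb_uminus[OF g])
    finally show ?thesis by (simp only: c.lin_simps)
  qed
  moreover have "disag q n (emb q n g) = c.G (Suc K) (\<xi> t)"
  proof (rule disag_emb_eqI)
    fix i r assume i: "i < q" and r: "r < n"
    define x' where "x' = emb q n (\<lambda>i. xi i t)"
    have blk_x': "blk n x' i = xi i t" if "i < q" for i
      unfolding x'_def by (rule blk_emb[where f = "\<lambda>i. xi i t", OF that xi[OF that t]])
    have "g i $ r = (\<Sum>l<Suc K. vsum n (\<lambda>j.
        ((A ^\<^sub>m l)\<^sup>T * (C i j)\<^sup>T * C i j * A ^\<^sub>m l) *\<^sub>v (xi i t - xi j t)) {..<q} $ r)"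
      unfolding g_def by (rule vsum_index[OF finite_lessThan r g_inner[OF i]])
    also have "\<dots> = (\<Sum>l<Suc K. \<Sum>j<q. (A\<^sup>T ^\<^sub>m l *\<^sub>v (WC i j *\<^sub>v (A ^\<^sub>m l *\<^sub>v (blk n x' i - blk n x' j)))) $ r)"
    proof (rule sum.cong[OF refl])
      fix l
      have "vsum n (\<lambda>j. ((A ^\<^sub>m l)\<^sup>T * (C i j)\<^sup>T * C i j * A ^\<^sub>m l) *\<^sub>v (xi i t - xi j t)) {..<q} $ r
          = (\<Sum>j<q. (((A ^\<^sub>m l)\<^sup>T * (C i j)\<^sup>T * C i j * A ^\<^sub>m l) *\<^sub>v (xi i t - xi j t)) $ r)"
        by (rule vsum_index[OF finite_lessThan r]) (use gc[OF i _ dl] term_g[OF i _ dl] i in simp)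
      then show "vsum n (\<lambda>j. ((A ^\<^sub>m l)\<^sup>T * (C i j)\<^sup>T * C i j * A ^\<^sub>m l) *\<^sub>v (xi i t - xi j t)) {..<q} $ r
          = (\<Sum>j<q. (A\<^sup>T ^\<^sub>m l *\<^sub>v (WC i j *\<^sub>v (A ^\<^sub>m l *\<^sub>v (blk n x' i - blk n x' j)))) $ r)"
        using term_g[OF i _ dl[OF i]] blk_x' i by simp
    qed
    also have "\<dots> = lookup (c.G (Suc K) x') (i, r)"
      unfolding c.G_def lookup_sum LC.lookup_pow_lapl_pow[OF At A i r] ..
    finally show "g i $ r = lookup (c.G (Suc K) (\<xi> t)) (i, r)"
      unfolding \<xi>_def x'_def c.G_P .
  qed simp
  moreover have "disag q n (emb q n h) = (diag q n A\<^sup>T ^^ K) (lapl q n WC a)"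
  proof (rule disag_emb_eqI)
    fix i r assume i: "i < q" and r: "r < n"
    have "h i $ r = (\<Sum>j<q. (((A ^\<^sub>m K)\<^sup>T * (C i j)\<^sup>T) *\<^sub>v (y i j - C i j *\<^sub>v (xh i - xh j))) $ r)"
      unfolding h_def by (rule vsum_index[OF finite_lessThan r]) (use hc term_h i in simp)
    also have "\<dots> = (\<Sum>j<q. (A\<^sup>T ^\<^sub>m K *\<^sub>v (WC i j *\<^sub>v (A ^\<^sub>m 0 *\<^sub>v (blk n a i - blk n a j)))) $ r)"
      using term_h[OF i] by (intro sum.cong refl) simp
    also have "\<dots> = lookup ((diag q n A\<^sup>T ^^ K) (lapl q n WC ((diag q n A ^^ 0) a))) (i, r)"
      by (rule LC.lookup_pow_lapl_pow[OF At A i r, symmetric])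
    finally show "h i $ r = lookup ((diag q n A\<^sup>T ^^ K) (lapl q n WC a)) (i, r)"
      by simp
  qed (simp add: c.P_funpow_A)
  ultimately show "(\<xi> has_vector_derivative - c.G (Suc K) (\<xi> t) + (diag q n A\<^sup>T ^^ K) (lapl q n WC a))
      (at t within {0..})"
    by simp
qed

end

section \<open>Synchronization\<close>

theorem theorem1:
  fixes q n Nc No :: nat
    and p m :: "nat \<Rightarrow> nat \<Rightarrow> nat"
    and A :: "real mat"
    and B C :: "nat \<Rightarrow> nat \<Rightarrow> real mat"
  assumes "relative_array q n p m A B C"
    and "array_controllable q n p A B"
    and "array_observable q n m A C"
    and "Nc \<ge> n" and "No \<ge> n"
  shows "\<exists>\<tau>c_bar \<tau>o_bar :: real. \<forall>\<tau>c \<tau>o. \<tau>c > 0 \<and> \<tau>o > 0 \<and> \<tau>c > \<tau>c_bar \<and> \<tau>o > \<tau>o_bar \<longrightarrow>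
           (\<forall>x y u xh w lam xi.
              array_trajectory q n p A B C u x y \<and>
              sync_algorithm q n p A B C Nc No \<tau>c \<tau>o y u xh w lam xi \<longrightarrow>
              synchronizes q x)"
proof (cases "n = 0")
  \<comment> \<open>For \<open>n = 0\<close> the horizons may be \<open>0\<close> and need not have
    the form \<open>Suc K\<close>; but every state difference is then an empty vector.\<close>
  case True
  have "synchronizes q x" if "array_trajectory q n p A B C u x y" for u x y
  proof -
    have "x i k - x j k \<in> carrier_vec 0" if "i < q" "j < q" for i j k
      using \<open>array_trajectory q n p A B C u x y\<close> that True
      by (intro minus_carrier_vec) (auto simp: array_trajectory_def)
    then have "vnorm (x i k - x j k) = 0" if "i < q" "j < q" for i j k
      using that by (simp add: vnorm_def scalar_prod_lessThan[of _ 0])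
    then show ?thesis
      by (simp add: synchronizes_def)
  qed
  then show ?thesis by blast
next
  case False
  then obtain K K' where K: "Nc = Suc K" and K': "No = Suc K'"
    using assms(4,5) by (metis less_eq_Suc_le neq0_conv not0_implies_Suc le_zero_eq)
  interpret array q n p m A B C
    by unfold_locales (rule assms)
  interpret c: horizon "diag q n A" "diag q n A\<^sup>T" "lapl q n WB" "disag q n" "unit_states q n" K
    by (rule control_horizon) (use assms K in auto)
  interpret o: horizon "diag q n A\<^sup>T" "diag q n A" "lapl q n WC" "disag q n" "unit_states q n" K'
    by (rule estimation_horizon) (use assms K' in auto)
  note A = A_carrier
  have AN: "A ^\<^sub>m l \<in> carrier_mat n n" for l by (rule pow_carrier_mat[OF A])

  \<comment> \<open>The tolerances depend on the ideal closed loops only, so they are available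
    before the stopping times are chosen.\<close>
  obtain \<epsilon>c where \<epsilon>c: "\<epsilon>c > 0" and stable_c: "\<And>x d. d \<longlonglongrightarrow> 0 \<Longrightarrow>
      (\<And>k. norm (x (Suc k) - c.F (x k)) \<le> \<epsilon>c * norm (x k) + d k) \<Longrightarrow> x \<longlonglongrightarrow> 0"
    using c.F_exponentially_stable contraction_robust[OF c.bl_F] by metis
  obtain \<epsilon>o where \<epsilon>o: "\<epsilon>o > 0" and stable_o: "\<And>x d. d \<longlonglongrightarrow> 0 \<Longrightarrow>
      (\<And>k. norm (x (Suc k) - o.F' (x k)) \<le> \<epsilon>o * norm (x k) + d k) \<Longrightarrow> x \<longlonglongrightarrow> 0"
    using o.F'_exponentially_stable contraction_robust[OF o.bl_F'] by metis
  obtain a where a: "a > 0" "\<And>x. norm ((diag q n A ^^ No) x) \<le> norm x * a"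
    using bounded_linear.pos_bounded[OF bounded_linear_funpow[OF c.bl_A]] by blast
  \<comment> \<open>The limit of the estimation flow as a function of the estimation error.\<close>
  define \<Gamma> where "\<Gamma> x = o.Gi ((diag q n A\<^sup>T ^^ K') (lapl q n WC x))" for x
  have "bounded_linear \<Gamma>"
    unfolding \<Gamma>_def
    by (intro bounded_linear_compose[OF o.bl_Gi]
        bounded_linear_compose[OF bounded_linear_funpow[OF o.bl_A]] o.bl_L)
  then obtain h where h: "h > 0" "\<And>x. norm (\<Gamma> x) \<le> norm x * h"
    using bounded_linear.pos_bounded by blast
  have \<Gamma>_P: "\<Gamma> (disag q n x) = \<Gamma> x" for x
    by (simp add: \<Gamma>_def)
  \<comment> \<open>\<open>Tc\<close> is fixed before \<open>a\<close> and the solutions of the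
    flow, so one stopping time serves every \<open>k\<close> and all initial conditions.\<close>
  obtain Tc where "\<forall>\<tau>>Tc. \<forall>a \<mu> z v. \<tau> > 0 \<longrightarrow> \<mu> 0 = 0 \<longrightarrow> z 0 = 0 \<longrightarrow> v 0 = 0 \<longrightarrow>
    (\<forall>t\<ge>0. disag q n (\<mu> t) = \<mu> t \<and>
       (\<mu> has_vector_derivative (diag q n A ^^ Suc K) (disag q n a) + z t) (at t within {0..}) \<and>
       (z has_vector_derivative - z t - c.G (Suc K) (\<mu> t)) (at t within {0..}) \<and>
       (v has_vector_derivative - v t - lapl q n WB ((diag q n A\<^sup>T ^^ K) (\<mu> t))) (at t within {0..})) \<longrightarrow>
    norm (v \<tau> + lapl q n WB ((diag q n A\<^sup>T ^^ K) (c.costate a))) \<le> \<epsilon>c * norm (disag q n a)"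
    by (rule exE[OF c.control_flow_converges[OF \<epsilon>c]])
  note Tc = this[THEN spec, THEN mp, THEN spec, THEN spec, THEN spec, THEN spec,
      THEN mp, THEN mp, THEN mp, THEN mp, THEN mp]
  \<comment> \<open>The error of the stopped flow passes through the power \<open>No\<close> of
    \<open>A\<close>, bounded by \<open>a\<close>, before it reaches the estimate; hence the
    division by \<open>a\<close>.\<close>
  have \<epsilon>oa: "\<epsilon>o / a > 0" using \<epsilon>o a(1) by simp
  obtain To where "\<forall>\<tau>>To. \<forall>a' \<xi>. \<tau> > 0 \<longrightarrow> \<xi> 0 = 0 \<longrightarrow>
    (\<forall>t\<ge>0. disag q n (\<xi> t) = \<xi> t \<and>
       (\<xi> has_vector_derivative - o.G (Suc K') (\<xi> t) + (diag q n A\<^sup>T ^^ K') (lapl q n WC a')) (at t within {0..})) \<longrightarrow>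
    norm (\<xi> \<tau> - o.Gi ((diag q n A\<^sup>T ^^ K') (lapl q n WC a'))) \<le> \<epsilon>o / a * norm (disag q n a')"
    by (rule exE[OF o.estimation_flow_converges[OF \<epsilon>oa]])
  note To = this[THEN spec, THEN mp, THEN spec, THEN spec, THEN mp, THEN mp, THEN mp, folded \<Gamma>_def]

  show ?thesis
  proof (rule exI[of _ Tc], rule exI[of _ To], intro allI impI)
    fix \<tau>c \<tau>o x y u xh w lam xi
    assume \<tau>: "0 < \<tau>c \<and> 0 < \<tau>o \<and> Tc < \<tau>c \<and> To < \<tau>o"
      and "array_trajectory q n p A B C u x y \<and>
        sync_algorithm q n p A B C Nc No \<tau>c \<tau>o y u xh w lam xi"
    then have traj: "array_trajectory q n p A B C u x y"
      and alg: "sync_algorithm q n p A B C Nc No \<tau>c \<tau>o y u xh w lam xi"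
      by auto
    have x: "x i k \<in> carrier_vec n"
      and x_Suc: "x i (Suc k) = A *\<^sub>v x i k + vsum n (\<lambda>j. B i j *\<^sub>v u i j k) {..<q}" if "i < q" for i k
      using traj that unfolding array_trajectory_def by blast+
    have u: "u i j k \<in> carrier_vec (p i j)"
      and y: "y i j k = C i j *\<^sub>v (x i k - x j k)" if "i < q" "j < q" for i j k
      using traj that unfolding array_trajectory_def by blast+
    have xh: "xh i k \<in> carrier_vec n"
      and xh_Suc: "xh i (Suc k) = A *\<^sub>v xh i k + A ^\<^sub>m No *\<^sub>v xi i k \<tau>o
          + vsum n (\<lambda>j. B i j *\<^sub>v u i j k) {..<q}" if "i < q" for i k
      using alg that unfolding sync_algorithm_def by blast+
    have u_eq: "u i j k = last_block_mat Nc (p i j) *\<^sub>v w i j k \<tau>c" if "i < q" "j < q" for i j k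
      using alg that unfolding sync_algorithm_def by blast
    have cflow: "control_flow q n p A B (Suc K) (\<lambda>i. xh i k) (\<lambda>i j. w i j k) (\<lambda>i. lam i k)" for k
      using alg unfolding sync_algorithm_def K by blast
    have oflow: "estimation_flow q n A C (Suc K') (\<lambda>i. xh i k) (\<lambda>i j. y i j k) (\<lambda>i. xi i k)" for k
      using alg unfolding sync_algorithm_def K' by blast
    have w: "w i j k \<tau>c \<in> carrier_vec (Suc K * p i j)" if "i < q" "j < q" for i j k
      using cflow[of k] that \<tau> unfolding control_flow_def by (meson less_imp_le)
    have xi: "xi i k \<tau>o \<in> carrier_vec n" if "i < q" for i k
      using oflow[of k] that \<tau> unfolding estimation_flow_def by (meson less_imp_le)
    have Bu: "vsum n (\<lambda>j. B i j *\<^sub>v u i j k) {..<q} \<in> carrier_vec n" if "i < q" for i k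
      by (rule vsum_carrier, rule mult_mat_vec_carrier[OF B_carrier u]) (use that in simp_all)
    have e: "x i k - xh i k \<in> carrier_vec n" if "i < q" for i k
      using x[OF that] xh[OF that] by simp

    define e0 where "e0 k = emb q n (\<lambda>i. x i k - xh i k)" for k
    define X0 where "X0 k = emb q n (\<lambda>i. xh i k)" for k
    define \<Xi> where "\<Xi> k = disag q n (emb q n (\<lambda>i. xi i k \<tau>o))" for k
    define V where "V k = disag q n (emb q n (actuation (Suc K) (\<lambda>i j. w i j k \<tau>c)))" for k
    define E where "E k = disag q n (e0 k)" for k
    define X where "X k = disag q n (X0 k)" for k

    have disag_A: "disag q n (emb q n (\<lambda>i. A *\<^sub>v f i)) = diag q n A (disag q n (emb q n f))"
      if "\<And>i. i < q \<Longrightarrow> f i \<in> carrier_vec n" for f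
      using disag_pow_emb[where l = "Suc 0" and f = f and q = q, OF A that] A by simp

    have \<Xi>: "norm (\<Xi> k - \<Gamma> (e0 k)) \<le> \<epsilon>o / a * norm (E k)" for k
      unfolding \<Xi>_def E_def
    proof (rule To)
      note states = estimation_flow_states[OF oflow[of k] o.horizon_axioms x xh y]
      show "disag q n (emb q n (\<lambda>i. xi i k 0)) = 0"
        by (rule states(1)[of 0]) simp_all
      show "\<forall>t\<ge>0. disag q n (disag q n (emb q n (\<lambda>i. xi i k t))) = disag q n (emb q n (\<lambda>i. xi i k t)) \<and>
        ((\<lambda>t. disag q n (emb q n (\<lambda>i. xi i k t))) has_vector_derivative
          - o.G (Suc K') (disag q n (emb q n (\<lambda>i. xi i k t))) + (diag q n A\<^sup>T ^^ K') (lapl q n WC (e0 k)))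
          (at t within {0..})"
        unfolding e0_def by (intro allI impI conjI o.P_idem states(2))
    qed (use \<tau> in auto)

    have V: "norm (V k + lapl q n WB ((diag q n A\<^sup>T ^^ K) (c.costate (X0 k)))) \<le> \<epsilon>c * norm (X k)" for k
      unfolding V_def X_def
    proof (rule Tc)
      note states = control_flow_states[OF cflow[of k] c.horizon_axioms xh]
      show "disag q n (emb q n (\<lambda>i. lam i k 0)) = 0"
        "disag q n (emb q n (aggregate (Suc K) (\<lambda>i j. w i j k 0))) = 0"
        "disag q n (emb q n (actuation (Suc K) (\<lambda>i j. w i j k 0))) = 0"
        by (rule states(1-3)[of 0]; simp)+
      show "\<forall>t\<ge>0. disag q n (disag q n (emb q n (\<lambda>i. lam i k t))) = disag q n (emb q n (\<lambda>i. lam i k t)) \<and>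
        ((\<lambda>t. disag q n (emb q n (\<lambda>i. lam i k t))) has_vector_derivative
          (diag q n A ^^ Suc K) (disag q n (X0 k)) + disag q n (emb q n (aggregate (Suc K) (\<lambda>i j. w i j k t))))
          (at t within {0..}) \<and>
        ((\<lambda>t. disag q n (emb q n (aggregate (Suc K) (\<lambda>i j. w i j k t)))) has_vector_derivative
          - disag q n (emb q n (aggregate (Suc K) (\<lambda>i j. w i j k t)))
          - c.G (Suc K) (disag q n (emb q n (\<lambda>i. lam i k t)))) (at t within {0..}) \<and>
        ((\<lambda>t. disag q n (emb q n (actuation (Suc K) (\<lambda>i j. w i j k t)))) has_vector_derivative
          - disag q n (emb q n (actuation (Suc K) (\<lambda>i j. w i j k t)))
          - lapl q n WB ((diag q n A\<^sup>T ^^ K) (disag q n (emb q n (\<lambda>i. lam i k t))))) (at t within {0..})"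
        unfolding X0_def by (intro allI impI conjI c.P_idem states(4-6))
    qed (use \<tau> in auto)

    have disag_\<Xi>: "disag q n (emb q n (\<lambda>i. A ^\<^sub>m No *\<^sub>v xi i k \<tau>o)) = (diag q n A ^^ No) (\<Xi> k)" for k
      unfolding \<Xi>_def by (rule disag_pow_emb[OF A xi])
    \<comment> \<open>Array and estimator receive the same inputs, which therefore cancel: the
      recursion for \<open>E\<close> contains no control term, and the two loops form a
      cascade.\<close>
    have E_Suc: "E (Suc k) = diag q n A (E k) - (diag q n A ^^ No) (\<Xi> k)" for k
    proof -
      have "x i (Suc k) - xh i (Suc k) = A *\<^sub>v (x i k - xh i k) - A ^\<^sub>m No *\<^sub>v xi i k \<tau>o" if i: "i < q" for i
      proof (rule eq_vecI)
        have Axi: "A ^\<^sub>m No *\<^sub>v xi i k \<tau>o \<in> carrier_vec n"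
          by (rule mult_mat_vec_carrier[OF AN xi[OF i]])
        note dims = carrier_vecD[OF Axi] carrier_vecD[OF Bu[OF i]] carrier_matD[OF A]
          carrier_vecD[OF x[OF i]] carrier_vecD[OF xh[OF i]]
        show "dim_vec (x i (Suc k) - xh i (Suc k)) = dim_vec (A *\<^sub>v (x i k - xh i k) - A ^\<^sub>m No *\<^sub>v xi i k \<tau>o)"
          by (simp only: index_minus_vec(2) dims)
        fix r assume "r < dim_vec (A *\<^sub>v (x i k - xh i k) - A ^\<^sub>m No *\<^sub>v xi i k \<tau>o)"
        then have r: "r < n" by (simp only: index_minus_vec(2) dims)
        then show "(x i (Suc k) - xh i (Suc k)) $ r = (A *\<^sub>v (x i k - xh i k) - A ^\<^sub>m No *\<^sub>v xi i k \<tau>o) $ r"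
          unfolding x_Suc[OF i] xh_Suc[OF i] mult_minus_distrib_mat_vec[OF A x[OF i] xh[OF i]]
          by (simp add: dims del: index_mult_mat_vec)
      qed
      then have "e0 (Suc k) = emb q n (\<lambda>i. A *\<^sub>v (x i k - xh i k) - A ^\<^sub>m No *\<^sub>v xi i k \<tau>o)"
        unfolding e0_def by (intro emb_cong) simp
      also have "\<dots> = emb q n (\<lambda>i. A *\<^sub>v (x i k - xh i k)) - emb q n (\<lambda>i. A ^\<^sub>m No *\<^sub>v xi i k \<tau>o)"
        by (rule emb_minus, rule mult_mat_vec_carrier[OF A e], assumption,
            rule mult_mat_vec_carrier[OF AN xi])
      finally have "E (Suc k) = disag q n (emb q n (\<lambda>i. A *\<^sub>v (x i k - xh i k)))
          - disag q n (emb q n (\<lambda>i. A ^\<^sub>m No *\<^sub>v xi i k \<tau>o))"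
        by (simp only: E_def c.lin_simps)
      moreover have "disag q n (emb q n (\<lambda>i. A *\<^sub>v (x i k - xh i k))) = diag q n A (E k)"
        unfolding E_def e0_def by (rule disag_A[OF e])
      ultimately show ?thesis by (simp only: disag_\<Xi>)
    qed
    have E_step: "norm (E (Suc k) - o.F' (E k)) \<le> \<epsilon>o * norm (E k) + 0" for k
    proof -
      have "o.F' (E k) = diag q n A (E k) - (diag q n A ^^ No) (\<Gamma> (e0 k))"
        unfolding o.F'_def by (simp only: E_def o.P_idem o.L_P \<Gamma>_def K')
      then have "E (Suc k) - o.F' (E k) = - (diag q n A ^^ No) (\<Xi> k - \<Gamma> (e0 k))"
        unfolding E_Suc by (simp add: c.lin_pow_simps)
      then have "norm (E (Suc k) - o.F' (E k)) \<le> norm (\<Xi> k - \<Gamma> (e0 k)) * a"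
        using a(2) by simp
      also have "\<dots> \<le> (\<epsilon>o / a * norm (E k)) * a"
        using \<Xi> a(1) by (intro mult_right_mono) auto
      finally show ?thesis using a(1) by simp
    qed
    have E_lim: "E \<longlonglongrightarrow> 0"
      by (rule stable_o[where x = E and d = "\<lambda>_. 0", OF tendsto_const E_step])

    have X_Suc: "X (Suc k) = diag q n A (X k) + (diag q n A ^^ No) (\<Xi> k) + V k" for k
    proof -
      have act: "vsum n (\<lambda>j. B i j *\<^sub>v u i j k) {..<q} = actuation (Suc K) (\<lambda>i j. w i j k \<tau>c) i" if i: "i < q" for i
        unfolding actuation_def
      proof (rule vsum_cong)
        fix j assume "j \<in> {..<q}"
        then have j: "j < q" by simp
        have L: "last_block_mat (Suc K) (p i j) \<in> carrier_mat (p i j) (Suc K * p i j)"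
          by (simp add: last_block_mat_def kron_def)
        show eq: "B i j *\<^sub>v u i j k = (B i j * last_block_mat (Suc K) (p i j)) *\<^sub>v w i j k \<tau>c"
          unfolding u_eq[OF i j] K by (rule assoc_mult_mat_vec[OF B_carrier[OF i j] L w[OF i j], symmetric])
        show "(B i j * last_block_mat (Suc K) (p i j)) *\<^sub>v w i j k \<tau>c \<in> carrier_vec n"
          unfolding eq[symmetric] by (rule mult_mat_vec_carrier[OF B_carrier[OF i j] u[OF i j]])
      qed
      have Axh: "A *\<^sub>v xh i k \<in> carrier_vec n" if "i < q" for i
        by (rule mult_mat_vec_carrier[OF A xh[OF that]])
      have Axi: "A ^\<^sub>m No *\<^sub>v xi i k \<tau>o \<in> carrier_vec n" if "i < q" for i
        by (rule mult_mat_vec_carrier[OF AN xi[OF that]])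
      have actc: "actuation (Suc K) (\<lambda>i j. w i j k \<tau>c) i \<in> carrier_vec n" if "i < q" for i
        using Bu[OF that, of k] act[OF that] by simp
      have "X0 (Suc k) = emb q n (\<lambda>i. (A *\<^sub>v xh i k + A ^\<^sub>m No *\<^sub>v xi i k \<tau>o) + actuation (Suc K) (\<lambda>i j. w i j k \<tau>c) i)"
        unfolding X0_def by (intro emb_cong) (simp only: xh_Suc act)
      also have "\<dots> = emb q n (\<lambda>i. A *\<^sub>v xh i k + A ^\<^sub>m No *\<^sub>v xi i k \<tau>o)
          + emb q n (actuation (Suc K) (\<lambda>i j. w i j k \<tau>c))"
        by (rule emb_add, rule add_carrier_vec[OF Axh Axi], assumption+, rule actc)
      also have "emb q n (\<lambda>i. A *\<^sub>v xh i k + A ^\<^sub>m No *\<^sub>v xi i k \<tau>o)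
          = emb q n (\<lambda>i. A *\<^sub>v xh i k) + emb q n (\<lambda>i. A ^\<^sub>m No *\<^sub>v xi i k \<tau>o)"
        by (rule emb_add[OF Axh Axi])
      finally have "X (Suc k) = disag q n (emb q n (\<lambda>i. A *\<^sub>v xh i k))
          + disag q n (emb q n (\<lambda>i. A ^\<^sub>m No *\<^sub>v xi i k \<tau>o)) + V k"
        by (simp only: X_def V_def c.lin_simps)
      moreover have "disag q n (emb q n (\<lambda>i. A *\<^sub>v xh i k)) = diag q n A (X k)"
        unfolding X_def X0_def by (rule disag_A[OF xh])
      ultimately show ?thesis by (simp only: disag_\<Xi>)
    qed
    \<comment> \<open>\<open>norm (\<Xi> k)\<close> is at most \<open>\<epsilon>o / a + h\<close>
      times \<open>norm (E k)\<close>: the error of the stopped flow plus the bound \<open>h\<close>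
      of its limit \<open>\<Gamma>\<close>. The factor \<open>a\<close> accounts for the power of
      \<open>A\<close> applied to \<open>\<Xi> k\<close>.\<close>
    define d where "d k = a * (\<epsilon>o / a + h) * norm (E k)" for k
    have "d \<longlonglongrightarrow> a * (\<epsilon>o / a + h) * 0"
      unfolding d_def by (intro tendsto_mult tendsto_const tendsto_norm_zero E_lim)
    then have d: "d \<longlonglongrightarrow> 0" by simp
    have "norm (X (Suc k) - c.F (X k)) \<le> \<epsilon>c * norm (X k) + d k" for k
    proof -
      have "c.F (X k) = diag q n A (X k) - lapl q n WB ((diag q n A\<^sup>T ^^ K) (c.costate (X0 k)))"
        unfolding c.F_costate by (simp only: X_def c.P_idem c.costate_P)
      then have "X (Suc k) - c.F (X k)
          = (diag q n A ^^ No) (\<Xi> k) + (V k + lapl q n WB ((diag q n A\<^sup>T ^^ K) (c.costate (X0 k))))"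
        unfolding X_Suc by simp
      then have "norm (X (Suc k) - c.F (X k)) \<le> norm ((diag q n A ^^ No) (\<Xi> k))
          + norm (V k + lapl q n WB ((diag q n A\<^sup>T ^^ K) (c.costate (X0 k))))"
        by (simp only: norm_triangle_ineq)
      moreover have "norm ((diag q n A ^^ No) (\<Xi> k)) \<le> d k"
      proof -
        have "norm (\<Xi> k) \<le> norm (\<Xi> k - \<Gamma> (e0 k)) + norm (\<Gamma> (e0 k))"
          using norm_triangle_ineq[of "\<Xi> k - \<Gamma> (e0 k)" "\<Gamma> (e0 k)"] by simp
        also have "\<dots> \<le> \<epsilon>o / a * norm (E k) + norm (E k) * h"
          using \<Xi>[of k] h(2)[of "E k"] by (simp add: E_def \<Gamma>_P)
        finally have "norm (\<Xi> k) * a \<le> (\<epsilon>o / a * norm (E k) + norm (E k) * h) * a"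
          using a(1) by (intro mult_right_mono) auto
        also have "\<dots> = d k"
          by (simp add: d_def distrib_left distrib_right ac_simps)
        finally show ?thesis
          using a(2)[of "\<Xi> k"] by linarith
      qed
      ultimately show ?thesis
        using V[of k] by linarith
    qed
    then have X_lim: "X \<longlonglongrightarrow> 0"
      by (rule stable_c[where x = X and d = d, OF d])
    show "synchronizes q x"
    proof (rule synchronizes_of_disag[OF x])
      have "emb q n (\<lambda>i. x i k) = e0 k + X0 k" for k
      proof -
        have "emb q n (\<lambda>i. x i k) = emb q n (\<lambda>i. (x i k - xh i k) + xh i k)"
          using x xh by (intro emb_cong) (simp add: carrier_vecD[OF x] carrier_vecD[OF xh])
        then show ?thesis
          unfolding e0_def X0_def using emb_add[OF e xh] by simp
      qed
      then have "disag q n (emb q n (\<lambda>i. x i k)) = E k + X k" for k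
        by (simp only: E_def X_def c.lin_simps)
      then show "(\<lambda>k. disag q n (emb q n (\<lambda>i. x i k))) \<longlonglongrightarrow> 0"
        using tendsto_add[OF E_lim X_lim] by simp
    qed
  qed
qed

end
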